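(* For every $\mathbf v\in\mathbb Z_{\ge0}^n$, with $\mathbf V$ an $I$-graded vector space of graded dimension $\mathbf v$, the irreducible components of $\mathcal L(\mathbf v,\mathbf w^n)$ (resp. $\mathcal L(\mathbf v,\mathbf w^{n-1})$) are precisely the sets $$X_{\mathcal O}=\Big(\big(\overline{\mathcal C_{\mathcal O}}\times\textstyle\bigoplus_{i\in I}\mathrm{Hom}(\mathbf V_i,\mathbf W_i)\big)\cap\Lambda(\mathbf v,\mathbf w)^{\mathrm{st}}\Big)/G_{\mathbf V},\qquad \mathbf w=\mathbf w^n\ (\text{resp. }\mathbf w=\mathbf w^{n-1}),$$ where $\mathcal O$ is the $G_{\mathbf V}$-orbit in $\mathbf E_{\mathbf V,\Omega}$ of all representations on $\mathbf V$ isomorphic to $\bigoplus_{(k',k)\in A_Y^+}(\mathbf V(k',k),x(k',k))$ (resp. $\bigoplus_{(k',k)\in A_Y^-}(\mathbf V(k',k),x(k',k))$) for some $Y\in\mathcal Y$ for which this direct sum has graded dimension $\mathbf v$. Denote the component so obtained from $Y$ by $X_Y^+$ (resp. $X_Y^-$). Thus $Y\mapsto X_Y^+$ (resp. $Y\mapsto X_Y^-$) is a one-to-one correspondence between $\mathcal Y$ and the set of irreducible components of $\bigcup_{\mathbf v}\mathcal L(\mathbf v,\mathbf w^n)$ (resp. $\bigcup_{\mathbf v}\mathcal L(\mathbf v,\mathbf w^{n-1})$).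
   Context: Quiver. Let $n\ge4$ and let $I=\{1,\dots,n\}$ be the vertex set of the Dynkin graph of type $D_n$, with edges $i - (i+1)$ for $1\le i\le n-2$ and $(n-2) - n$. $H$ is the set of edges with an orientation; $\mathrm{out}(h)$ is the source and $\mathrm{in}(h)$ the target of $h\in H$; $\bar h$ is the same edge with opposite orientation; $h_{i,j}$ is the oriented edge with $\mathrm{out}=i$, $\mathrm{in}=j$. Let $\Omega=\{h_{i,i+1}:1\le i\le n-2\}\cup\{h_{n-2,n}\}$, and $\varepsilon(h)=1$ for $h\in\Omega$, $\varepsilon(h)=-1$ for $h\in\bar\Omega=H\setminus\Omega$. For a finite-dimensional $I$-graded complex vector space $\mathbf V=\bigoplus_i\mathbf V_i$, let $\mathbf E_{\mathbf V}=\bigoplus_{h\in H}\mathrm{Hom}(\mathbf V_{\mathrm{out}(h)},\mathbf V_{\mathrm{in}(h)})$, let $\mathbf E_{\mathbf V,\Omega}$ be the subspace of $x=(x_h)$ with $x_h=0$ for $h\notin\Omega$, and let $G_{\mathbf V}=\prod_i\mathrm{Aut}(\mathbf V_i)$ act by $(gx)_h=g_{\mathrm{in}(h)}x_hg_{\mathrm{out}(h)}^{-1}$. The symplectic form $\langle x,y\rangle=\sum_{h\in H}\varepsilon(h)\,\mathrm{tr}(x_hy_{\bar h})$ identifies $\mathbf E_{\mathbf V}$ with the cotangent bundle of $\mathbf E_{\mathbf V,\Omega}$. For a $G_{\mathbf V}$-orbit $\mathcal O\subset\mathbf E_{\mathbf V,\Omega}$, $\mathcal C_{\mathcal O}\subset\mathbf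 E_{\mathbf V}$ is its conormal bundle and $\overline{\mathcal C_{\mathcal O}}$ the closure. Put $\psi_i(x)=\sum_{h:\mathrm{in}(h)=i}\varepsilon(h)x_hx_{\bar h}\in\mathrm{End}(\mathbf V_i)$. An element $x\in\mathbf E_{\mathbf V}$ is nilpotent if there is $N\ge1$ such that every composition $x_{h_1'}\cdots x_{h_N'}$ along composable oriented edges ($\mathrm{out}(h'_j)=\mathrm{in}(h'_{j+1})$) is zero. $\Lambda_{\mathbf V}$ is the set of nilpotent $x$ with $\psi_i(x)=0$ for all $i$. For $\mathbf v,\mathbf w\in\mathbb Z_{\ge0}^I$ choose $I$-graded spaces $\mathbf V,\mathbf W$ of graded dimensions $\mathbf v,\mathbf w$; $\Lambda(\mathbf v,\mathbf w)=\Lambda_{\mathbf V}\times\bigoplus_i\mathrm{Hom}(\mathbf V_i,\mathbf W_i)$, with elements $(x,j)$. $\Lambda(\mathbf v,\mathbf w)^{\mathrm{st}}$ is the set of $(x,j)$ such that every $I$-graded subspace $\mathbf S\subset\mathbf V$ with $x(\mathbf S)\subset\mathbf S$ and $j_i(\mathbf S_i)=0$ for all $i$ is zero. $G_{\mathbf V}$ acts by $(x,j)\mapsto((g_{\mathrm{in}(h)}x_hg_{\mathrm{out}(h)}^{-1}),(j_ig_i^{-1}))$, with trivial stabilizers on $\Lambda(\mathbf v,\mathbf w)^{\mathrm{st}}$, and $\mathcal L(\mathbf v,\mathbf w)=\Lambda(\mathbf v,\mathbf w)^{\mathrm{st}}/G_{\mathbf V}$. Let $\mathbf w^i$ be given by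 $\mathbf w^i_j=\delta_{ij}$. Unions over $\mathbf v$ are disjoint unions. String representations. For $1\le k'\le k\le n-1$, $\mathbf V(k',k)$ has basis $e_r$ ($k'\le r\le k$), $e_r$ of degree $r$, and $x(k',k)\in\mathbf E_{\mathbf V(k',k),\Omega}$ has $x(k',k)_{h_{r,r+1}}(e_r)=e_{r+1}$ for $k'\le r<k$, all other components zero. For $1\le k'\le n-2$ or $k'=n$, $\mathbf V(k',n)$ has basis $\{e_r: k'\le r\le n-2\text{ or }r=n\}$, $e_r$ of degree $r$, and $x(k',n)$ has $x(k',n)_{h_{r,r+1}}(e_r)=e_{r+1}$ for $k'\le r<n-2$, $x(k',n)_{h_{n-2,n}}(e_{n-2})=e_n$ (when $k'\le n-2$), all other components zero. Young diagrams. $\mathcal Y$ is the set of strictly decreasing sequences $Y=(l_1>\dots>l_s)$ of positive integers, $s\ge0$, with $l_1\le n-1$. For $Y\in\mathcal Y$ and $1\le i\le s$: $A^+_{l_i}=(n-l_i,n)$ if $i$ is odd and $l_i>1$; $(n,n)$ if $i$ is odd and $l_i=1$; $(n-l_i,n-1)$ if $i$ is even. $A^-_{l_i}=(n-l_i,n)$ if $i$ is even and $l_i>1$; $(n,n)$ if $i$ is even and $l_i=1$; $(n-l_i,n-1)$ if $i$ is odd. $A_Y^\pm=\{A_{l_1}^\pm,\dots,A_{l_s}^\pm\}$. *)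

theory Defs
  imports
    "HOL-Analysis.Sum_Topology"
    "Jordan_Normal_Form.VS_Connect"
begin

section \<open>Zariski topology, quotient topology, irreducible components\<close>

text \<open>Polynomial functions are the algebra of functions generated by a set of coordinate
  functions.  A point of an affine space is any object determined by its coordinates.\<close>

inductive_set polyfuns :: "('a \<Rightarrow> complex) set \<Rightarrow> ('a \<Rightarrow> complex) set"
  for C :: "('a \<Rightarrow> complex) set" where
  const: "(\<lambda>_. c) \<in> polyfuns C"
| coord: "f \<in> C \<Longrightarrow> f \<in> polyfuns C"
| add: "f \<in> polyfuns C \<Longrightarrow> g \<in> polyfuns C \<Longrightarrow> (\<lambda>p. f p + g p) \<in> polyfuns C"
| mult: "f \<in> polyfuns C \<Longrightarrow> g \<in> polyfuns C \<Longrightarrow> (\<lambda>p. f p * g p) \<in> polyfuns C"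

definition zariski :: "('a \<Rightarrow> complex) set \<Rightarrow> 'a set \<Rightarrow> 'a topology" where
  "zariski C M = topology (\<lambda>U. \<exists>F \<subseteq> polyfuns C. U = {p \<in> M. \<exists>f \<in> F. f p \<noteq> 0})"

lemma istopology_zariski:
  "istopology (\<lambda>U. \<exists>F \<subseteq> polyfuns C. U = {p \<in> M. \<exists>f \<in> F. f p \<noteq> 0})"
proof -
  define D where "D F = {p \<in> M. \<exists>f \<in> F. f p \<noteq> 0}" for F :: "('a \<Rightarrow> complex) set"
  have inter: "\<exists>H \<subseteq> polyfuns C. D F \<inter> D F' = D H"
    if F: "F \<subseteq> polyfuns C" "F' \<subseteq> polyfuns C" for F F'
  proof (intro exI conjI)
    let ?H = "(\<lambda>(f, g) p. f p * g p) ` (F \<times> F')"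
    show "?H \<subseteq> polyfuns C" using F by (auto intro!: polyfuns.mult)
    show "D F \<inter> D F' = D ?H" unfolding D_def by auto
  qed
  have union: "\<Union>(D ` \<F>) = D (\<Union>\<F>)" for \<F>
    unfolding D_def by blast
  have Union: "\<exists>H \<subseteq> polyfuns C. \<Union>K = D H" if "\<forall>U\<in>K. \<exists>F \<subseteq> polyfuns C. U = D F" for K
  proof -
    have "K \<subseteq> D ` Pow (polyfuns C)" using that by blast
    then obtain \<F> where "\<F> \<subseteq> Pow (polyfuns C)" "K = D ` \<F>"
      by (auto simp: subset_image_iff)
    then show ?thesis by (intro exI[of _ "\<Union>\<F>"]) (auto simp: union)
  qed
  show ?thesis
    unfolding istopology_def D_def[symmetric]
  proof (intro conjI allI impI)
    fix S T assume "\<exists>F \<subseteq> polyfuns C. S = D F" "\<exists>F \<subseteq> polyfuns C. T = D F"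
    then obtain F F' where "F \<subseteq> polyfuns C" "S = D F" "F' \<subseteq> polyfuns C" "T = D F'"
      by (elim exE conjE)
    then show "\<exists>H \<subseteq> polyfuns C. S \<inter> T = D H" by (simp only: inter)
  next
    fix K assume "\<forall>U\<in>K. \<exists>F \<subseteq> polyfuns C. U = D F"
    then show "\<exists>H \<subseteq> polyfuns C. \<Union>K = D H" by (rule Union)
  qed
qed

lemma openin_zariski:
  "openin (zariski C M) U \<longleftrightarrow> (\<exists>F \<subseteq> polyfuns C. U = {p \<in> M. \<exists>f \<in> F. f p \<noteq> 0})"
  unfolding zariski_def by (simp add: topology_inverse'[OF istopology_zariski])

definition quotient_topology :: "'a topology \<Rightarrow> ('a \<Rightarrow> 'b) \<Rightarrow> 'b topology" where
  "quotient_topology X q =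
     topology (\<lambda>U. U \<subseteq> q ` topspace X \<and> openin X {p \<in> topspace X. q p \<in> U})"

lemma istopology_quotient:
  "istopology (\<lambda>U. U \<subseteq> q ` topspace X \<and> openin X {p \<in> topspace X. q p \<in> U})"
proof -
  have 1: "{p \<in> topspace X. q p \<in> S \<inter> T}
      = {p \<in> topspace X. q p \<in> S} \<inter> {p \<in> topspace X. q p \<in> T}" for S T
    by auto
  have 2: "{p \<in> topspace X. q p \<in> \<Union>K} = (\<Union>U\<in>K. {p \<in> topspace X. q p \<in> U})" for K
    by auto
  show ?thesis unfolding istopology_def 1 2 by blast
qed

lemma openin_quotient_topology:
  "openin (quotient_topology X q) U \<longleftrightarrow>
     U \<subseteq> q ` topspace X \<and> openin X {p \<in> topspace X. q p \<in> U}"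
  unfolding quotient_topology_def by (simp add: topology_inverse'[OF istopology_quotient])

definition irreducible_in :: "'a topology \<Rightarrow> 'a set \<Rightarrow> bool" where
  "irreducible_in X S \<longleftrightarrow> S \<subseteq> topspace X \<and> S \<noteq> {} \<and>
     (\<forall>A B. closedin X A \<and> closedin X B \<and> S \<subseteq> A \<union> B \<longrightarrow> S \<subseteq> A \<or> S \<subseteq> B)"

definition irreducible_components :: "'a topology \<Rightarrow> 'a set set" where
  "irreducible_components X =
     {S. irreducible_in X S \<and> (\<forall>T. irreducible_in X T \<and> S \<subseteq> T \<longrightarrow> T = S)}"


section \<open>The quiver of type \<open>D\<^sub>n\<close> and its representations\<close>

text \<open>The oriented edge \<open>h\<^bsub>i,j\<^esub>\<close> is the pair \<open>(i, j)\<close>, and \<open>prod.swap\<close> reverses it.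
  The graded spaces \<open>V\<close> and \<open>W\<close> are the coordinate spaces of complex vectors of length
  \<open>v i\<close> resp. \<open>w i\<close> in degree \<open>i\<close>, so that linear maps are matrices.
  Families indexed by vertices or edges, including dimension vectors, are extensional
  functions, so that each mathematical family is represented exactly once.\<close>

type_synonym edge = "nat \<times> nat"
type_synonym rep = "edge \<Rightarrow> complex mat"
type_synonym vfam = "nat \<Rightarrow> complex mat"

abbreviation source :: "edge \<Rightarrow> nat" where "source \<equiv> fst"
abbreviation target :: "edge \<Rightarrow> nat" where "target \<equiv> snd"

definition vertices :: "nat \<Rightarrow> nat set" where
  "vertices n = {1..n}"

definition Omega :: "nat \<Rightarrow> edge set" where
  "Omega n = {(i, i + 1) | i. 1 \<le> i \<and> i \<le> n - 2} \<union> {(n - 2, n)}"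

definition edges :: "nat \<Rightarrow> edge set" where
  "edges n = Omega n \<union> prod.swap ` Omega n"

definition eps :: "nat \<Rightarrow> edge \<Rightarrow> complex" where
  "eps n h = (if h \<in> Omega n then 1 else - 1)"

definition dimvecs :: "nat \<Rightarrow> (nat \<Rightarrow> nat) set" where
  "dimvecs n = vertices n \<rightarrow>\<^sub>E UNIV"

definition E :: "nat \<Rightarrow> (nat \<Rightarrow> nat) \<Rightarrow> rep set" where
  "E n v = (\<Pi>\<^sub>E h\<in>edges n. carrier_mat (v (target h)) (v (source h)))"

definition E_Omega :: "nat \<Rightarrow> (nat \<Rightarrow> nat) \<Rightarrow> rep set" where
  "E_Omega n v = {x \<in> E n v. \<forall>h \<in> edges n - Omega n. x h = 0\<^sub>m (v (target h)) (v (source h))}"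

definition proj_Omega :: "nat \<Rightarrow> (nat \<Rightarrow> nat) \<Rightarrow> rep \<Rightarrow> rep" where
  "proj_Omega n v x =
     (\<lambda>h\<in>edges n. if h \<in> Omega n then x h else 0\<^sub>m (v (target h)) (v (source h)))"

definition coords_E :: "nat \<Rightarrow> (nat \<Rightarrow> nat) \<Rightarrow> (rep \<Rightarrow> complex) set" where
  "coords_E n v =
     {\<lambda>x. x h $$ (r, c) | h r c. h \<in> edges n \<and> r < v (target h) \<and> c < v (source h)}"

abbreviation GL_ring :: "nat \<Rightarrow> (complex mat, unit) ring_scheme" where
  "GL_ring k \<equiv> ring_mat TYPE(complex) k ()"

definition G :: "nat \<Rightarrow> (nat \<Rightarrow> nat) \<Rightarrow> vfam set" where
  "G n v = (\<Pi>\<^sub>E i\<in>vertices n. Units (GL_ring (v i)))"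

definition act :: "nat \<Rightarrow> (nat \<Rightarrow> nat) \<Rightarrow> vfam \<Rightarrow> rep \<Rightarrow> rep" where
  "act n v g x =
     (\<lambda>h\<in>edges n. g (target h) * x h * inv\<^bsub>GL_ring (v (source h))\<^esub> (g (source h)))"

definition rep_iso :: "nat \<Rightarrow> (nat \<Rightarrow> nat) \<Rightarrow> rep \<Rightarrow> rep \<Rightarrow> bool" where
  "rep_iso n v x y \<longleftrightarrow> (\<exists>g \<in> G n v. y = act n v g x)"


section \<open>Conormal bundles\<close>

definition tr :: "complex mat \<Rightarrow> complex" where
  "tr A = (\<Sum>i<dim_row A. A $$ (i, i))"

definition symp :: "nat \<Rightarrow> rep \<Rightarrow> rep \<Rightarrow> complex" where
  "symp n x y = (\<Sum>h\<in>edges n. eps n h * tr (x h * y (prod.swap h)))"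

text \<open>Zariski tangent space at \<open>x \<in> S\<close>: the common kernel of the differentials at \<open>x\<close> of all
  polynomials vanishing on \<open>S\<close>.  For the smooth locally closed set \<open>S\<close> in question (an orbit)
  this is the usual tangent space, because \<open>S\<close> is open in its closure.\<close>

definition tangent_space :: "nat \<Rightarrow> (nat \<Rightarrow> nat) \<Rightarrow> rep set \<Rightarrow> rep \<Rightarrow> rep set" where
  "tangent_space n v S x =
     {t \<in> E_Omega n v. \<forall>f \<in> polyfuns (coords_E n v). (\<forall>y\<in>S. f y = 0) \<longrightarrow>
        ((\<lambda>s. f (\<lambda>h\<in>edges n. x h + s \<cdot>\<^sub>m t h)) has_field_derivative 0) (at 0)}"

text \<open>Under \<open>symp\<close>, the components of \<open>x\<close> outside \<open>Omega n\<close> are a covector at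
  \<open>proj_Omega n v x\<close>: since \<open>t\<close> is supported on \<open>Omega n\<close>, \<open>symp n t x\<close> depends only on them.\<close>

definition conormal :: "nat \<Rightarrow> (nat \<Rightarrow> nat) \<Rightarrow> rep set \<Rightarrow> rep set" where
  "conormal n v Orb = {x \<in> E n v. proj_Omega n v x \<in> Orb \<and>
     (\<forall>t \<in> tangent_space n v Orb (proj_Omega n v x). symp n t x = 0)}"


section \<open>Quiver varieties\<close>

definition psi :: "nat \<Rightarrow> (nat \<Rightarrow> nat) \<Rightarrow> nat \<Rightarrow> rep \<Rightarrow> complex mat" where
  "psi n v i x = mat (v i) (v i) (\<lambda>rc.
     \<Sum>h | h \<in> edges n \<and> target h = i. eps n h * (x h * x (prod.swap h)) $$ rc)"

text \<open>A nonempty list of edges is read like a composition of maps, so its last edge is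
  applied first.\<close>

definition composable :: "nat \<Rightarrow> edge list \<Rightarrow> bool" where
  "composable n p \<longleftrightarrow> set p \<subseteq> edges n \<and>
     (\<forall>k. Suc k < length p \<longrightarrow> source (p ! k) = target (p ! Suc k))"

definition path_map :: "(nat \<Rightarrow> nat) \<Rightarrow> rep \<Rightarrow> edge list \<Rightarrow> complex mat" where
  "path_map v x p = foldr (\<lambda>h A. x h * A) p (1\<^sub>m (v (source (last p))))"

definition nilpotent_rep :: "nat \<Rightarrow> (nat \<Rightarrow> nat) \<Rightarrow> rep \<Rightarrow> bool" where
  "nilpotent_rep n v x \<longleftrightarrow> (\<exists>N \<ge> 1. \<forall>p. length p = N \<and> composable n p \<longrightarrow>
     path_map v x p = 0\<^sub>m (v (target (hd p))) (v (source (last p))))"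

definition Lambda_V :: "nat \<Rightarrow> (nat \<Rightarrow> nat) \<Rightarrow> rep set" where
  "Lambda_V n v = {x \<in> E n v. nilpotent_rep n v x \<and>
     (\<forall>i \<in> vertices n. psi n v i x = 0\<^sub>m (v i) (v i))}"

definition Hom_VW :: "nat \<Rightarrow> (nat \<Rightarrow> nat) \<Rightarrow> (nat \<Rightarrow> nat) \<Rightarrow> vfam set" where
  "Hom_VW n v w = (\<Pi>\<^sub>E i\<in>vertices n. carrier_mat (w i) (v i))"

definition stable :: "nat \<Rightarrow> (nat \<Rightarrow> nat) \<Rightarrow> (nat \<Rightarrow> nat) \<Rightarrow> rep \<times> vfam \<Rightarrow> bool" where
  "stable n v w = (\<lambda>(x, j). \<forall>S.
     (\<forall>i \<in> vertices n. VectorSpace.subspace class_ring (S i) (module_vec TYPE(complex) (v i))) \<and>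
     (\<forall>h \<in> edges n. \<forall>u \<in> S (source h). x h *\<^sub>v u \<in> S (target h)) \<and>
     (\<forall>i \<in> vertices n. \<forall>u \<in> S i. j i *\<^sub>v u = 0\<^sub>v (w i))
     \<longrightarrow> (\<forall>i \<in> vertices n. S i = {0\<^sub>v (v i)}))"

definition Lambda_st :: "nat \<Rightarrow> (nat \<Rightarrow> nat) \<Rightarrow> (nat \<Rightarrow> nat) \<Rightarrow> (rep \<times> vfam) set" where
  "Lambda_st n v w = {p \<in> Lambda_V n v \<times> Hom_VW n v w. stable n v w p}"

definition coords_fr :: "nat \<Rightarrow> (nat \<Rightarrow> nat) \<Rightarrow> (nat \<Rightarrow> nat) \<Rightarrow> (rep \<times> vfam \<Rightarrow> complex) set" where
  "coords_fr n v w = {\<lambda>p. f (fst p) | f. f \<in> coords_E n v} \<union>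
     {\<lambda>p. snd p i $$ (r, c) | i r c. i \<in> vertices n \<and> r < w i \<and> c < v i}"

definition act_fr :: "nat \<Rightarrow> (nat \<Rightarrow> nat) \<Rightarrow> vfam \<Rightarrow> rep \<times> vfam \<Rightarrow> rep \<times> vfam" where
  "act_fr n v g = (\<lambda>(x, j). (act n v g x, \<lambda>i\<in>vertices n. j i * inv\<^bsub>GL_ring (v i)\<^esub> (g i)))"

definition orbit_fr :: "nat \<Rightarrow> (nat \<Rightarrow> nat) \<Rightarrow> rep \<times> vfam \<Rightarrow> (rep \<times> vfam) set" where
  "orbit_fr n v p = (\<lambda>g. act_fr n v g p) ` G n v"

text \<open>The geometric quotient by \<open>G\<close>: its points are the orbits, and its Zariski topology is the
  quotient of the Zariski topology of \<open>Lambda_st\<close>.\<close>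

definition quiver_var ::
  "nat \<Rightarrow> (nat \<Rightarrow> nat) \<Rightarrow> (nat \<Rightarrow> nat) \<Rightarrow> (rep \<times> vfam) set topology" where
  "quiver_var n v w = quotient_topology
     (subtopology (zariski (coords_fr n v w) (E n v \<times> Hom_VW n v w)) (Lambda_st n v w))
     (orbit_fr n v)"

definition X_orb ::
  "nat \<Rightarrow> (nat \<Rightarrow> nat) \<Rightarrow> (nat \<Rightarrow> nat) \<Rightarrow> rep set \<Rightarrow> (rep \<times> vfam) set set" where
  "X_orb n v w Orb = orbit_fr n v `
     (((zariski (coords_E n v) (E n v) closure_of conormal n v Orb) \<times> Hom_VW n v w)
       \<inter> Lambda_st n v w)"

definition fund_weight :: "nat \<Rightarrow> nat \<Rightarrow> (nat \<Rightarrow> nat)" where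
  "fund_weight n k = (\<lambda>i\<in>vertices n. if i = k then 1 else 0)"


section \<open>String representations and Young diagrams\<close>

definition string_support :: "nat \<Rightarrow> nat \<times> nat \<Rightarrow> nat set" where
  "string_support n = (\<lambda>(k', k). if k = n then {k'..n - 2} \<union> {n} else {k'..k})"

definition string_arrows :: "nat \<Rightarrow> nat \<times> nat \<Rightarrow> edge set" where
  "string_arrows n = (\<lambda>(k', k).
     if k = n then {(r, r + 1) | r. k' \<le> r \<and> r < n - 2} \<union> (if k' \<le> n - 2 then {(n - 2, n)} else {})
     else {(r, r + 1) | r. k' \<le> r \<and> r < k})"

definition string_dim :: "nat \<Rightarrow> nat \<times> nat \<Rightarrow> nat \<Rightarrow> nat" where
  "string_dim n a i = (if i \<in> string_support n a then 1 else 0)"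

text \<open>Matrices with respect to the basis vectors \<open>e\<^sub>r\<close>; all blocks have size at most 1.\<close>

definition string_rep :: "nat \<Rightarrow> nat \<times> nat \<Rightarrow> rep" where
  "string_rep n a = (\<lambda>h\<in>edges n. mat (string_dim n a (target h)) (string_dim n a (source h))
     (\<lambda>_. if h \<in> string_arrows n a then 1 else 0))"

definition dsum_dim :: "nat \<Rightarrow> (nat \<times> nat) list \<Rightarrow> (nat \<Rightarrow> nat)" where
  "dsum_dim n as = (\<lambda>i\<in>vertices n. \<Sum>a\<leftarrow>as. string_dim n a i)"

definition dsum_rep :: "nat \<Rightarrow> (nat \<times> nat) list \<Rightarrow> rep" where
  "dsum_rep n as = (\<lambda>h\<in>edges n. diag_block_mat (map (\<lambda>a. string_rep n a h) as))"

text \<open>Only meaningful when \<open>dsum_dim n as = v\<close>, so that \<open>dsum_rep n as\<close> lies in \<open>E_Omega n v\<close>.\<close>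

definition iso_class :: "nat \<Rightarrow> (nat \<Rightarrow> nat) \<Rightarrow> (nat \<times> nat) list \<Rightarrow> rep set" where
  "iso_class n v as = {x \<in> E_Omega n v. rep_iso n v (dsum_rep n as) x}"

definition Young :: "nat \<Rightarrow> nat list set" where
  "Young n = {Y. sorted_wrt (>) Y \<and> set Y \<subseteq> {1..n - 1}}"

definition A_plus :: "nat \<Rightarrow> nat \<Rightarrow> nat \<Rightarrow> nat \<times> nat" where
  "A_plus n i l = (if odd i then (if l > 1 then (n - l, n) else (n, n)) else (n - l, n - 1))"

definition A_minus :: "nat \<Rightarrow> nat \<Rightarrow> nat \<Rightarrow> nat \<times> nat" where
  "A_minus n i l = (if even i then (if l > 1 then (n - l, n) else (n, n)) else (n - l, n - 1))"

text \<open>The sets \<open>A\<^sub>Y\<close> as lists without repetition (the pairs for different parts are distinct);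
  the order only affects the direct sum up to isomorphism.  List positions start at 0,
  parts \<open>l\<^sub>i\<close> at \<open>i = 1\<close>.\<close>

definition AY_plus :: "nat \<Rightarrow> nat list \<Rightarrow> (nat \<times> nat) list" where
  "AY_plus n Y = map (\<lambda>i. A_plus n (i + 1) (Y ! i)) [0..<length Y]"

definition AY_minus :: "nat \<Rightarrow> nat list \<Rightarrow> (nat \<times> nat) list" where
  "AY_minus n Y = map (\<lambda>i. A_minus n (i + 1) (Y ! i)) [0..<length Y]"

text \<open>The component attached to a list of strings, as a subset of the disjoint union over all
  dimension vectors.\<close>

definition X_strings ::
  "nat \<Rightarrow> (nat \<Rightarrow> nat) \<Rightarrow> (nat \<times> nat) list \<Rightarrow> ((nat \<Rightarrow> nat) \<times> (rep \<times> vfam) set) set" where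
  "X_strings n w as =
     {dsum_dim n as} \<times> X_orb n (dsum_dim n as) w (iso_class n (dsum_dim n as) as)"

end

theory Submission
  imports Defs
begin


text \<open>The spin representations of type \<open>D\<^sub>n\<close> are minuscule: all their weight spaces are
one-dimensional and their weights form one Weyl group orbit.  On the geometric side this means that
every \<open>\<L>(v, w)\<close> with \<open>w\<close> the fundamental weight of a spin vertex \<open>s\<close> is empty or a single
point.  So the theorem asks for a normal form of the stable points, for the \<open>v\<close> for which there is
one, and for a proof that \<open>X\<^sub>\<O>\<close> is not empty for the orbit \<open>\<O>\<close> in question.

\<^emph>\<open>One point.\<close>  A stable point is a module over the preprojective algebra whose socle embeds into the
simple module at \<open>s\<close>, so it embeds into the injective hull of that module.  This is made explicit by
composing \<open>j\<close> with paths ending at \<open>s\<close>, which gives row vectors on the spaces \<open>V\<^sub>i\<close>.  By the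
preprojective relations, each such row vector is zero or one of the vectors \<open>box_fun r d\<close> indexed by
the boxes of the shifted staircase: row \<open>r\<close> starts at \<open>s\<close> or at the other spin vertex according to
the parity of \<open>r\<close>, continues along \<open>n - 2, n - 3, \<dots>\<close>, and has \<open>n - 1 - r\<close> boxes
(\<open>fun_at_arrow\<close>, \<open>box_outside_eq_0\<close>).  At a fixed vertex \<open>i\<close> these vectors are \<open>f, f y, f y\<^sup>2, \<dots>\<close>
for one endomorphism \<open>y\<close> of \<open>V\<^sub>i\<close>, the action of a closed walk (\<open>fun_at_step\<close>).  By stability they
separate the points of \<open>V\<^sub>i\<close>, hence the first \<open>v i\<close> of them form a basis of the dual space and all
others vanish (\<open>cyclic_nilpotent_functionals\<close>).  In these coordinates the point \<open>(x, j)\<close> becomes a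
point that depends only on \<open>v\<close> (\<open>stable_normal_form\<close>).

\<^emph>\<open>Which \<open>v\<close>.\<close>  The boxes with a nonzero row vector form a shifted Young diagram, and \<open>v i\<close> counts
its boxes at the vertex \<open>i\<close>.  Conversely the standard point of a diagram is nilpotent, stable and in
the zero fibre of \<open>psi\<close> (\<open>std_Lambda_st\<close>).  The boxes at one vertex form a chain, so \<open>v\<close> determines the
diagram (\<open>shape_determines_rows\<close>).

\<^emph>\<open>Which orbit.\<close>  In the standard point the arrows of \<open>\<Omega>\<close> join neighbouring boxes in a row.  So its
projection is the direct sum of the strings given by the rows (\<open>dsum_rep_row_strings\<close>), and it
remains to see that the standard point is a conormal vector of its orbit.  The equation \<open>psi = 0\<close>
says that the covector annihilates all infinitesimal motions
\<open>x\<^sub>h f\<^bsub>source h\<^esub> - f\<^bsub>target h\<^esub> x\<^sub>h\<close>; it has to annihilate the Zariski tangent space, which could be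
larger.  For \<open>y\<close> in the orbit of \<open>x\<close>, the linear map \<open>f \<mapsto> y f - f x\<close> has the same rank \<open>r\<close> as
for \<open>y = x\<close>, so its minors of size \<open>r + 1\<close> vanish on the orbit.  The identity lies in the kernel of
\<open>f \<mapsto> x f - f x\<close> and the covector annihilates the image.  Bordering an invertible minor of size \<open>r\<close>
with these two gives a polynomial whose derivative at \<open>x\<close> is the covector itself
(\<open>conormal_of_psi_eq_0\<close>).\<close>

section \<open>Thin products and cyclic functionals\<close>

lemma det_thin_product_eq_0:
  fixes A B :: "'a :: field mat"
  assumes A: "A \<in> carrier_mat k r" and B: "B \<in> carrier_mat r k" and "r < k"
  shows "det (A * B) = 0"
proof -
  define B' where "B' = mat k k (\<lambda>(i, j). if i < r then B $$ (i, j) else 0)"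
  have B': "B' \<in> carrier_mat k k" by (simp add: B'_def)
  have "Matrix.row B' r = 0\<^sub>v k"
    using \<open>r < k\<close> by (intro eq_vecI) (auto simp: B'_def)
  define A' where "A' = mat k k (\<lambda>(i, j). if j < r then A $$ (i, j) else 0)"
  have A': "A' \<in> carrier_mat k k" by (simp add: A'_def)
  have "A * B = A' * B'"
  proof (rule eq_matI)
    fix i j assume "i < dim_row (A' * B')" "j < dim_col (A' * B')"
    then have ij: "i < k" "j < k" by (simp_all add: A'_def B'_def)
    have "(\<Sum>l<k. A' $$ (i, l) * B' $$ (l, j)) = (\<Sum>l<r. A $$ (i, l) * B $$ (l, j))"
      using ij \<open>r < k\<close> by (intro sum.mono_neutral_cong_right) (auto simp: A'_def B'_def)
    then show "(A * B) $$ (i, j) = (A' * B') $$ (i, j)"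
      using ij A B A' B' by (simp add: scalar_prod_def lessThan_atLeast0)
  qed (use A B A' B' in auto)
  moreover have "det B' = 0"
  proof -
    have "det (transpose_mat B') = 0"
    proof (subst det_0_iff_vec_prod_zero_field[where n = k])
      show "transpose_mat B' \<in> carrier_mat k k" using B' by simp
      show "\<exists>v. v \<in> carrier_vec k \<and> v \<noteq> 0\<^sub>v k \<and> transpose_mat B' *\<^sub>v v = 0\<^sub>v k"
      proof (intro exI[of _ "unit_vec k r"] conjI)
        show "transpose_mat B' *\<^sub>v unit_vec k r = 0\<^sub>v k"
          using B' \<open>r < k\<close>
          by (intro eq_vecI) (auto simp: B'_def)
      qed (use \<open>r < k\<close> in \<open>auto simp: unit_vec_nonzero\<close>)
    qed
    then show ?thesis using det_transpose[OF B'] by simp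
  qed
  ultimately show ?thesis using det_mult[OF A' B'] by simp
qed

text \<open>Padding the matrix with zero rows makes it square, and the padded matrix is singular by
\<open>det_thin_product_eq_0\<close>.\<close>

lemma ex_nontrivial_kernel:
  fixes A :: "'a :: field mat"
  assumes A: "A \<in> carrier_mat r k" and "r < k"
  shows "\<exists>u \<in> carrier_vec k. u \<noteq> 0\<^sub>v k \<and> A *\<^sub>v u = 0\<^sub>v r"
proof -
  define J :: "'a mat" where "J = mat k r (\<lambda>(i, j). if i = j then 1 else 0)"
  have J: "J \<in> carrier_mat k r" by (simp add: J_def)
  have "det (J * A) = 0" using det_thin_product_eq_0[OF J A \<open>r < k\<close>] .
  then obtain u where u: "u \<in> carrier_vec k" "u \<noteq> 0\<^sub>v k" "J * A *\<^sub>v u = 0\<^sub>v k"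
    using det_0_iff_vec_prod_zero_field[of "J * A" k] J A by auto
  have "A *\<^sub>v u = 0\<^sub>v r"
  proof (rule eq_vecI)
    fix i assume i: "i < dim_vec (0\<^sub>v r :: 'a vec)"
    then have ir: "i < r" by simp
    have "(J *\<^sub>v (A *\<^sub>v u)) $ i = 0"
      using u J A ir \<open>r < k\<close> by (simp flip: assoc_mult_mat_vec)
    moreover have "Matrix.row J i = unit_vec r i"
      using ir \<open>r < k\<close> by (intro eq_vecI) (auto simp: J_def)
    ultimately show "(A *\<^sub>v u) $ i = 0\<^sub>v r $ i"
      using ir J A \<open>r < k\<close> u(1) by (auto simp: )
  qed (use A in auto)
  with u show ?thesis by blast
qed

text \<open>The row vectors \<open>f 0, f 1, \<dots>\<close> up to the last
nonzero one are linearly independent, because a power of \<open>y\<close> isolates the lowest term of a linear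
relation; and they span the dual space because they separate points.  So there are \<open>v\<close> of them.\<close>

lemma cyclic_nilpotent_functionals:
  fixes f :: "nat \<Rightarrow> 'a :: field mat" and y :: "'a mat"
  assumes f: "\<And>k. f k \<in> carrier_mat 1 v" and y: "y \<in> carrier_mat v v"
    and step: "\<And>k. f (Suc k) = f k * y"
    and vanish: "f M = 0\<^sub>m 1 v"
    and separating: "\<And>u. u \<in> carrier_vec v \<Longrightarrow> (\<And>k. f k *\<^sub>v u = 0\<^sub>v 1) \<Longrightarrow> u = 0\<^sub>v v"
  shows "\<And>k. f k = 0\<^sub>m 1 v \<longleftrightarrow> k \<ge> v"
    and "mat v v (\<lambda>(a, c). f a $$ (0, c)) \<in> Units (ring_mat TYPE('a) v b)"
proof -
  have stay: "f (k + l) = 0\<^sub>m 1 v" if "f k = 0\<^sub>m 1 v" for k l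
    by (induction l) (use that y step in auto)
  define m where "m = (LEAST k. f k = 0\<^sub>m 1 v)"
  have m0: "f m = 0\<^sub>m 1 v" unfolding m_def using vanish by (rule LeastI)
  have mlt: "f k \<noteq> 0\<^sub>m 1 v" if "k < m" for k using that not_less_Least unfolding m_def by blast
  have f0_iff: "f k = 0\<^sub>m 1 v \<longleftrightarrow> m \<le> k" for k
    using mlt[of k] stay[OF m0, of "k - m"] by (cases "m \<le> k") auto
  have app: "(f k *\<^sub>v u) $ 0 = (\<Sum>c<v. f k $$ (0, c) * u $ c)" if "u \<in> carrier_vec v" for k u
    using f[of k] that by (simp add: scalar_prod_def lessThan_atLeast0)
  have app0: "f k *\<^sub>v u = 0\<^sub>v 1 \<longleftrightarrow> (\<Sum>c<v. f k $$ (0, c) * u $ c) = 0" if "u \<in> carrier_vec v" for k u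
  proof -
    have "f k *\<^sub>v u = 0\<^sub>v 1 \<longleftrightarrow> (f k *\<^sub>v u) $ 0 = 0"
      using f[of k] by (auto simp: vec_eq_iff)
    then show ?thesis by (simp only: app[OF that])
  qed
  have zero_app: "0\<^sub>m 1 v *\<^sub>v u = 0\<^sub>v 1" if "u \<in> carrier_vec v" for u :: "'a vec"
    using that by (intro eq_vecI) (auto simp: scalar_prod_def)
  \<comment> \<open>Fewer than \<open>v\<close> row vectors annihilate a common nonzero vector.\<close>
  have "v \<le> m"
  proof (rule ccontr)
    assume "\<not> v \<le> m"
    define A where "A = mat m v (\<lambda>(a, c). f a $$ (0, c))"
    obtain u where u: "u \<in> carrier_vec v" "u \<noteq> 0\<^sub>v v" "A *\<^sub>v u = 0\<^sub>v m"
      using ex_nontrivial_kernel[of A m v] \<open>\<not> v \<le> m\<close> by (auto simp: A_def)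
    have "f k *\<^sub>v u = 0\<^sub>v 1" for k
    proof (cases "k < m")
      case True
      then have "(A *\<^sub>v u) $ k = 0" using u by simp
      then show ?thesis
        unfolding app0[OF u(1)] using True u(1) by (simp add: A_def scalar_prod_def lessThan_atLeast0)
    next
      case False
      then show ?thesis using f0_iff[of k] zero_app[OF u(1)] by simp
    qed
    then show False using separating[OF u(1)] u(2) by blast
  qed
  \<comment> \<open>More than \<open>v\<close> row vectors are linearly dependent; let \<open>k\<close> be the lowest index in a relation.\<close>
  moreover have "m \<le> v"
  proof (rule ccontr)
    assume "\<not> m \<le> v"
    define A where "A = mat v (Suc v) (\<lambda>(c, a). f a $$ (0, c))"
    obtain u where u: "u \<in> carrier_vec (Suc v)" "u \<noteq> 0\<^sub>v (Suc v)" "A *\<^sub>v u = 0\<^sub>v v"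
      using ex_nontrivial_kernel[of A v "Suc v"] by (auto simp: A_def)
    have dep: "(\<Sum>a<Suc v. u $ a * f a $$ (0, c)) = 0" if "c < v" for c
    proof -
      have "(A *\<^sub>v u) $ c = 0" using u that by simp
      then show ?thesis using that u(1)
        by (simp add: A_def scalar_prod_def lessThan_atLeast0 mult.commute)
    qed
    define k where "k = (LEAST k. k < Suc v \<and> u $ k \<noteq> 0)"
    have "\<exists>k. k < Suc v \<and> u $ k \<noteq> 0" using u(1,2) by (auto simp: vec_eq_iff)
    then have k: "k < Suc v" "u $ k \<noteq> 0" unfolding k_def by (rule LeastI2_ex, simp)+
    have below: "u $ a = 0" if "a < k" for a
      using that not_less_Least[of a "\<lambda>k. k < Suc v \<and> u $ k \<noteq> 0"] k(1) unfolding k_def by auto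
    have dep': "(\<Sum>a<Suc v. u $ a * f (a + l) $$ (0, c)) = 0" if "c < v" for c l
      using that
    proof (induction l arbitrary: c)
      case 0 then show ?case using dep by simp
    next
      case (Suc l)
      have "f (a + Suc l) $$ (0, c) = (\<Sum>d<v. f (a + l) $$ (0, d) * y $$ (d, c))" for a
        using f[of "a + l"] y Suc.prems step[of "a + l"]
        by (simp add: scalar_prod_def lessThan_atLeast0)
      then have "(\<Sum>a<Suc v. u $ a * f (a + Suc l) $$ (0, c))
        = (\<Sum>a<Suc v. \<Sum>d<v. u $ a * f (a + l) $$ (0, d) * y $$ (d, c))"
        by (simp only: sum_distrib_left mult.assoc)
      also have "\<dots> = (\<Sum>d<v. (\<Sum>a<Suc v. u $ a * f (a + l) $$ (0, d)) * y $$ (d, c))"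
        by (subst sum.swap) (simp only: sum_distrib_right)
      also have "\<dots> = 0" using Suc.IH by (intro sum.neutral) (simp del: sum.lessThan_Suc)
      finally show ?case .
    qed
    have "k < m" using k(1) \<open>\<not> m \<le> v\<close> by simp
    \<comment> \<open>Multiplying by \<open>y\<close> to the power \<open>m - 1 - k\<close> kills every term of the relation except the lowest.\<close>
    have "f (m - 1) = 0\<^sub>m 1 v"
    proof (rule eq_matI)
      fix i c assume "i < dim_row (0\<^sub>m 1 v :: 'a mat)" "c < dim_col (0\<^sub>m 1 v :: 'a mat)"
      then have c: "i = 0" "c < v" by auto
      have "(\<Sum>a<Suc v. u $ a * f (a + (m - 1 - k)) $$ (0, c))
        = (\<Sum>a\<in>{k}. u $ a * f (a + (m - 1 - k)) $$ (0, c))"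
      proof (intro sum.mono_neutral_right ballI)
        fix a assume "a \<in> {..<Suc v} - {k}"
        then consider "a < k" | "a > k" by fastforce
        then show "u $ a * f (a + (m - 1 - k)) $$ (0, c) = 0"
        proof cases
          case 2
          then have "f (a + (m - 1 - k)) = 0\<^sub>m 1 v" using \<open>k < m\<close> by (subst f0_iff) auto
          then show ?thesis using c by simp
        qed (use below in simp)
      qed (use k in auto)
      then have "u $ k * f (m - 1) $$ (0, c) = 0"
        using dep'[OF c(2), of "m - 1 - k"] \<open>k < m\<close> by (simp del: sum.lessThan_Suc)
      then show "f (m - 1) $$ (i, c) = 0\<^sub>m 1 v $$ (i, c)" using k c by simp
    qed (use f[of "m - 1"] in auto)
    then show False using f0_iff[of "m - 1"] \<open>k < m\<close> by simp
  qed
  ultimately have "m = v" by simp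
  then show f0: "\<And>k. f k = 0\<^sub>m 1 v \<longleftrightarrow> k \<ge> v" using f0_iff by simp
  let ?A = "mat v v (\<lambda>(a, c). f a $$ (0, c))"
  show "?A \<in> Units (ring_mat TYPE('a) v b)"
  proof (rule det_non_zero_imp_unit)
    show "det ?A \<noteq> 0"
    proof
      assume "det ?A = 0"
      then obtain u where u: "u \<in> carrier_vec v" "u \<noteq> 0\<^sub>v v" "?A *\<^sub>v u = 0\<^sub>v v"
        using det_0_iff_vec_prod_zero_field[of ?A v] by auto
      have "f k *\<^sub>v u = 0\<^sub>v 1" for k
      proof (cases "k < v")
        case True
        then have "(?A *\<^sub>v u) $ k = 0" using u by simp
        then show ?thesis
          unfolding app0[OF u(1)] using True u(1) by (simp add: scalar_prod_def lessThan_atLeast0)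
      next
        case False
        then show ?thesis using f0[of k] zero_app[OF u(1)] by simp
      qed
      then show False using separating[OF u(1)] u(2) by blast
    qed
  qed simp
qed


section \<open>Discrete spaces and the orbit space\<close>

lemma irreducible_components_discrete:
  assumes "\<And>U. U \<subseteq> topspace X \<Longrightarrow> openin X U"
  shows "irreducible_components X = (\<lambda>p. {p}) ` topspace X"
proof -
  have closed: "closedin X A" if "A \<subseteq> topspace X" for A
    using that assms by (simp add: closedin_def)
  have irr: "irreducible_in X S \<longleftrightarrow> (\<exists>p \<in> topspace X. S = {p})" for S
  proof
    assume S: "irreducible_in X S"
    then obtain p where p: "p \<in> S" "S \<subseteq> topspace X" by (auto simp: irreducible_in_def)
    have "S \<subseteq> {p} \<or> S \<subseteq> S - {p}"
      using S p closed[of "{p}"] closed[of "S - {p}"] unfolding irreducible_in_def by blast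
    then show "\<exists>p \<in> topspace X. S = {p}" using p by blast
  qed (auto simp: irreducible_in_def)
  show ?thesis unfolding irreducible_components_def irr by auto
qed

text \<open>A disjoint union of spaces with at most one point is discrete; this covers the union over all
dimension vectors.\<close>

lemma irreducible_components_sum_topology:
  assumes one: "\<And>i. i \<in> I \<Longrightarrow> \<exists>p. topspace (X i) \<subseteq> {p}"
  shows "irreducible_components (sum_topology X I) = (\<lambda>p. {p}) ` (SIGMA i:I. topspace (X i))"
proof -
  have "openin (sum_topology X I) U" if "U \<subseteq> (SIGMA i:I. topspace (X i))" for U
  proof -
    have "openin (X i) {x. (i, x) \<in> U}" if "i \<in> I" for i
    proof -
      have "{x. (i, x) \<in> U} = {} \<or> {x. (i, x) \<in> U} = topspace (X i)"
        using one[OF that] \<open>U \<subseteq> _\<close> by blast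
      then show ?thesis by (metis openin_empty openin_topspace)
    qed
    then show ?thesis using that by (auto simp: openin_sum_topology)
  qed
  then show ?thesis using irreducible_components_discrete[of "sum_topology X I"] by (simp add: comp_def)
qed

lemma topspace_quotient_topology: "topspace (quotient_topology X q) = q ` topspace X"
proof -
  have "{p \<in> topspace X. q p \<in> q ` topspace X} = topspace X" by blast
  then have "openin (quotient_topology X q) (q ` topspace X)"
    by (simp add: openin_quotient_topology)
  then show ?thesis
    using openin_subset openin_topspace[of "quotient_topology X q"]
    by (metis openin_quotient_topology subset_antisym)
qed

lemma topspace_zariski: "topspace (zariski C M) = M"
proof -
  have "openin (zariski C M) M"
    unfolding openin_zariski by (intro exI[of _ "{\<lambda>_. 1}"]) (auto intro: polyfuns.const)
  moreover have "U \<subseteq> M" if "openin (zariski C M) U" for U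
    using that unfolding openin_zariski by auto
  ultimately show ?thesis by (meson openin_subset openin_topspace subset_antisym)
qed

lemma topspace_quiver_var: "topspace (quiver_var n v w) = orbit_fr n v ` Lambda_st n v w"
proof -
  have "Lambda_st n v w \<subseteq> E n v \<times> Hom_VW n v w"
    by (auto simp: Lambda_st_def Lambda_V_def)
  then show ?thesis
    unfolding quiver_var_def topspace_quotient_topology
    by (simp add: topspace_zariski Int_absorb1)
qed

section \<open>The action of the group\<close>

lemma GL_carrier: "A \<in> Units (GL_ring k) \<Longrightarrow> A \<in> carrier_mat k k"
  by (simp add: Units_def ring_mat_def)

lemma GL_inv:
  assumes "A \<in> Units (GL_ring k)"
  shows GL_inv_carrier: "inv\<^bsub>GL_ring k\<^esub> A \<in> carrier_mat k k"
    and GL_inv_left: "inv\<^bsub>GL_ring k\<^esub> A * A = 1\<^sub>m k"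
    and GL_inv_right: "A * inv\<^bsub>GL_ring k\<^esub> A = 1\<^sub>m k"
proof -
  interpret ring "GL_ring k" by (rule ring_mat)
  show "inv\<^bsub>GL_ring k\<^esub> A \<in> carrier_mat k k"
    using Units_inv_closed[OF assms] by (simp add: ring_mat_def)
  show "inv\<^bsub>GL_ring k\<^esub> A * A = 1\<^sub>m k"
    using Units_l_inv[OF assms] by (simp add: ring_mat_def)
  show "A * inv\<^bsub>GL_ring k\<^esub> A = 1\<^sub>m k"
    using Units_r_inv[OF assms] by (simp add: ring_mat_def)
qed

lemma GL_one: "1\<^sub>m k \<in> Units (GL_ring k)" "inv\<^bsub>GL_ring k\<^esub> (1\<^sub>m k) = 1\<^sub>m k"
proof -
  interpret ring "GL_ring k" by (rule ring_mat)
  show "1\<^sub>m k \<in> Units (GL_ring k)" "inv\<^bsub>GL_ring k\<^esub> (1\<^sub>m k) = 1\<^sub>m k"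
    using Units_one_closed inv_one by (simp_all add: ring_mat_def)
qed

lemma GL_mult:
  assumes "A \<in> Units (GL_ring k)" "B \<in> Units (GL_ring k)"
  shows "A * B \<in> Units (GL_ring k)"
    and "inv\<^bsub>GL_ring k\<^esub> (A * B) = inv\<^bsub>GL_ring k\<^esub> B * inv\<^bsub>GL_ring k\<^esub> A"
proof -
  interpret ring "GL_ring k" by (rule ring_mat)
  show "A * B \<in> Units (GL_ring k)"
    using Units_m_closed[OF assms] by (simp add: ring_mat_def)
  have "inv\<^bsub>GL_ring k\<^esub> (A \<otimes>\<^bsub>GL_ring k\<^esub> B) =
      inv\<^bsub>GL_ring k\<^esub> B \<otimes>\<^bsub>GL_ring k\<^esub> inv\<^bsub>GL_ring k\<^esub> A"
    using group.inv_mult_group[OF units_group, of A B] Units_m_closed[OF assms] assms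
    by (simp add: units_of_mult units_of_carrier units_of_inv)
  then show "inv\<^bsub>GL_ring k\<^esub> (A * B) = inv\<^bsub>GL_ring k\<^esub> B * inv\<^bsub>GL_ring k\<^esub> A"
    by (simp add: ring_mat_def)
qed

lemma GL_inv_Units: "A \<in> Units (GL_ring k) \<Longrightarrow> inv\<^bsub>GL_ring k\<^esub> A \<in> Units (GL_ring k)"
proof -
  interpret ring "GL_ring k" by (rule ring_mat)
  show "A \<in> Units (GL_ring k) \<Longrightarrow> inv\<^bsub>GL_ring k\<^esub> A \<in> Units (GL_ring k)" by (rule Units_inv_Units)
qed

lemma edges_endpoints:
  assumes "h \<in> edges n" "n \<ge> 4"
  shows "source h \<in> vertices n" "target h \<in> vertices n"
  using assms by (auto simp: edges_def Omega_def vertices_def)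

lemma act_fr_mult:
  assumes n: "n \<ge> 4" and g: "g \<in> G n v" and h: "h \<in> G n v"
    and p: "p \<in> E n v \<times> Hom_VW n v w"
  shows "act_fr n v g (act_fr n v h p) = act_fr n v (\<lambda>i\<in>vertices n. g i * h i) p"
proof -
  obtain x j where xj: "p = (x, j)" "x \<in> E n v" "j \<in> Hom_VW n v w" using p by auto
  have gh: "g i \<in> Units (GL_ring (v i))" "h i \<in> Units (GL_ring (v i))" if "i \<in> vertices n" for i
    using g h that by (auto simp: G_def)
  have 1: "g (target e) * (h (target e) * x e * inv\<^bsub>GL_ring (v (source e))\<^esub> h (source e)) *
          inv\<^bsub>GL_ring (v (source e))\<^esub> g (source e) =
          g (target e) * h (target e) * x e *
          inv\<^bsub>GL_ring (v (source e))\<^esub> (g (source e) * h (source e))" if e: "e \<in> edges n" for e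
  proof -
    note st = edges_endpoints[OF e n]
    have x: "x e \<in> carrier_mat (v (target e)) (v (source e))" using xj e by (auto simp: E_def)
    note c = GL_carrier[OF gh(1)[OF st(2)]] GL_carrier[OF gh(2)[OF st(2)]]
      GL_inv_carrier[OF gh(1)[OF st(1)]] GL_inv_carrier[OF gh(2)[OF st(1)]] x
    show ?thesis
      unfolding GL_mult(2)[OF gh[OF st(1)]]
      using c by (simp add: assoc_mult_mat[of _ "v (target e)" "v (target e)" _ "v (source e)" _ "v (source e)"]
        assoc_mult_mat[of _ "v (target e)" "v (source e)" _ "v (source e)" _ "v (source e)"]
        assoc_mult_mat[of _ "v (target e)" "v (target e)" _ "v (target e)" _ "v (source e)"] mult_carrier_mat)
  qed
  have 2: "j i * inv\<^bsub>GL_ring (v i)\<^esub> h i * inv\<^bsub>GL_ring (v i)\<^esub> g i =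
        j i * inv\<^bsub>GL_ring (v i)\<^esub> (g i * h i)" if i: "i \<in> vertices n" for i
  proof -
    have "j i \<in> carrier_mat (w i) (v i)" using xj i by (auto simp: Hom_VW_def)
    then show ?thesis
      unfolding GL_mult(2)[OF gh[OF i]]
      using GL_inv_carrier[OF gh(1)[OF i]] GL_inv_carrier[OF gh(2)[OF i]] by simp
  qed
  show ?thesis
    unfolding xj act_fr_def act_def
    using 1 2 edges_endpoints[OF _ n] by (auto simp: restrict_def fun_eq_iff)
qed

text \<open>This is what turns a normal form under the group into a statement about points of the quotient.\<close>

lemma orbit_fr_act_fr:
  assumes n: "n \<ge> 4" and g: "g \<in> G n v" and p: "p \<in> E n v \<times> Hom_VW n v w"
  shows "orbit_fr n v (act_fr n v g p) = orbit_fr n v p"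
proof -
  have gi: "g i \<in> Units (GL_ring (v i))" if "i \<in> vertices n" for i
    using g that by (auto simp: G_def)
  have prod: "(\<lambda>i\<in>vertices n. h i * g i) \<in> G n v" if "h \<in> G n v" for h
    using that g by (auto simp: G_def intro!: GL_mult(1))
  show ?thesis
  proof (intro equalityI subsetI)
    fix q assume "q \<in> orbit_fr n v (act_fr n v g p)"
    then obtain h where h: "h \<in> G n v" "q = act_fr n v h (act_fr n v g p)"
      by (auto simp: orbit_fr_def)
    then show "q \<in> orbit_fr n v p"
      using act_fr_mult[OF n h(1) g p] prod[OF h(1)] by (auto simp: orbit_fr_def)
  next
    fix q assume "q \<in> orbit_fr n v p"
    then obtain h where h: "h \<in> G n v" "q = act_fr n v h p" by (auto simp: orbit_fr_def)
    have hi: "h i \<in> Units (GL_ring (v i))" if "i \<in> vertices n" for i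
      using h that by (auto simp: G_def)
    define k where "k = (\<lambda>i\<in>vertices n. h i * inv\<^bsub>GL_ring (v i)\<^esub> (g i))"
    have k: "k \<in> G n v" unfolding k_def G_def using hi gi by (auto intro!: GL_mult(1) GL_inv_Units)
    have "(\<lambda>i\<in>vertices n. k i * g i) = h"
    proof
      fix i
      show "(\<lambda>i\<in>vertices n. k i * g i) i = h i"
      proof (cases "i \<in> vertices n")
        case True
        then show ?thesis
          using GL_carrier[OF hi[OF True]] GL_carrier[OF gi[OF True]] GL_inv[OF gi[OF True]]
          by (simp add: k_def assoc_mult_mat[of _ "v i" "v i" _ "v i" _ "v i"])
      qed (use h in \<open>auto simp: G_def PiE_def extensional_def\<close>)
    qed
    then have "q = act_fr n v k (act_fr n v g p)" using act_fr_mult[OF n k g p] h(2) by simp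
    then show "q \<in> orbit_fr n v (act_fr n v g p)" using k by (auto simp: orbit_fr_def)
  qed
qed


section \<open>Pairings of finite rank and bordered minors\<close>

lemma polyfuns_sum:
  "(\<And>i. i \<in> I \<Longrightarrow> F i \<in> polyfuns C) \<Longrightarrow> (\<lambda>p. \<Sum>i\<in>I. F i p) \<in> polyfuns C"
  by (induction I rule: infinite_finite_induct) (auto intro: polyfuns.const polyfuns.add)

lemma polyfuns_prod:
  "(\<And>i. i \<in> I \<Longrightarrow> F i \<in> polyfuns C) \<Longrightarrow> (\<lambda>p. \<Prod>i\<in>I. F i p) \<in> polyfuns C"
  by (induction I rule: infinite_finite_induct) (auto intro: polyfuns.const polyfuns.mult)

lemma det_mat: "det (mat k k f) =
    (\<Sum>p | p permutes {0..<k}. signof p * (\<Prod>i = 0..<k. f (i, p i)))"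
  unfolding det_def by (auto intro!: sum.cong prod.cong arg_cong[of _ _ "(*) _"] simp: permutes_in_image)

lemma polyfuns_det:
  assumes "\<And>a b. a < k \<Longrightarrow> b < k \<Longrightarrow> (\<lambda>p. F p a b) \<in> polyfuns C"
  shows "(\<lambda>p. det (mat k k (\<lambda>(a, b). F p a b))) \<in> polyfuns C"
  unfolding det_mat
  by (intro polyfuns_sum polyfuns.mult polyfuns.const polyfuns_prod)
     (auto intro!: assms simp: permutes_in_image)

text \<open>The rank factorisation of a matrix, in terms of the bilinear form of a linear map \<open>T\<close>.  Forms on
spaces of functions avoid a numbering of the coordinates of a family of matrices.  A maximal system
with \<open>b (\<Phi> a) (F c) = \<delta>\<^sub>a\<^sub>c\<close> exists because its size is bounded by the number of coordinates.\<close>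

lemma finite_rank_factorisation:
  fixes T :: "('j \<Rightarrow> 'a::field) \<Rightarrow> 'k \<Rightarrow> 'a"
  assumes K: "finite K"
    and lin: "\<And>f g c k. T (\<lambda>j. f j + c * g j) k = T f k + c * T g k"
  defines "b \<equiv> \<lambda>\<phi> f. \<Sum>k\<in>K. \<phi> k * T f k"
  obtains r :: nat and \<Phi> F where "\<And>a c. a < r \<Longrightarrow> c < r \<Longrightarrow> b (\<Phi> a) (F c) = (if a = c then 1 else 0)"
    and "\<And>\<phi> f. b \<phi> f = (\<Sum>a<r. b \<phi> (F a) * b (\<Phi> a) f)"
proof -
  define dual where "dual r \<Phi> F \<longleftrightarrow> (\<forall>a<r. \<forall>c<r. b (\<Phi> a) (F c) = (if a = c then 1 else 0))"
    for r :: nat and \<Phi> F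
  have T0: "T (\<lambda>j. 0) k = 0" for k using lin[of "\<lambda>j. 0" "- 1" "\<lambda>j. 0" k] by simp
  have Tscale: "T (\<lambda>j. c * g j) k = c * T g k" for c g k
    using lin[of "\<lambda>j. 0" c g k] by (simp add: T0)
  have Tsum: "T (\<lambda>j. f j + (\<Sum>a<r. c a * F a j)) k = T f k + (\<Sum>a<r. c a * T (F a) k)"
    for f c F k and r :: nat
  proof (induction r)
    case (Suc r)
    then show ?case
      using lin[of "\<lambda>j. f j + (\<Sum>a<r. c a * F a j)" "c r" "F r" k] by (simp add: algebra_simps)
  qed simp
  have b_left: "b (\<lambda>k. \<phi> k + (\<Sum>a<r. c a * \<Phi> a k)) f = b \<phi> f + (\<Sum>a<r. c a * b (\<Phi> a) f)"
    for \<phi> c \<Phi> f and r :: nat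
    unfolding b_def distrib_right sum.distrib sum_distrib_right sum_distrib_left
    by (subst (2) sum.swap) (simp add: mult.assoc)
  have b_right: "b \<phi> (\<lambda>j. f j + (\<Sum>a<r. c a * F a j)) = b \<phi> f + (\<Sum>a<r. c a * b \<phi> (F a))"
    for \<phi> c F f and r :: nat
    unfolding b_def Tsum distrib_left sum.distrib sum_distrib_left
    by (subst (2) sum.swap) (simp add: mult.left_commute)
  have b_scale: "b \<phi> (\<lambda>j. c * f j) = c * b \<phi> f" for \<phi> c f
    unfolding b_def Tscale sum_distrib_left by (simp add: mult.left_commute)
  have bound: "r \<le> card K" if d: "dual r \<Phi> F" for r \<Phi> F
  proof (rule ccontr)
    assume "\<not> r \<le> card K"
    obtain \<kappa> where \<kappa>: "bij_betw \<kappa> {0..<card K} K" using ex_bij_betw_nat_finite[OF K] by blast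
    let ?A = "mat r (card K) (\<lambda>(a, i). \<Phi> a (\<kappa> i))"
    let ?B = "mat (card K) r (\<lambda>(i, c). T (F c) (\<kappa> i))"
    have "?A * ?B = 1\<^sub>m r"
    proof (rule eq_matI)
      fix a c assume "a < dim_row (1\<^sub>m r :: 'a mat)" "c < dim_col (1\<^sub>m r :: 'a mat)"
      then have "a < r" "c < r" by auto
      moreover have "b (\<Phi> a) (F c) = (\<Sum>i = 0..<card K. \<Phi> a (\<kappa> i) * T (F c) (\<kappa> i))"
        unfolding b_def using sum.reindex_bij_betw[OF \<kappa>, of "\<lambda>k. \<Phi> a k * T (F c) k"] by simp
      ultimately show "(?A * ?B) $$ (a, c) = 1\<^sub>m r $$ (a, c)"
        using d by (auto simp: dual_def scalar_prod_def)
    qed auto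
    then show False
      using det_thin_product_eq_0[of ?A r "card K" ?B] \<open>\<not> r \<le> card K\<close> by simp
  qed
  have "\<exists>\<Phi> F. dual 0 \<Phi> F" by (simp add: dual_def)
  moreover have "\<forall>r. (\<exists>\<Phi> F. dual r \<Phi> F) \<longrightarrow> r < Suc (card K)" using bound by (auto simp: less_Suc_eq_le)
  ultimately have "\<exists>r. (\<exists>\<Phi> F. dual r \<Phi> F) \<and> (\<forall>r'. (\<exists>\<Phi> F. dual r' \<Phi> F) \<longrightarrow> r' \<le> r)"
    by (rule ex_has_greatest_nat)
  then obtain r where r: "\<exists>\<Phi> F. dual r \<Phi> F" "\<And>r'. \<exists>\<Phi> F. dual r' \<Phi> F \<Longrightarrow> r' \<le> r"
    by blast
  then obtain \<Phi> F where d: "dual r \<Phi> F" by blast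
  have dd: "b (\<Phi> a) (F c) = (if a = c then 1 else 0)" if "a < r" "c < r" for a c
    using d that by (simp add: dual_def)
  have factor: "b \<phi> f = (\<Sum>a<r. b \<phi> (F a) * b (\<Phi> a) f)" for \<phi> f
  proof (rule ccontr)
    assume ne: "b \<phi> f \<noteq> (\<Sum>a<r. b \<phi> (F a) * b (\<Phi> a) f)"
    \<comment> \<open>The parts of \<open>\<phi>\<close> and \<open>f\<close> orthogonal to the system; if they do not pair to zero, they enlarge it.\<close>
    define \<phi>' where "\<phi>' = (\<lambda>k. \<phi> k + (\<Sum>a<r. - b \<phi> (F a) * \<Phi> a k))"
    define f' where "f' = (\<lambda>j. f j + (\<Sum>a<r. - b (\<Phi> a) f * F a j))"
    have 1: "b \<phi>' (F c) = 0" if "c < r" for c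
    proof -
      have "(\<Sum>a<r. - b \<phi> (F a) * b (\<Phi> a) (F c)) = (\<Sum>a<r. if a = c then - b \<phi> (F a) else 0)"
        using that by (intro sum.cong) (auto simp: dd)
      then show ?thesis unfolding \<phi>'_def b_left using that by simp
    qed
    have 2: "b (\<Phi> c) f' = 0" if "c < r" for c
    proof -
      have "(\<Sum>a<r. - b (\<Phi> a) f * b (\<Phi> c) (F a)) = (\<Sum>a<r. if a = c then - b (\<Phi> a) f else 0)"
        using that by (intro sum.cong) (auto simp: dd)
      then show ?thesis unfolding f'_def b_right using that by simp
    qed
    have "b \<phi>' f' = b \<phi>' f" unfolding f'_def b_right using 1 by simp
    also have "\<dots> = b \<phi> f - (\<Sum>a<r. b \<phi> (F a) * b (\<Phi> a) f)"
      unfolding \<phi>'_def b_left by (simp add: sum_negf)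
    finally have 3: "b \<phi>' f' \<noteq> 0" using ne by simp
    have "dual (Suc r) (\<Phi>(r := \<phi>')) (F(r := (\<lambda>j. inverse (b \<phi>' f') * f' j)))"
      unfolding dual_def less_Suc_eq using 1 2 3 dd by (auto simp: b_scale)
    then show False using r(2)[of "Suc r"] by auto
  qed
  show ?thesis by (rule that[of r \<Phi> F, OF dd factor])
qed

lemma has_field_derivative_mult_id_0:
  fixes q :: "'a::real_normed_field \<Rightarrow> 'a"
  assumes "isCont q 0"
  shows "((\<lambda>s. s * q s) has_field_derivative q 0) (at 0)"
proof -
  have "((\<lambda>h. (h * q h - 0 * q 0) / h) \<longlongrightarrow> q 0) (at 0)"
    using assms unfolding isCont_def
    by (rule Lim_transform_eventually) (auto simp: eventually_at intro!: exI[of _ 1])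
  then show ?thesis by (simp add: DERIV_def)
qed

text \<open>At \<open>s = 0\<close> the matrix is the identity of size \<open>r\<close> bordered by zeros.  The last column is divisible
by \<open>s\<close>, and after division the matrix at \<open>s = 0\<close> is upper triangular with diagonal
\<open>1, \<dots>, 1, d r r\<close>.\<close>

lemma has_field_derivative_bordered_det:
  fixes d :: "nat \<Rightarrow> nat \<Rightarrow> complex"
  shows "((\<lambda>s. det (mat (Suc r) (Suc r)
            (\<lambda>(a, c). (if a = c \<and> a < r then 1 else 0) + s * d a c)))
          has_field_derivative d r r) (at 0)"
proof -
  define M where "M s = mat (Suc r) (Suc r) (\<lambda>(a, c).
      if c = r then d a r else (if a = c then 1 else 0) + s * d a c)" for s
  have det: "det (mat (Suc r) (Suc r) (\<lambda>(a, c). (if a = c \<and> a < r then 1 else 0) + s * d a c))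
      = s * det (M s)" for s
  proof -
    let ?D = "mat (Suc r) (Suc r) (\<lambda>(a, c). if a = c then if a = r then s else 1 else 0)"
    have "mat (Suc r) (Suc r) (\<lambda>(a, c). (if a = c \<and> a < r then 1 else 0) + s * d a c) = M s * ?D"
    proof (rule eq_matI)
      fix a c assume "a < dim_row (M s * ?D)" "c < dim_col (M s * ?D)"
      then have ac: "a < Suc r" "c < Suc r" by (auto simp: M_def)
      have "(M s * ?D) $$ (a, c) = (\<Sum>l<Suc r. M s $$ (a, l) * ?D $$ (l, c))"
        using ac by (simp add: M_def scalar_prod_def lessThan_atLeast0 del: sum.op_ivl_Suc)
      also have "\<dots> = (\<Sum>l<Suc r. if l = c then M s $$ (a, c) * (if c = r then s else 1) else 0)"
        using ac by (intro sum.cong) auto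
      also have "\<dots> = M s $$ (a, c) * (if c = r then s else 1)" using ac by (subst sum.delta) auto
      finally show "mat (Suc r) (Suc r)
          (\<lambda>(a, c). (if a = c \<and> a < r then 1 else 0) + s * d a c) $$ (a, c) = (M s * ?D) $$ (a, c)"
        using ac by (auto simp: M_def)
    qed (auto simp: M_def)
    moreover have "det ?D = s"
    proof -
      have "upper_triangular ?D" by (auto simp: upper_triangular_def)
      then have "det ?D = prod_list (diag_mat ?D)" by (rule det_upper_triangular[where n = "Suc r"]) simp
      also have "diag_mat ?D = map (\<lambda>a. if a = r then s else 1) [0..<Suc r]"
        by (auto simp: diag_mat_def simp del: upt_Suc)
      also have "prod_list \<dots> = s"
      proof -
        have "map (\<lambda>a. if a = r then s else 1) [0..<r] = map (\<lambda>a. 1) [0..<r]" by simp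
        then show ?thesis by (simp add: map_replicate_const prod_list_replicate)
      qed
      finally show ?thesis .
    qed
    ultimately show ?thesis using det_mult[of "M s" "Suc r" ?D] by (simp add: M_def)
  qed
  have M0: "det (M 0) = d r r"
  proof -
    have "upper_triangular (M 0)" by (auto simp: upper_triangular_def M_def)
    then have "det (M 0) = prod_list (diag_mat (M 0))"
      by (rule det_upper_triangular[where n = "Suc r"]) (simp add: M_def)
    also have "diag_mat (M 0) = map (\<lambda>a. if a = r then d r r else 1) [0..<Suc r]"
      by (auto simp: diag_mat_def M_def simp del: upt_Suc)
    also have "prod_list \<dots> = d r r"
    proof -
      have "map (\<lambda>a. if a = r then d r r else 1) [0..<r] = map (\<lambda>a. 1) [0..<r]" by simp
      then show ?thesis by (simp add: map_replicate_const prod_list_replicate)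
    qed
    finally show ?thesis .
  qed
  have "isCont (\<lambda>s. det (M s)) 0"
  proof -
    have entry: "isCont (\<lambda>s. (\<lambda>(a, c). if c = r then d a r else (if a = c then 1 else 0) + s * d a c) ac) 0"
      for ac
      by (cases "snd ac = r") (auto simp: split_def intro!: continuous_add continuous_mult continuous_ident continuous_const)
    show ?thesis
      unfolding M_def det_mat
      by (intro continuous_sum continuous_mult continuous_const continuous_prod entry)
  qed
  from has_field_derivative_mult_id_0[OF this] show ?thesis unfolding det M0 .
qed


section \<open>Conormal vectors of an orbit\<close>

lemma mult_mat_entry:
  assumes "A \<in> carrier_mat k l" "B \<in> carrier_mat l m" "i < k" "j < m"
  shows "(A * B) $$ (i, j) = (\<Sum>e<l. A $$ (i, e) * B $$ (e, j))"
  using assms by (simp add: scalar_prod_def lessThan_atLeast0)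

lemma tr_mult_commute:
  assumes "A \<in> carrier_mat k l" "B \<in> carrier_mat l k"
  shows "tr (A * B) = tr (B * A)"
proof -
  have "tr (A * B) = (\<Sum>i<k. \<Sum>j<l. A $$ (i, j) * B $$ (j, i))"
    using assms by (simp add: tr_def scalar_prod_def lessThan_atLeast0)
  also have "\<dots> = (\<Sum>j<l. \<Sum>i<k. B $$ (j, i) * A $$ (i, j))"
    by (subst sum.swap) (simp add: mult.commute)
  also have "\<dots> = tr (B * A)"
    using assms by (simp add: tr_def scalar_prod_def lessThan_atLeast0)
  finally show ?thesis .
qed

lemma tr_mult:
  assumes "A \<in> carrier_mat k l" "B \<in> carrier_mat l k"
  shows "tr (A * B) = (\<Sum>i<k. \<Sum>j<l. A $$ (i, j) * B $$ (j, i))"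
    using assms by (simp add: tr_def scalar_prod_def lessThan_atLeast0)

lemma tr_minus: "A \<in> carrier_mat k k \<Longrightarrow> B \<in> carrier_mat k k \<Longrightarrow> tr (A - B) = tr A - tr B"
  by (simp add: tr_def sum_subtractf)

lemma finite_Omega: "finite (Omega n)"
proof -
  have "Omega n \<subseteq> (\<lambda>i. (i, i + 1)) ` {1..n} \<union> {(n - 2, n)}" by (auto simp: Omega_def)
  then show ?thesis by (rule finite_subset) simp
qed

lemma Omega_swap_disjoint: "n \<ge> 4 \<Longrightarrow> Omega n \<inter> prod.swap ` Omega n = {}"
  by (auto simp: Omega_def)

lemma sum_edges:
  assumes "n \<ge> 4"
  shows "(\<Sum>h\<in>edges n. f h) = (\<Sum>h\<in>Omega n. f h + f (prod.swap h))"
proof -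
  have "(\<Sum>h\<in>prod.swap ` Omega n. f h) = (\<Sum>h\<in>Omega n. f (prod.swap h))"
    by (subst sum.reindex) (auto intro: inj_onI)
  then show ?thesis
    unfolding edges_def using Omega_swap_disjoint[OF assms] finite_Omega
    by (simp add: sum.union_disjoint sum.distrib)
qed

text \<open>The map \<open>psi\<close> is the moment map: its component along \<open>F\<close> is the value of the covector on the
infinitesimal motion by \<open>F\<close>.\<close>

lemma sum_tr_psi:
  assumes n: "n \<ge> 4" and X: "X \<in> E n v"
    and F: "\<And>i. i \<in> vertices n \<Longrightarrow> F i \<in> carrier_mat (v i) (v i)"
  shows "(\<Sum>h\<in>Omega n. tr ((F (target h) * X h - X h * F (source h)) * X (prod.swap h))) =
    (\<Sum>i\<in>vertices n. tr (F i * psi n v i X))"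
proof -
  have fin: "finite (edges n)" "finite (vertices n)" by (auto simp: edges_def finite_Omega vertices_def)
  have swap: "prod.swap h \<in> edges n" if "h \<in> edges n" for h using that by (force simp: edges_def)
  have XE: "X h \<in> carrier_mat (v (target h)) (v (source h))" if "h \<in> edges n" for h
    using X that by (auto simp: E_def)
  have XX: "X h * X (prod.swap h) \<in> carrier_mat (v (target h)) (v (target h))" if "h \<in> edges n" for h
    using XE[OF that] XE[OF swap[OF that]] by auto
  have "tr (F i * psi n v i X) = (\<Sum>h | h \<in> edges n \<and> target h = i.
      eps n h * tr (F (target h) * (X h * X (prod.swap h))))" if i: "i \<in> vertices n" for i
  proof -
    have "tr (F i * psi n v i X) =
      (\<Sum>a<v i. \<Sum>b<v i. F i $$ (a, b) * (\<Sum>h | h \<in> edges n \<and> target h = i.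
          eps n h * (X h * X (prod.swap h)) $$ (b, a)))"
      using F[OF i] by (subst tr_mult[of _ "v i" "v i"]) (auto simp: psi_def)
    also have "\<dots> = (\<Sum>h | h \<in> edges n \<and> target h = i. \<Sum>a<v i. \<Sum>b<v i.
         eps n h * (F i $$ (a, b) * (X h * X (prod.swap h)) $$ (b, a)))"
      by (simp add: sum_distrib_left mult.left_commute sum.swap[of _ "{h. h \<in> edges n \<and> target h = i}"])
    also have "\<dots> = (\<Sum>h | h \<in> edges n \<and> target h = i.
      eps n h * tr (F (target h) * (X h * X (prod.swap h))))"
      using XX F[OF i] by (intro sum.cong) (auto simp: tr_mult[of _ "v i" "v i"] sum_distrib_left)
    finally show ?thesis .
  qed
  then have "(\<Sum>i\<in>vertices n. tr (F i * psi n v i X)) = (\<Sum>i\<in>vertices n.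
     \<Sum>h | h \<in> edges n \<and> target h = i. eps n h * tr (F (target h) * (X h * X (prod.swap h))))"
    by simp
  also have "\<dots> = (\<Sum>h\<in>edges n. eps n h * tr (F (target h) * (X h * X (prod.swap h))))"
    using fin edges_endpoints[OF _ n] by (intro sum.group) auto
  also have "\<dots> = (\<Sum>h\<in>Omega n. tr (F (target h) * (X h * X (prod.swap h)))
      - tr (F (source h) * (X (prod.swap h) * X h)))"
    unfolding sum_edges[OF n]
  proof (intro sum.cong refl)
    fix h assume "h \<in> Omega n"
    then have "prod.swap h \<notin> Omega n" using Omega_swap_disjoint[OF n] by blast
    then show "eps n h * tr (F (target h) * (X h * X (prod.swap h))) +
         eps n (prod.swap h) * tr (F (target (prod.swap h)) * (X (prod.swap h) * X (prod.swap (prod.swap h)))) =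
         tr (F (target h) * (X h * X (prod.swap h))) - tr (F (source h) * (X (prod.swap h) * X h))"
      using \<open>h \<in> Omega n\<close> by (simp add: eps_def)
  qed
  also have "\<dots> = (\<Sum>h\<in>Omega n. tr ((F (target h) * X h - X h * F (source h)) * X (prod.swap h)))"
  proof (intro sum.cong refl)
    fix h assume "h \<in> Omega n"
    then have h: "h \<in> edges n" by (simp add: edges_def)
    note st = edges_endpoints[OF h n]
    note c = XE[OF h] XE[OF swap[OF h], simplified] F[OF st(1)] F[OF st(2)]
    have "tr ((F (target h) * X h - X h * F (source h)) * X (prod.swap h))
      = tr (F (target h) * X h * X (prod.swap h)) - tr (X h * F (source h) * X (prod.swap h))"
      using c by (subst minus_mult_distrib_mat[of _ "v (target h)" "v (source h)"])
        (auto intro!: tr_minus[of _ "v (target h)"])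
    also have "tr (F (target h) * X h * X (prod.swap h)) = tr (F (target h) * (X h * X (prod.swap h)))"
      using c by (subst assoc_mult_mat[of _ "v (target h)" "v (target h)" _ "v (source h)"]) auto
    also have "tr (X h * F (source h) * X (prod.swap h)) = tr (F (source h) * (X (prod.swap h) * X h))"
      using c assoc_mult_mat[OF c(1,3,2)] assoc_mult_mat[OF c(3,2,1)]
        tr_mult_commute[of "X h" "v (target h)" "v (source h)" "F (source h) * X (prod.swap h)"]
      by simp
    finally show "tr (F (target h) * (X h * X (prod.swap h))) - tr (F (source h) * (X (prod.swap h) * X h))
      = tr ((F (target h) * X h - X h * F (source h)) * X (prod.swap h))" by simp
  qed
  finally show ?thesis by simp
qed

text \<open>The polynomial \<open>p\<close> in the proof is the bordered minor described at the beginning.  It vanishes on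
the orbit because the form of \<open>y = g x\<close> arises from that of \<open>x\<close> by a change of both
arguments, so it still factors through dimension \<open>r\<close>.\<close>

lemma conormal_of_psi_eq_0:
  assumes n: "n \<ge> 4" and X: "X \<in> E n v"
    and psi0: "\<And>i. i \<in> vertices n \<Longrightarrow> psi n v i X = 0\<^sub>m (v i) (v i)"
    and Orb: "proj_Omega n v X \<in> Orb" "\<And>y. y \<in> Orb \<Longrightarrow> rep_iso n v (proj_Omega n v X) y"
  shows "X \<in> conormal n v Orb"
proof -
  define x where "x = proj_Omega n v X"
  have OE: "h \<in> edges n" "prod.swap h \<in> edges n" "source h \<in> vertices n" "target h \<in> vertices n"
    if "h \<in> Omega n" for h
    using that edges_endpoints[OF _ n, of h] by (auto simp: edges_def)
  have XE: "X h \<in> carrier_mat (v (target h)) (v (source h))" if "h \<in> edges n" for h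
    using X that by (auto simp: E_def)
  have xX: "x h = X h" if "h \<in> Omega n" for h using that OE by (simp add: x_def proj_Omega_def)
  have xE: "x h \<in> carrier_mat (v (target h)) (v (source h))" if "h \<in> edges n" for h
    using XE that by (auto simp: x_def proj_Omega_def)
  define K where "K = (SIGMA h:Omega n. {..<v (target h)} \<times> {..<v (source h)})"
  have finK: "finite K" unfolding K_def by (auto simp: finite_Omega)
  have sumK: "(\<Sum>k\<in>K. f k) = (\<Sum>h\<in>Omega n. \<Sum>r<v (target h). \<Sum>c<v (source h). f (h, r, c))"
    for f :: "_ \<Rightarrow> complex"
    unfolding K_def sum.cartesian_product
    by (subst sum.Sigma) (auto simp: finite_Omega intro!: sum.cong)
  \<comment> \<open>\<open>T y f\<close> lists the entries of \<open>y f - f x\<close>, and \<open>b y\<close> is the associated bilinear form.\<close>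
  define T :: "rep \<Rightarrow> (nat \<times> nat \<times> nat \<Rightarrow> complex) \<Rightarrow> edge \<times> nat \<times> nat \<Rightarrow> complex" where
    "T y f = (\<lambda>(h, r, c). (\<Sum>k<v (source h). y h $$ (r, k) * f (source h, k, c))
        - (\<Sum>k<v (target h). f (target h, r, k) * x h $$ (k, c)))" for y f
  define b where "b y \<phi> f = (\<Sum>k\<in>K. \<phi> k * T y f k)" for y \<phi> f
  define Fm where "Fm f i = mat (v i) (v i) (\<lambda>(a, c). f (i, a, c))" for f :: "nat \<times> nat \<times> nat \<Rightarrow> complex" and i
  have Fm: "Fm f i \<in> carrier_mat (v i) (v i)" for f i by (simp add: Fm_def)
  have Fm_entry: "a < v i \<Longrightarrow> c < v i \<Longrightarrow> Fm f i $$ (a, c) = f (i, a, c)"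
      "dim_row (Fm f i) = v i" "dim_col (Fm f i) = v i" for f i a c
    by (simp_all add: Fm_def)
  have T_mat: "T y f (h, r, c) = (y h * Fm f (source h) - Fm f (target h) * x h) $$ (r, c)"
    if "h \<in> Omega n" "y h \<in> carrier_mat (v (target h)) (v (source h))" "r < v (target h)" "c < v (source h)"
    for y f h r c
    using that xE[OF OE(1)[OF that(1)]]
    by (simp add: T_def Fm_def scalar_prod_def lessThan_atLeast0)
  have T_lin: "T y (\<lambda>j. f j + c * g j) k = T y f k + c * T y g k" for y f g c k
    by (cases k) (simp add: T_def algebra_simps sum.distrib sum_distrib_left)
  \<comment> \<open>\<open>\<phi>0\<close> is the covector given by \<open>X\<close>, and \<open>f0\<close> is the identity.\<close>
  define \<phi>0 :: "edge \<times> nat \<times> nat \<Rightarrow> complex" where "\<phi>0 = (\<lambda>(h, r, c). X (prod.swap h) $$ (c, r))"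
  define f0 :: "nat \<times> nat \<times> nat \<Rightarrow> complex" where "f0 = (\<lambda>(i, r, c). if r = c then 1 else 0)"
  have tr_\<phi>0: "(\<Sum>r<v (target h). \<Sum>c<v (source h). \<phi>0 (h, r, c) * A $$ (r, c)) = tr (A * X (prod.swap h))"
    if "h \<in> Omega n" "A \<in> carrier_mat (v (target h)) (v (source h))" for A h
    using that XE[OF OE(2)[OF that(1)]]
    by (simp add: tr_mult[of A "v (target h)" "v (source h)"] \<phi>0_def mult.commute)
  have b\<phi>0: "b x \<phi>0 f = 0" for f
  proof -
    have T_X: "T x f (h, r, c) = (X h * Fm f (source h) - Fm f (target h) * X h) $$ (r, c)"
      if "h \<in> Omega n" "r < v (target h)" "c < v (source h)" for h r c
      using T_mat[of h x r c f] that OE(1)[OF that(1)] by (simp add: xX XE)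
    have "b x \<phi>0 f = (\<Sum>h\<in>Omega n. \<Sum>r<v (target h). \<Sum>c<v (source h). \<phi>0 (h, r, c) *
        (X h * Fm f (source h) - Fm f (target h) * X h) $$ (r, c))"
      unfolding b_def sumK
      by (intro sum.cong refl) (simp add: T_X)
    also have "\<dots> = (\<Sum>h\<in>Omega n. tr ((X h * Fm f (source h) - Fm f (target h) * X h) * X (prod.swap h)))"
      using tr_\<phi>0 XE OE Fm
      by (intro sum.cong refl) (meson minus_carrier_mat mult_carrier_mat)
    also have "\<dots> = - (\<Sum>h\<in>Omega n. tr ((Fm f (target h) * X h - X h * Fm f (source h)) * X (prod.swap h)))"
      unfolding sum_negf[symmetric]
    proof (intro sum.cong refl)
      fix h assume h: "h \<in> Omega n"
      note c = XE[OF OE(1)[OF h]] XE[OF OE(2)[OF h]] Fm[of f "source h"] Fm[of f "target h"]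
      show "tr ((X h * Fm f (source h) - Fm f (target h) * X h) * X (prod.swap h)) =
         - tr ((Fm f (target h) * X h - X h * Fm f (source h)) * X (prod.swap h))"
        using c by (simp add: minus_mult_distrib_mat[of _ "v (target h)" "v (source h)"] tr_minus[of _ "v (target h)"])
    qed
    also have "\<dots> = 0"
    proof -
      have "tr (Fm f i * psi n v i X) = 0" if "i \<in> vertices n" for i
        unfolding psi0[OF that] using Fm[of f i] by (simp add: tr_def)
      then show ?thesis using sum_tr_psi[OF n X, of "Fm f", OF Fm] by simp
    qed
    finally show ?thesis .
  qed
  have Tf0: "T y f0 (h, r, c) = y h $$ (r, c) - x h $$ (r, c)"
    if "r < v (target h)" "c < v (source h)" for y h r c
  proof -
    have "(\<Sum>k<v (source h). y h $$ (r, k) * f0 (source h, k, c)) = y h $$ (r, c)"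
      using that by (simp add: f0_def if_distrib sum.delta cong: if_cong)
    moreover have "(\<Sum>k<v (target h). f0 (target h, r, k) * x h $$ (k, c)) = x h $$ (r, c)"
      using that by (simp add: f0_def if_distrib if_distribR sum.delta' cong: if_cong)
    ultimately show ?thesis by (simp add: T_def)
  qed
  have bf0: "b x \<phi> f0 = 0" for \<phi>
    unfolding b_def by (intro sum.neutral) (auto simp: K_def Tf0)
  obtain r :: nat and \<Phi> :: "nat \<Rightarrow> edge \<times> nat \<times> nat \<Rightarrow> complex"
      and F :: "nat \<Rightarrow> nat \<times> nat \<times> nat \<Rightarrow> complex" where
    dual: "\<And>a c. a < r \<Longrightarrow> c < r \<Longrightarrow> b x (\<Phi> a) (F c) = (if a = c then 1 else 0)"
    and fact: "\<And>\<phi> f. b x \<phi> f = (\<Sum>a<r. b x \<phi> (F a) * b x (\<Phi> a) f)"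
    by (rule finite_rank_factorisation[where T = "T x", OF finK T_lin, folded b_def]) (rule that)
  define \<Phi>' where "\<Phi>' = \<Phi>(r := \<phi>0)"
  define F' where "F' = F(r := f0)"
  define p where "p y = det (mat (Suc r) (Suc r) (\<lambda>(a, c). b y (\<Phi>' a) (F' c)))" for y
  have p_poly: "p \<in> polyfuns (coords_E n v)"
  proof -
    have coord: "(\<lambda>y. y h $$ (a, k)) \<in> polyfuns (coords_E n v)"
      if "h \<in> Omega n" "a < v (target h)" "k < v (source h)" for h a k
      by (rule polyfuns.coord) (unfold coords_E_def, use that OE(1)[OF that(1)] in blast)
    have diff: "(\<lambda>y. A y - c) \<in> polyfuns (coords_E n v)" if "A \<in> polyfuns (coords_E n v)" for A c
      using polyfuns.add[OF that polyfuns.const[of "- c"]] by simp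
    have "(\<lambda>y. b y \<phi> f) \<in> polyfuns (coords_E n v)" for \<phi> f
      unfolding b_def T_def K_def
      by (intro polyfuns_sum polyfuns.mult polyfuns.const) (auto intro!: diff coord polyfuns_sum polyfuns.mult polyfuns.const)
    then show ?thesis unfolding p_def by (intro polyfuns_det)
  qed
  have p_Orb: "p y = 0" if y: "y \<in> Orb" for y
  proof -
    obtain g where g: "g \<in> G n v" "y = act n v g x"
      using Orb(2)[OF y] unfolding rep_iso_def x_def by blast
    have gi: "g i \<in> Units (GL_ring (v i))" if "i \<in> vertices n" for i
      using g(1) that by (auto simp: G_def)
    \<comment> \<open>The substitutions \<open>f \<mapsto> g\<^sup>-\<^sup>1 f\<close> and \<open>\<phi> \<mapsto> \<phi> g\<close> carry the form of \<open>x\<close> to that of \<open>y\<close>.\<close>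
    define gf where "gf f = (\<lambda>(i, a, c). (inv\<^bsub>GL_ring (v i)\<^esub> (g i) * Fm f i) $$ (a, c))" for f
    define g\<phi> :: "(edge \<times> nat \<times> nat \<Rightarrow> complex) \<Rightarrow> _" where
      "g\<phi> \<phi> = (\<lambda>(h, k, c). \<Sum>a<v (target h). \<phi> (h, a, c) * g (target h) $$ (a, k))" for \<phi>
    have Fgf: "Fm (gf f) i = inv\<^bsub>GL_ring (v i)\<^esub> (g i) * Fm f i" if "i \<in> vertices n" for f i
    proof -
      have "inv\<^bsub>GL_ring (v i)\<^esub> (g i) * Fm f i \<in> carrier_mat (v i) (v i)"
        using GL_inv_carrier[OF gi[OF that]] Fm[of f i] by (rule mult_carrier_mat)
      then show ?thesis by (intro eq_matI) (auto simp: Fm_entry gf_def simp del: index_mult_mat(1))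
    qed
    have b_act: "b y \<phi> f = b x (g\<phi> \<phi>) (gf f)" for \<phi> f
    proof -
      have T_act: "T y f (h, a, c) = (\<Sum>k<v (target h). g (target h) $$ (a, k) * T x (gf f) (h, k, c))"
        if h: "h \<in> Omega n" and ac: "a < v (target h)" "c < v (source h)" for h a c
      proof -
        let ?s = "source h" and ?t = "target h"
        note cs = xE[OF OE(1)[OF h]] GL_carrier[OF gi[OF OE(4)[OF h]]]
          GL_inv_carrier[OF gi[OF OE(4)[OF h]]] GL_inv_carrier[OF gi[OF OE(3)[OF h]]]
          Fm[of f ?s] Fm[of f ?t]
        have yh: "y h = g ?t * x h * inv\<^bsub>GL_ring (v ?s)\<^esub> (g ?s)"
          using g(2) OE[OF h] by (simp add: act_def)
        then have yc: "y h \<in> carrier_mat (v ?t) (v ?s)" using cs by auto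
        have "y h * Fm f ?s - Fm f ?t * x h = g ?t * (x h * Fm (gf f) ?s - Fm (gf f) ?t * x h)"
        proof -
          have "y h * Fm f ?s = g ?t * (x h * Fm (gf f) ?s)"
            unfolding yh Fgf[OF OE(3)[OF h]] using cs
            by (simp add: assoc_mult_mat[of _ "v ?t" "v ?t" _ "v ?s" _ "v ?s"]
              assoc_mult_mat[of _ "v ?t" "v ?s" _ "v ?s" _ "v ?s"])
          moreover have "Fm f ?t * x h = g ?t * (Fm (gf f) ?t * x h)"
          proof -
            have "g ?t * (inv\<^bsub>GL_ring (v ?t)\<^esub> (g ?t) * Fm f ?t * x h)
              = (g ?t * inv\<^bsub>GL_ring (v ?t)\<^esub> (g ?t)) * (Fm f ?t * x h)"
              using cs by (simp add: assoc_mult_mat[of _ "v ?t" "v ?t" _ "v ?t" _ "v ?s"])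
            then show ?thesis
              unfolding Fgf[OF OE(4)[OF h]] GL_inv_right[OF gi[OF OE(4)[OF h]]] using cs by simp
          qed
          ultimately show ?thesis
            using cs Fm[of "gf f" ?s] Fm[of "gf f" ?t]
            by (simp add: mult_minus_distrib_mat[of _ "v ?t" "v ?t" _ "v ?s"])
        qed
        moreover have "x h * Fm (gf f) ?s - Fm (gf f) ?t * x h \<in> carrier_mat (v ?t) (v ?s)"
          using mult_carrier_mat[OF Fm cs(1)] by (rule minus_carrier_mat)
        ultimately show ?thesis
          using T_mat[of h y a c f, OF h yc ac] T_mat[of h x _ c "gf f", OF h cs(1) _ ac(2)]
            mult_mat_entry[OF cs(2) _ ac] by simp
      qed
      have "b y \<phi> f = (\<Sum>h\<in>Omega n. \<Sum>a<v (target h). \<Sum>c<v (source h). \<Sum>k<v (target h).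
          \<phi> (h, a, c) * g (target h) $$ (a, k) * T x (gf f) (h, k, c))"
        unfolding b_def sumK by (intro sum.cong refl) (simp add: T_act sum_distrib_left mult.assoc)
      also have "\<dots> = (\<Sum>h\<in>Omega n. \<Sum>k<v (target h). \<Sum>c<v (source h). \<Sum>a<v (target h).
          \<phi> (h, a, c) * g (target h) $$ (a, k) * T x (gf f) (h, k, c))"
      proof (rule sum.cong[OF refl])
        fix h
        let ?A = "\<lambda>a c k. \<phi> (h, a, c) * g (target h) $$ (a, k) * T x (gf f) (h, k, c)"
        have "(\<Sum>a<v (target h). \<Sum>c<v (source h). \<Sum>k<v (target h). ?A a c k)
          = (\<Sum>c<v (source h). \<Sum>a<v (target h). \<Sum>k<v (target h). ?A a c k)" by (rule sum.swap)
        also have "\<dots> = (\<Sum>c<v (source h). \<Sum>k<v (target h). \<Sum>a<v (target h). ?A a c k)"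
          by (intro sum.cong refl sum.swap)
        also have "\<dots> = (\<Sum>k<v (target h). \<Sum>c<v (source h). \<Sum>a<v (target h). ?A a c k)" by (rule sum.swap)
        finally show "(\<Sum>a<v (target h). \<Sum>c<v (source h). \<Sum>k<v (target h). ?A a c k)
          = (\<Sum>k<v (target h). \<Sum>c<v (source h). \<Sum>a<v (target h). ?A a c k)" .
      qed
      also have "\<dots> = b x (g\<phi> \<phi>) (gf f)"
        unfolding b_def sumK by (simp add: g\<phi>_def sum_distrib_right)
      finally show ?thesis .
    qed
    have "mat (Suc r) (Suc r) (\<lambda>(a, c). b y (\<Phi>' a) (F' c)) =
      mat (Suc r) r (\<lambda>(a, e). b x (g\<phi> (\<Phi>' a)) (F e)) * mat r (Suc r) (\<lambda>(e, c). b x (\<Phi> e) (gf (F' c)))"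
    proof (rule eq_matI, goal_cases)
      case (1 a c)
      then show ?case
        using fact[of "g\<phi> (\<Phi>' a)" "gf (F' c)"]
        by (simp add: b_act scalar_prod_def lessThan_atLeast0 del: sum.op_ivl_Suc)
    qed auto
    then show "p y = 0" unfolding p_def
      by (simp only:) (rule det_thin_product_eq_0[where r = r and k = "Suc r"], simp_all)
  qed
  have "symp n t X = 0" if t: "t \<in> tangent_space n v Orb x" for t
  proof -
    have tE: "t h \<in> carrier_mat (v (target h)) (v (source h))" if "h \<in> edges n" for h
      using t that by (auto simp: tangent_space_def E_Omega_def E_def)
    have t0: "t h = 0\<^sub>m (v (target h)) (v (source h))" if "h \<in> edges n" "h \<notin> Omega n" for h
      using t that by (auto simp: tangent_space_def E_Omega_def)
    let ?line = "\<lambda>s. \<lambda>h\<in>edges n. x h + s \<cdot>\<^sub>m t h"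
    define d where "d \<phi> f = (\<Sum>(h, a, c)\<in>K. \<phi> (h, a, c) * (\<Sum>k<v (source h). t h $$ (a, k) * f (source h, k, c)))" for \<phi> f
    have b_line: "b (?line s) \<phi> f = b x \<phi> f + s * d \<phi> f" for s \<phi> f
    proof -
      have T_line: "T (?line s) f (h, a, c) = T x f (h, a, c) + s * (\<Sum>k<v (source h). t h $$ (a, k) * f (source h, k, c))"
        if "h \<in> Omega n" "a < v (target h)" for h a c
        using that OE[OF that(1)] xE[OF OE(1)[OF that(1)]] tE[OF OE(1)[OF that(1)]]
        by (simp add: T_def sum.distrib sum_distrib_left algebra_simps)
      show ?thesis unfolding b_def d_def
        by (subst sum_distrib_left, subst sum.distrib[symmetric], rule sum.cong)
          (auto simp: K_def T_line algebra_simps)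
    qed
    have "p (?line s) = det (mat (Suc r) (Suc r)
            (\<lambda>(a, c). (if a = c \<and> a < r then 1 else 0) + s * d (\<Phi>' a) (F' c)))" for s
      unfolding p_def b_line
      by (intro arg_cong[where f = det] cong_mat refl)
        (auto simp: \<Phi>'_def F'_def dual b\<phi>0 bf0 less_Suc_eq)
    then have "((\<lambda>s. p (?line s)) has_field_derivative d (\<Phi>' r) (F' r)) (at 0)"
      using has_field_derivative_bordered_det[of r "\<lambda>a c. d (\<Phi>' a) (F' c)"] by simp
    moreover have "((\<lambda>s. p (?line s)) has_field_derivative 0) (at 0)"
      using t p_poly p_Orb by (auto simp: tangent_space_def)
    ultimately have "d \<phi>0 f0 = 0" using DERIV_unique by (fastforce simp: \<Phi>'_def F'_def)
    moreover have "d \<phi>0 f0 = symp n t X"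
    proof -
      have "d \<phi>0 f0 = (\<Sum>h\<in>Omega n. \<Sum>a<v (target h). \<Sum>c<v (source h). \<phi>0 (h, a, c) * t h $$ (a, c))"
        unfolding d_def sumK
        by (intro sum.cong refl) (simp add: f0_def if_distrib sum.delta cong: if_cong)
      also have "\<dots> = (\<Sum>h\<in>Omega n. tr (t h * X (prod.swap h)))"
        using tr_\<phi>0 tE OE by simp
      also have "\<dots> = symp n t X"
        unfolding symp_def sum_edges[OF n]
      proof (intro sum.cong refl)
        fix h assume h: "h \<in> Omega n"
        then have h': "prod.swap h \<notin> Omega n" using Omega_swap_disjoint[OF n] by blast
        have "tr (t (prod.swap h) * X h) = 0"
          using t0[OF OE(2)[OF h] h'] XE[OF OE(1)[OF h]] by (simp add: tr_def)
        then show "tr (t h * X (prod.swap h)) = eps n h * tr (t h * X (prod.swap h))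
           + eps n (prod.swap h) * tr (t (prod.swap h) * X (prod.swap (prod.swap h)))"
          using h by (simp add: eps_def)
      qed
      finally show ?thesis .
    qed
    ultimately show ?thesis by simp
  qed
  then show ?thesis using X Orb(1) by (simp add: conormal_def x_def)
qed


section \<open>Boxes of the shifted staircase\<close>

text \<open>The framing sits at one of the two spin vertices, so that both halves of the theorem are instances
of one argument.  Boxes are pairs \<open>(r, d)\<close> of a row and a position in the row, both counted from 0;
row \<open>r\<close> is drawn shifted by \<open>r\<close> columns to the right.\<close>

locale spin_vertex =
  fixes n s :: nat
  assumes n4: "n \<ge> 4" and s: "s = n \<or> s = n - 1"
begin

text \<open>The leaf of the Dynkin graph at which row \<open>r\<close> begins; \<open>2 * n - 1 - s\<close> is the spin vertex other
than \<open>s\<close>.\<close>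

definition row_end :: "nat \<Rightarrow> nat" where
  "row_end r = (if even r then s else 2 * n - 1 - s)"

text \<open>The position in its row of a box at the vertex \<open>i\<close>, in other words the distance from \<open>i\<close> to the
nearer spin vertex.\<close>

definition depth :: "nat \<Rightarrow> nat" where
  "depth i = (if i < n - 1 then n - 1 - i else 0)"

definition label :: "nat \<Rightarrow> nat \<Rightarrow> nat" where
  "label r d = (if d = 0 then row_end r else n - 1 - d)"

text \<open>The row of the \<open>k\<close>-th box at the vertex \<open>i\<close>, counted from above.  Every row meets the vertices up
to \<open>n - 2\<close>, but only every second row meets a given spin vertex.\<close>

definition rowno :: "nat \<Rightarrow> nat \<Rightarrow> nat" where
  "rowno i k = (if i < n - 1 then k else if i = s then 2 * k else Suc (2 * k))"

text \<open>Arrows of \<open>\<Omega>\<close> act along a row, the opposite arrows lead from a row to the row above it.\<close>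

definition row_step :: "edge \<Rightarrow> nat" where
  "row_step h = (if h \<in> Omega n then 0 else 1)"

lemma row_end_cases: "row_end r = n \<and> row_end (Suc r) = n - 1 \<or> row_end r = n - 1 \<and> row_end (Suc r) = n"
  using s n4 by (auto simp: row_end_def)

lemma row_end_bounds: "row_end r < Suc n" "row_end r \<ge> n - 1"
  using row_end_cases[of r] by auto

lemma label_simps [simp]: "label r 0 = row_end r" "label r (Suc d) = n - 2 - d" "label r 1 = n - 2"
  by (auto simp: label_def)

lemma label_vertices: "d \<le> n - 2 \<Longrightarrow> label r d \<in> vertices n"
  using n4 row_end_bounds[of r] by (auto simp: label_def vertices_def)

lemma depth_label: "d \<le> n - 2 \<Longrightarrow> depth (label r d) = d"
  using n4 row_end_bounds[of r] by (auto simp: label_def depth_def)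

lemma depth_le: "i \<in> vertices n \<Longrightarrow> depth i \<le> n - 2"
  by (auto simp: depth_def vertices_def)

lemma label_rowno: "i \<in> vertices n \<Longrightarrow> label (rowno i k) (depth i) = i"
  using n4 s by (auto simp: label_def depth_def vertices_def rowno_def row_end_def)

lemma ex_rowno: "d \<le> n - 2 \<Longrightarrow> \<exists>k. rowno (label r d) k = r"
proof (cases d)
  case 0
  have "rowno (row_end r) (r div 2) = r" using row_end_bounds[of r] s n4
    by (auto simp: rowno_def row_end_def elim!: evenE oddE)
  then show ?thesis using 0 by auto
qed (use n4 in \<open>auto simp: rowno_def\<close>)

lemma rowno_inj: "rowno i k = rowno i l \<longleftrightarrow> k = l"
  by (auto simp: rowno_def)

lemma rowno_mono: "rowno i k \<le> rowno i l \<longleftrightarrow> k \<le> l"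
  by (auto simp: rowno_def)

lemma edge_cases:
  assumes "h \<in> edges n"
  obtains (right) r d where "d < n - 2" "h = (label r (Suc d), label r d)" "h \<in> Omega n" "row_step h = 0"
    | (down) r d where "d < n - 2" "h = (label r d, label r (Suc d))" "h \<notin> Omega n" "row_step h = 1"
proof -
  have *: "\<exists>r d. d < n - 2 \<and> e = (label r (Suc d), label r d)" if "e \<in> Omega n" for e
  proof -
    from that consider (1) i where "1 \<le> i" "i \<le> n - 3" "e = (i, i + 1)" | (2) "e = (n - 2, n - 1)" | (3) "e = (n - 2, n)"
      using n4 unfolding Omega_def by fastforce
    then show ?thesis
    proof cases
      case 1 then show ?thesis using n4 by (intro exI[of _ 0] exI[of _ "n - 2 - i"]) (auto simp: label_def)
    next
      case 2 then show ?thesis using n4 s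
        by (intro exI[of _ "if s = n then 1 else 0"] exI[of _ 0]) (auto simp: row_end_def)
    next
      case 3 then show ?thesis using n4 s
        by (intro exI[of _ "if s = n then 0 else 1"] exI[of _ 0]) (auto simp: row_end_def)
    qed
  qed
  show ?thesis
  proof (cases "h \<in> Omega n")
    case True
    then obtain r d where "d < n - 2" "h = (label r (Suc d), label r d)" using * by blast
    then show ?thesis using right True by (simp add: row_step_def)
  next
    case False
    then have "prod.swap h \<in> Omega n" using assms by (auto simp: edges_def)
    then obtain r d where "d < n - 2" "prod.swap h = (label r (Suc d), label r d)" using * by blast
    then have "h = (label r d, label r (Suc d))" by (cases h) simp
    then show ?thesis using down False \<open>d < n - 2\<close> by (simp add: row_step_def)
  qed
qed

lemma Omega_label: "d < n - 2 \<Longrightarrow> (label r (Suc d), label r d) \<in> Omega n"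
proof (cases d)
  case 0
  then show ?thesis using row_end_cases[of r] n4 by (fastforce simp: Omega_def)
next
  case (Suc e)
  assume "d < n - 2"
  then have "(label r (Suc d), label r d) = (n - 3 - e, (n - 3 - e) + 1)" "1 \<le> n - 3 - e" "n - 3 - e \<le> n - 2"
    using Suc n4 by auto
  then show ?thesis unfolding Omega_def by blast
qed

lemma edges_label: "d < n - 2 \<Longrightarrow> (label r (Suc d), label r d) \<in> edges n" "d < n - 2 \<Longrightarrow> (label r d, label r (Suc d)) \<in> edges n"
  using Omega_label[of d r] unfolding edges_def by force+

end

section \<open>The preprojective relations\<close>

lemma incoming_edges:
  assumes n: "n \<ge> 4" and i: "i \<in> vertices n"
  shows "{h \<in> edges n. target h = i} =
    (if i = 1 then {(2, 1)}
     else if i \<le> n - 3 then {(i - 1, i), (i + 1, i)}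
     else if i = n - 2 then {(n - 3, n - 2), (n - 1, n - 2), (n, n - 2)}
     else {(n - 2, i)})"
proof -
  have "(a, i) \<in> edges n \<longleftrightarrow> (1 \<le> a \<and> a \<le> n - 2 \<and> i = a + 1) \<or> (a = n - 2 \<and> i = n) \<or>
     (1 \<le> i \<and> i \<le> n - 2 \<and> a = i + 1) \<or> (i = n - 2 \<and> a = n)" for a
    unfolding edges_def Omega_def by (auto simp: image_iff)
  moreover have "(1 \<le> a \<and> a \<le> n - 2 \<and> i = a + 1) \<or> (a = n - 2 \<and> i = n) \<or>
      (1 \<le> i \<and> i \<le> n - 2 \<and> a = i + 1) \<or> (i = n - 2 \<and> a = n) \<longleftrightarrow>
    (if i = 1 then a = 2
     else if i \<le> n - 3 then a = i - 1 \<or> a = i + 1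
     else if i = n - 2 then a = n - 3 \<or> a = n - 1 \<or> a = n
     else a = n - 2)" for a
  proof -
    obtain k where k: "n = Suc (Suc (Suc (Suc k)))" using n that[of "n - 4"] by auto
    have "1 \<le> i" "i \<le> n" using i by (auto simp: vertices_def)
    then consider "i = 1" | "2 \<le> i" "i \<le> n - 3" | "i = n - 2" | "i = n - 1" | "i = n"
      by linarith
    then show ?thesis
    proof cases
      case 1 then show ?thesis using n by auto
    next
      case 2 then show ?thesis using n by auto
    next
      case 3 then show ?thesis by (auto simp: k)
    next
      case 4 then show ?thesis by (auto simp: k)
    next
      case 5 then show ?thesis by (auto simp: k)
    qed
  qed
  ultimately have mem: "(a, i) \<in> edges n \<longleftrightarrow> (if i = 1 then a = 2
     else if i \<le> n - 3 then a = i - 1 \<or> a = i + 1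
     else if i = n - 2 then a = n - 3 \<or> a = n - 1 \<or> a = n
     else a = n - 2)" for a
    by simp
  have "{h \<in> edges n. target h = i} = (\<lambda>a. (a, i)) ` {a. (a, i) \<in> edges n}" by auto
  then show ?thesis by (simp add: mem insert_commute Collect_disj_eq image_Un)
qed

text \<open>At every vertex at most one incoming edge lies in \<open>\<Omega>\<close> and all others carry the sign \<open>-1\<close>, so
the relations can be written without signs.\<close>

lemma preprojective_relations:
  assumes n: "n \<ge> 4" and x: "x \<in> E n v"
    and psi: "\<And>i. i \<in> vertices n \<Longrightarrow> psi n v i x = 0\<^sub>m (v i) (v i)"
  shows "x (2, 1) * x (1, 2) = 0\<^sub>m (v 1) (v 1)"
    and "\<And>i. 2 \<le> i \<Longrightarrow> i \<le> n - 3 \<Longrightarrow> x (i + 1, i) * x (i, i + 1) = x (i - 1, i) * x (i, i - 1)"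
    and "x (n - 3, n - 2) * x (n - 2, n - 3) =
      x (n - 1, n - 2) * x (n - 2, n - 1) + x (n, n - 2) * x (n - 2, n)"
    and "\<And>i. i \<in> {n - 1, n} \<Longrightarrow> x (n - 2, i) * x (i, n - 2) = 0\<^sub>m (v i) (v i)"
proof -
  have xE: "x (a, b) \<in> carrier_mat (v b) (v a)" if "(a, b) \<in> edges n" for a b
    using PiE_mem[OF x[unfolded E_def] that] by simp
  have sum0: "(\<Sum>h\<in>{h \<in> edges n. target h = i}. eps n h * (x h * x (prod.swap h)) $$ (r, c)) = 0"
    if "i \<in> vertices n" "r < v i" "c < v i" for i r c
    using arg_cong[OF psi[OF that(1)], of "\<lambda>A. A $$ (r, c)"] that by (simp add: psi_def)
  have eps_nz: "eps n h \<noteq> 0" for h by (simp add: eps_def)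
  have Om: "(a, b) \<in> Omega n \<longleftrightarrow> (1 \<le> a \<and> a \<le> n - 2 \<and> b = a + 1) \<or> (a = n - 2 \<and> b = n)" for a b
    by (auto simp: Omega_def)
  have ed: "(a, b) \<in> edges n \<longleftrightarrow> (a, b) \<in> Omega n \<or> (b, a) \<in> Omega n" for a b
    unfolding edges_def by (force simp: image_iff)
  show "x (2, 1) * x (1, 2) = 0\<^sub>m (v 1) (v 1)"
  proof (rule eq_matI)
    fix r c assume "r < dim_row (0\<^sub>m (v 1) (v 1) :: complex mat)" "c < dim_col (0\<^sub>m (v 1) (v 1) :: complex mat)"
    then show "(x (2, 1) * x (1, 2)) $$ (r, c) = 0\<^sub>m (v 1) (v 1) $$ (r, c)"
      using sum0[of 1 r c] n by (simp add: incoming_edges[OF n] vertices_def eps_nz)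
  next
    have "x (2, 1) \<in> carrier_mat (v 1) (v 2)" "x (1, 2) \<in> carrier_mat (v 2) (v 1)"
      by (intro xE; use n in \<open>simp add: ed Om\<close>)+
    then show "dim_row (x (2, 1) * x (1, 2)) = dim_row (0\<^sub>m (v 1) (v 1) :: complex mat)"
      "dim_col (x (2, 1) * x (1, 2)) = dim_col (0\<^sub>m (v 1) (v 1) :: complex mat)"
      by (metis carrier_matD index_mult_mat(2,3) index_zero_mat(2,3))+
  qed
  show "x (i + 1, i) * x (i, i + 1) = x (i - 1, i) * x (i, i - 1)" if i: "2 \<le> i" "i \<le> n - 3" for i
  proof -
    have c: "x (i + 1, i) \<in> carrier_mat (v i) (v (i + 1))" "x (i, i + 1) \<in> carrier_mat (v (i + 1)) (v i)"
      "x (i - 1, i) \<in> carrier_mat (v i) (v (i - 1))" "x (i, i - 1) \<in> carrier_mat (v (i - 1)) (v i)"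
      by (intro xE; use i n in \<open>auto simp: ed Om\<close>)+
    have "eps n (i - 1, i) = 1" "eps n (i + 1, i) = - 1" using i n by (auto simp: eps_def Om)
    then have "(x (i + 1, i) * x (i, i + 1)) $$ (r, k) = (x (i - 1, i) * x (i, i - 1)) $$ (r, k)"
      if "r < v i" "k < v i" for r k
      using sum0[of i r k] that i n by (simp add: incoming_edges[OF n] vertices_def)
    then show ?thesis by (intro eq_matI) (use c in auto)
  qed
  show "x (n - 3, n - 2) * x (n - 2, n - 3) =
      x (n - 1, n - 2) * x (n - 2, n - 1) + x (n, n - 2) * x (n - 2, n)"
  proof -
    have c: "x (n - 3, n - 2) \<in> carrier_mat (v (n - 2)) (v (n - 3))" "x (n - 2, n - 3) \<in> carrier_mat (v (n - 3)) (v (n - 2))"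
      "x (n - 1, n - 2) \<in> carrier_mat (v (n - 2)) (v (n - 1))" "x (n - 2, n - 1) \<in> carrier_mat (v (n - 1)) (v (n - 2))"
      "x (n, n - 2) \<in> carrier_mat (v (n - 2)) (v n)" "x (n - 2, n) \<in> carrier_mat (v n) (v (n - 2))"
      by (intro xE; use n in \<open>unfold ed Om; presburger\<close>)+
    have "(n - 3, n - 2) \<in> Omega n" "(n - 1, n - 2) \<notin> Omega n" "(n, n - 2) \<notin> Omega n"
      using n unfolding Om by presburger+
    then have "eps n (n - 3, n - 2) = 1" "eps n (n - 1, n - 2) = - 1" "eps n (n, n - 2) = - 1"
      by (simp_all add: eps_def)
    moreover have "n - 3 \<noteq> n - 1" "n - 3 \<noteq> n" "n - 1 \<noteq> n" "n - 2 \<noteq> Suc 0" "\<not> n - 2 \<le> n - 3" "n - 2 \<in> vertices n"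
      using n by (auto simp: vertices_def)
    ultimately have "(x (n - 3, n - 2) * x (n - 2, n - 3)) $$ (r, k) =
      (x (n - 1, n - 2) * x (n - 2, n - 1)) $$ (r, k) + (x (n, n - 2) * x (n - 2, n)) $$ (r, k)"
      if "r < v (n - 2)" "k < v (n - 2)" for r k
      using sum0[of "n - 2" r k] that by (simp add: incoming_edges[OF n] algebra_simps)
    then show ?thesis using c by (intro eq_matI) auto
  qed
  show "x (n - 2, i) * x (i, n - 2) = 0\<^sub>m (v i) (v i)" if i: "i \<in> {n - 1, n}" for i
  proof -
    have c: "x (n - 2, i) \<in> carrier_mat (v i) (v (n - 2))" "x (i, n - 2) \<in> carrier_mat (v (n - 2)) (v i)"
      by (intro xE; use n i in \<open>auto simp: ed Om\<close>)+
    have "eps n (n - 2, i) = 1" "i \<noteq> Suc 0" "\<not> i \<le> n - 3" "i \<noteq> n - 2" "i \<in> vertices n"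
      using n i by (auto simp: eps_def Om vertices_def)
    then have "(x (n - 2, i) * x (i, n - 2)) $$ (r, k) = 0" if "r < v i" "k < v i" for r k
      using sum0[of i r k] that by (simp add: incoming_edges[OF n])
    then show ?thesis using c by (intro eq_matI) auto
  qed
qed


section \<open>Row vectors attached to boxes\<close>

context spin_vertex
begin

text \<open>The composition of \<open>j\<close> with a path from the vertex of a box back to \<open>s\<close>, a row vector on the space
at the vertex of the box.  Among the paths through the diagram that lead from the box to the corner,
the chosen one runs along the row to its beginning and then up in zigzags along the diagonal.\<close>

primrec row_start :: "rep \<Rightarrow> vfam \<Rightarrow> nat \<Rightarrow> complex mat" where
  "row_start x j 0 = j s"
| "row_start x j (Suc r) = row_start x j r * x (n - 2, row_end r) * x (row_end (Suc r), n - 2)"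

primrec box_fun :: "rep \<Rightarrow> vfam \<Rightarrow> nat \<Rightarrow> nat \<Rightarrow> complex mat" where
  "box_fun x j r 0 = row_start x j r"
| "box_fun x j r (Suc d) = box_fun x j r d * x (label r (Suc d), label r d)"

lemma s_vertices: "s \<in> vertices n" using s n4 by (auto simp: vertices_def)

lemma E_carrier: "x \<in> E n v \<Longrightarrow> h \<in> edges n \<Longrightarrow> x h \<in> carrier_mat (v (target h)) (v (source h))"
  by (auto simp: E_def)

lemma arrow_carrier:
  assumes "x \<in> E n v" "d < n - 2"
  shows "x (label r (Suc d), label r d) \<in> carrier_mat (v (label r d)) (v (label r (Suc d)))"
    and "x (label r d, label r (Suc d)) \<in> carrier_mat (v (label r (Suc d))) (v (label r d))"
  using E_carrier[OF assms(1) edges_label(1)[OF assms(2)], of r]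
    E_carrier[OF assms(1) edges_label(2)[OF assms(2)], of r]
  by (simp_all del: label_simps)

lemma box_fun_in_carrier:
  assumes x: "x \<in> E n v" and j: "j \<in> Hom_VW n v (fund_weight n s)"
  shows "d \<le> n - 2 \<Longrightarrow> box_fun x j r d \<in> carrier_mat 1 (v (label r d))"
proof -
  have start: "row_start x j r \<in> carrier_mat 1 (v (row_end r))" for r
  proof (induction r)
    case 0
    have "j s \<in> carrier_mat (fund_weight n s s) (v s)"
      using j s_vertices unfolding Hom_VW_def by (rule PiE_mem)
    then show ?case using s_vertices by (simp add: row_end_def fund_weight_def)
  next
    case (Suc r)
    then show ?case using arrow_carrier[OF x, of 0 r] arrow_carrier[OF x, of 0 "Suc r"] n4 by (auto intro!: mult_carrier_mat)
  qed
  show "d \<le> n - 2 \<Longrightarrow> box_fun x j r d \<in> carrier_mat 1 (v (label r d))"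
  proof (induction d)
    case 0 then show ?case using start by simp
  next
    case (Suc d)
    then show ?case using arrow_carrier(1)[OF x, of d r] by (simp del: label_simps)
  qed
qed

end

locale framed_rep = spin_vertex n s for n s +
  fixes v :: "nat \<Rightarrow> nat" and x :: rep and j :: vfam
  assumes x: "x \<in> E n v" and j: "j \<in> Hom_VW n v (fund_weight n s)"
    and psi0: "\<And>i. i \<in> vertices n \<Longrightarrow> psi n v i x = 0\<^sub>m (v i) (v i)"
begin

lemmas relations = preprojective_relations[OF n4 x psi0]

text \<open>A step along the row that is undone at once gives zero, by the relation at a leaf.\<close>

lemma box_Suc_0_back: "box_fun x j r 1 * x (row_end r, n - 2) = 0\<^sub>m 1 (v (row_end r))"
proof -
  have "box_fun x j r 1 * x (row_end r, n - 2) = row_start x j r * (x (n - 2, row_end r) * x (row_end r, n - 2))"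
    using box_fun_in_carrier[OF x j, of 0 r] arrow_carrier[OF x, of 0 r] n4
    by (simp add: assoc_mult_mat[of _ 1 "v (row_end r)" _ "v (n - 2)" _ "v (row_end r)"])
  also have "x (n - 2, row_end r) * x (row_end r, n - 2) = 0\<^sub>m (v (row_end r)) (v (row_end r))"
    using relations(4)[of "row_end r"] row_end_cases[of r] by auto
  finally show ?thesis using box_fun_in_carrier[OF x j, of 0 r] by simp
qed

text \<open>The squares of the diagram commute, so a box below is reached from its upper neighbour as well.  The
relation at the vertex of a box exchanges the two ways around a square; next to the leaves the third
summand drops out by \<open>box_Suc_0_back\<close>.\<close>

lemma box_down: "d < n - 2 \<Longrightarrow> box_fun x j (Suc r) d = box_fun x j r (Suc d) * x (label (Suc r) d, label r (Suc d))"
proof (induction d)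
  case (Suc d)
  show ?case
  proof (cases d)
    case 0
    let ?m = "n - 2" and ?e = "row_end r" and ?f = "row_end (Suc r)" and ?b = "box_fun x j r 1"
    note c = box_fun_in_carrier[OF x j, of 1 r] arrow_carrier[OF x, of 0 r] arrow_carrier[OF x, of 0 "Suc r"]
      arrow_carrier[OF x, of "Suc 0" r]
    have c': "?b \<in> carrier_mat 1 (v ?m)" "x (?f, ?m) \<in> carrier_mat (v ?m) (v ?f)" "x (?m, ?f) \<in> carrier_mat (v ?f) (v ?m)"
      "x (?e, ?m) \<in> carrier_mat (v ?m) (v ?e)" "x (?m, ?e) \<in> carrier_mat (v ?e) (v ?m)"
      "x (n - 3, ?m) \<in> carrier_mat (v ?m) (v (n - 3))" "x (?m, n - 3) \<in> carrier_mat (v (n - 3)) (v ?m)"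
      using c n4 by simp_all
    have "box_fun x j (Suc r) (Suc 0) = ?b * x (?f, ?m) * x (?m, ?f)" by simp
    also have "\<dots> = ?b * (x (?f, ?m) * x (?m, ?f))" using c' by (intro assoc_mult_mat) auto
    also have "\<dots> = ?b * (x (?e, ?m) * x (?m, ?e)) + ?b * (x (?f, ?m) * x (?m, ?f))"
    proof -
      have "?b * (x (?e, ?m) * x (?m, ?e)) = ?b * x (?e, ?m) * x (?m, ?e)"
        using c' by (intro assoc_mult_mat[symmetric]) auto
      also have "\<dots> = 0\<^sub>m 1 (v ?m)" unfolding box_Suc_0_back using c' by simp
      finally show ?thesis using c' by simp
    qed
    also have "\<dots> = ?b * (x (?e, ?m) * x (?m, ?e) + x (?f, ?m) * x (?m, ?f))"
      using c' by (intro mult_add_distrib_mat[symmetric]) auto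
    also have "x (?e, ?m) * x (?m, ?e) + x (?f, ?m) * x (?m, ?f) = x (n - 3, ?m) * x (?m, n - 3)"
      using relations(3) row_end_cases[of r] c'
        comm_add_mat[of "x (?e, ?m) * x (?m, ?e)" "v ?m" "v ?m" "x (?f, ?m) * x (?m, ?f)"]
      by auto
    also have "?b * \<dots> = ?b * x (n - 3, ?m) * x (?m, n - 3)"
      using c' by (intro assoc_mult_mat[symmetric]) auto
    finally show ?thesis using 0 by simp
  next
    case (Suc e)
    let ?i = "n - 2 - d" and ?b = "box_fun x j r (Suc d)"
    have de: "d < n - 2" "Suc d < n - 2" "Suc (Suc e) < n - 2" using Suc.prems Suc by auto
    have i: "2 \<le> ?i" "?i \<le> n - 3" using de Suc by auto
    have label: "label r' (Suc d) = ?i" "label r' d = ?i + 1" "label r' (Suc (Suc d)) = ?i - 1" for r'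
      using i Suc by (auto simp: label_def)
    note c = box_fun_in_carrier[OF x j, of "Suc d" r] arrow_carrier[OF x de(1), of r] arrow_carrier[OF x de(2), of r]
    have c': "?b \<in> carrier_mat 1 (v ?i)" "x (?i + 1, ?i) \<in> carrier_mat (v ?i) (v (?i + 1))"
      "x (?i, ?i + 1) \<in> carrier_mat (v (?i + 1)) (v ?i)"
      "x (?i - 1, ?i) \<in> carrier_mat (v ?i) (v (?i - 1))" "x (?i, ?i - 1) \<in> carrier_mat (v (?i - 1)) (v ?i)"
      using c de(1) unfolding label by auto
    have "box_fun x j (Suc r) (Suc d) = ?b * x (?i + 1, ?i) * x (?i, ?i + 1)"
      unfolding box_fun.simps(2)[of x j "Suc r" d] Suc.IH[OF de(1)] label ..
    also have "\<dots> = ?b * (x (?i + 1, ?i) * x (?i, ?i + 1))" using c' by (intro assoc_mult_mat) auto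
    also have "\<dots> = ?b * (x (?i - 1, ?i) * x (?i, ?i - 1))" using relations(2)[OF _ i] by auto
    also have "\<dots> = ?b * x (?i - 1, ?i) * x (?i, ?i - 1)"
      using c' by (intro assoc_mult_mat[symmetric]) auto
    finally show ?thesis unfolding box_fun.simps(2)[of x j r "Suc d"] label .
  qed
qed simp

end


context framed_rep
begin

lemma box_fun_carrier: "d \<le> n - 2 \<Longrightarrow> box_fun x j r d \<in> carrier_mat 1 (v (label r d))"
  by (rule box_fun_in_carrier[OF x j])

lemma box_right_eq_0:
  assumes "box_fun x j r d = 0\<^sub>m 1 (v (label r d))" "d < n - 2"
  shows "box_fun x j r (Suc d) = 0\<^sub>m 1 (v (label r (Suc d)))"
  unfolding box_fun.simps(2) assms(1) using arrow_carrier(1)[OF x assms(2)] by (rule left_mult_zero_mat)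

lemma box_down_eq_0:
  assumes "box_fun x j r (Suc d) = 0\<^sub>m 1 (v (label r (Suc d)))" "d < n - 2"
  shows "box_fun x j (Suc r) d = 0\<^sub>m 1 (v (label (Suc r) d))"
proof -
  have "x (label (Suc r) d, label r (Suc d)) \<in> carrier_mat (v (label r (Suc d))) (v (label (Suc r) d))"
    using arrow_carrier(2)[OF x assms(2), of "Suc r"] by simp
  then show ?thesis unfolding box_down[OF assms(2)] assms(1) by (rule left_mult_zero_mat)
qed

text \<open>The vertex 1 is an end of the Dynkin graph, so the relation there has only one term.\<close>

lemma box_last_column_eq_0: "box_fun x j (Suc r) (n - 2) = 0\<^sub>m 1 (v (label (Suc r) (n - 2)))"
proof -
  define d where "d = n - 3"
  have d: "d < n - 2" "n - 2 = Suc d" using n4 by (auto simp: d_def)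
  have l: "label r' (Suc d) = 1" "label r' d = 2" for r' using n4 by (auto simp: d_def label_def)
  let ?b = "box_fun x j r (Suc d)"
  have c: "?b \<in> carrier_mat 1 (v 1)" "x (2, 1) \<in> carrier_mat (v 1) (v 2)" "x (1, 2) \<in> carrier_mat (v 2) (v 1)"
    using box_fun_carrier[of "Suc d" r] arrow_carrier[OF x d(1), of r] d unfolding l by auto
  have "box_fun x j (Suc r) (n - 2) = ?b * x (2, 1) * x (1, 2)"
    unfolding d(2) box_fun.simps(2)[of x j "Suc r" d] box_down[OF d(1)] l ..
  also have "\<dots> = ?b * (x (2, 1) * x (1, 2))" using c by (intro assoc_mult_mat) auto
  also have "x (2, 1) * x (1, 2) = 0\<^sub>m (v 1) (v 1)" by (rule relations(1))
  also have "?b * \<dots> = 0\<^sub>m 1 (v 1)" using c(1) by (rule right_mult_zero_mat)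
  finally show ?thesis unfolding d(2) l .
qed

text \<open>The vanishing in the last column propagates downwards, to all boxes outside the staircase.\<close>

lemma box_outside_eq_0: "d \<le> n - 2 \<Longrightarrow> r + d \<ge> n - 1 \<Longrightarrow> box_fun x j r d = 0\<^sub>m 1 (v (label r d))"
proof (induction r arbitrary: d)
  case 0 then show ?case using n4 by linarith
next
  case (Suc r)
  show ?case
  proof (cases "d = n - 2")
    case True then show ?thesis using box_last_column_eq_0 by simp
  next
    case False
    then have "d < n - 2" "box_fun x j r (Suc d) = 0\<^sub>m 1 (v (label r (Suc d)))"
      using Suc by (auto simp del: label_simps box_fun.simps)
    then show ?thesis using box_down_eq_0 by blast
  qed
qed

text \<open>The row vectors of the boxes at one vertex, from top to bottom.\<close>

definition fun_at :: "nat \<Rightarrow> nat \<Rightarrow> complex mat" where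
  "fun_at i k = box_fun x j (rowno i k) (depth i)"

lemma fun_at_carrier: "i \<in> vertices n \<Longrightarrow> fun_at i k \<in> carrier_mat 1 (v i)"
  using box_fun_carrier[OF depth_le, of i "rowno i k"] label_rowno[of i k] by (simp add: fun_at_def)

lemma label_eq_iff: "d \<le> n - 2 \<Longrightarrow> e \<le> n - 2 \<Longrightarrow> label r d = label q e \<longleftrightarrow> d = e \<and> (d > 0 \<or> even r = even q)"
  using n4 s by (auto simp: label_def row_end_def split: if_splits)

lemma label_rowno_label: "d \<le> n - 2 \<Longrightarrow> label (rowno (label r d) k) d = label r d"
  using label_rowno[OF label_vertices] depth_label by metis

text \<open>The span of all row vectors is stable under composition with the arrows: a box goes to its right or
lower neighbour when that neighbour lies at the source of the arrow, and to zero otherwise.  The only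
case of the second kind is an arrow that comes from the leaf at which the row begins.\<close>

lemma fun_at_arrow:
  assumes h: "h \<in> edges n"
  shows "rowno (source h) b = rowno (target h) a + row_step h \<Longrightarrow> fun_at (target h) a * x h = fun_at (source h) b"
    and "(\<And>b. rowno (source h) b \<noteq> rowno (target h) a + row_step h) \<Longrightarrow>
      fun_at (target h) a * x h = 0\<^sub>m 1 (v (source h))"
proof -
  show "fun_at (target h) a * x h = fun_at (source h) b"
    if b: "rowno (source h) b = rowno (target h) a + row_step h"
    using h
  proof (cases rule: edge_cases)
    case (right r d)
    let ?q = "rowno (label r d) a"
    have l: "label ?q d = label r d" "label ?q (Suc d) = label r (Suc d)" using right(1) label_rowno_label[of d r a] by auto
    have "fun_at (target h) a * x h = box_fun x j ?q (Suc d)"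
      using right l by (simp add: fun_at_def depth_label del: label_simps)
    also have "\<dots> = fun_at (source h) b"
      using right b by (simp add: fun_at_def depth_label del: label_simps box_fun.simps)
    finally show ?thesis .
  next
    case (down r d)
    let ?q = "rowno (label r (Suc d)) a"
    have "label (rowno (label r d) b) d = label r d" using label_rowno_label[of d r b] down(1) by simp
    then have l: "label (Suc ?q) d = label r d" "label ?q (Suc d) = label r (Suc d)"
      using b down by auto
    have "fun_at (target h) a * x h = box_fun x j (Suc ?q) d"
      using down l by (simp add: fun_at_def depth_label box_down del: label_simps box_fun.simps)
    also have "\<dots> = fun_at (source h) b"
      using down b by (simp add: fun_at_def depth_label del: label_simps box_fun.simps)
    finally show ?thesis .
  qed
  show "fun_at (target h) a * x h = 0\<^sub>m 1 (v (source h))"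
    if b: "\<And>b. rowno (source h) b \<noteq> rowno (target h) a + row_step h"
    using h
  proof (cases rule: edge_cases)
    case (right r d)
    obtain b where "rowno (label (rowno (label r d) a) (Suc d)) b = rowno (label r d) a"
      using ex_rowno[of "Suc d" "rowno (label r d) a"] right(1) by auto
    then show ?thesis using b[of b] right by simp
  next
    case (down r d)
    let ?q = "rowno (label r (Suc d)) a"
    obtain b where b': "rowno (label (Suc ?q) d) b = Suc ?q" using ex_rowno[of d "Suc ?q"] down(1) by auto
    then have "label (Suc ?q) d \<noteq> label r d" using b[of b] down by auto
    then have "d = 0" "even (Suc ?q) \<noteq> even r"
      using label_eq_iff[of d d "Suc ?q" r] down(1) by (auto simp del: label_simps)
    then have "row_end ?q = row_end r" by (simp add: row_end_def)
    then show ?thesis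
      using box_Suc_0_back[of ?q] down \<open>d = 0\<close> n4 by (simp add: fun_at_def depth_label[of 1 r, simplified] del: box_fun.simps)
  qed
qed

text \<open>The box diagonally below is reached by a closed walk.  At a leaf the next box is two rows below, and
the walk is \<open>i, n - 2, i', n - 2, i\<close> with \<open>i'\<close> the other leaf.  At \<open>n - 2\<close> the walk goes right and
down, because the vertex below depends on the row; elsewhere it goes down and right, because the
right neighbour is missing for \<open>i = 1\<close>.\<close>

lemma fun_at_step:
  assumes i: "i \<in> vertices n"
  shows "\<exists>y \<in> carrier_mat (v i) (v i). \<forall>k. fun_at i (Suc k) = fun_at i k * y"
proof -
  have gen: "\<exists>y \<in> carrier_mat (v i) (v i). \<forall>k. fun_at i (Suc k) = fun_at i k * y"
    if y: "y1 \<in> carrier_mat (v i) (v a)" "y2 \<in> carrier_mat (v a) (v i)"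
      "\<And>k. fun_at i (Suc k) = fun_at i k * y1 * y2" for y1 y2 a
    using y(1,2) assoc_mult_mat[OF fun_at_carrier[OF i] y(1,2)] by (intro bexI[of _ "y1 * y2"]) (auto simp: y(3))
  consider "depth i = 0" | "depth i = 1" | d where "depth i = Suc (Suc d)" by (metis One_nat_def not0_implies_Suc)
  then show ?thesis
  proof cases
    case 1
    let ?m = "n - 2"
    define i' where "i' = 2 * n - 1 - i"
    have ii: "i = s \<or> i = 2 * n - 1 - s" using 1 i s n4 by (auto simp: depth_def vertices_def split: if_splits)
    obtain p where p: "row_end p = i" "row_end (Suc p) = i'" "\<And>k. rowno i k = p + 2 * k" 
    proof (cases "i = s")
      case True then show ?thesis using s n4 by (intro that[of 0]) (auto simp: row_end_def i'_def rowno_def)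
    next
      case False then show ?thesis using s n4 ii by (intro that[of 1]) (auto simp: row_end_def i'_def rowno_def)
    qed
    have e: "row_end (p + 2 * k) = i" "row_end (Suc (p + 2 * k)) = i'" "row_end (Suc (Suc (p + 2 * k))) = i" for k
      using p by (auto simp: row_end_def)
    have c: "x (?m, i) \<in> carrier_mat (v i) (v ?m)" "x (i, ?m) \<in> carrier_mat (v ?m) (v i)"
      "x (?m, i') \<in> carrier_mat (v i') (v ?m)" "x (i', ?m) \<in> carrier_mat (v ?m) (v i')"
      using arrow_carrier[OF x, of 0 p] arrow_carrier[OF x, of 0 "Suc p"] p n4 by auto
    have "fun_at i (Suc k) = fun_at i k * (x (?m, i) * x (i', ?m)) * (x (?m, i') * x (i, ?m))" for k
    proof -
      have b: "fun_at i k \<in> carrier_mat 1 (v i)" by (rule fun_at_carrier[OF i])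
      have "fun_at i (Suc k) = fun_at i k * x (?m, i) * x (i', ?m) * x (?m, i') * x (i, ?m)"
        unfolding fun_at_def 1 using p(3)[of k] p(3)[of "Suc k"] e[of k] by simp
      also have "\<dots> = fun_at i k * x (?m, i) * x (i', ?m) * (x (?m, i') * x (i, ?m))"
        using b c by (intro assoc_mult_mat) auto
      also have "fun_at i k * x (?m, i) * x (i', ?m) = fun_at i k * (x (?m, i) * x (i', ?m))"
        using b c by (intro assoc_mult_mat) auto
      finally show ?thesis .
    qed
    then show ?thesis using c by (intro gen) auto
  next
    case 2
    then have i2: "i = n - 2" using i n4 by (auto simp: depth_def vertices_def split: if_splits)
    have d: "Suc 0 < n - 2" using n4 by simp
    have l: "label r (Suc 0) = i" "label r (Suc (Suc 0)) = n - 3" for r using i2 by (auto simp: label_def)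
    have "i < n - 1" using i2 n4 by linarith
    then have fun_at: "fun_at i k = box_fun x j k (Suc 0)" for k unfolding fun_at_def 2 rowno_def by simp
    show ?thesis
    proof (rule gen)
      show "x (n - 3, i) \<in> carrier_mat (v i) (v (n - 3))" "x (i, n - 3) \<in> carrier_mat (v (n - 3)) (v i)"
        using arrow_carrier[OF x d, of 0] unfolding l .
      show "fun_at i (Suc k) = fun_at i k * x (n - 3, i) * x (i, n - 3)" for k
        unfolding fun_at box_down[OF d] box_fun.simps(2)[of x j k "Suc 0"] l ..
    qed
  next
    case (3 d)
    have i3: "i = n - 3 - d" "i < n - 1" using 3 i n4 by (auto simp: depth_def vertices_def split: if_splits)
    have d: "Suc d < n - 2" using 3 depth_le[OF i] by simp
    have l: "label r (Suc d) = i + 1" "label r (Suc (Suc d)) = i" for r using i3 d by (auto simp: label_def)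
    show ?thesis
    proof (rule gen)
      show "x (i, i + 1) \<in> carrier_mat (v (i + 1)) (v i)" "x (i + 1, i) \<in> carrier_mat (v i) (v (i + 1))"
        using arrow_carrier[OF x d, of 0] unfolding l by auto
      show "fun_at i (Suc k) = fun_at i k * x (i + 1, i) * x (i, i + 1)" for k
        unfolding fun_at_def 3 using i3 box_down[OF d, of k] by (simp add: rowno_def l del: label_simps)
    qed
  qed
qed

end


section \<open>The normal form of a stable point\<close>

lemma sum_selector:
  fixes k m :: nat
  assumes "k < m" "\<And>a. a < m \<Longrightarrow> f a \<longleftrightarrow> a = k"
  shows "(\<Sum>a<m. (if f a then 1 else 0) * g a) = (g k :: complex)"
proof -
  have "(\<Sum>a<m. (if f a then 1 else 0) * g a) = (\<Sum>a<m. if a = k then g a else 0)"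
    using assms(2) by (intro sum.cong) auto
  then show ?thesis using assms(1) by simp
qed

lemma subspace_common_kernel:
  fixes A :: "'i \<Rightarrow> complex mat"
  assumes A: "\<And>k. A k \<in> carrier_mat 1 m"
  shows "VectorSpace.subspace class_ring {u \<in> carrier_vec m. \<forall>k. A k *\<^sub>v u = 0\<^sub>v 1} (module_vec TYPE(complex) m)"
proof -
  interpret vec_space "TYPE(complex)" m .
  have zero: "A k *\<^sub>v 0\<^sub>v m = 0\<^sub>v 1" for k
    using A[of k] by (intro eq_vecI) (auto simp: scalar_prod_def)
  show ?thesis
  proof (rule subspace.intro[OF vectorspace_axioms submodule.intro])
    show "module class_ring (module_vec TYPE(complex) m)" by (rule vec_module)
  qed (use A zero in \<open>auto simp: module_vec_simps class_field_def mult_add_distrib_mat_vec[OF A] mult_mat_vec[OF A]\<close>)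
qed

context spin_vertex
begin

text \<open>A box is sent to its left neighbour by the arrows of \<open>\<Omega>\<close> and to its upper neighbour by the opposite
arrows.  The basis of the space at \<open>i\<close> consists of the first \<open>v i\<close> boxes at \<open>i\<close>, so the diagram does
not occur in the definition.\<close>

definition std_rep :: "(nat \<Rightarrow> nat) \<Rightarrow> rep" where
  "std_rep v = (\<lambda>h\<in>edges n. mat (v (target h)) (v (source h))
     (\<lambda>(a, c). if rowno (target h) a + row_step h = rowno (source h) c then 1 else 0))"

definition std_fr :: "(nat \<Rightarrow> nat) \<Rightarrow> vfam" where
  "std_fr v = (\<lambda>i\<in>vertices n. mat (fund_weight n s i) (v i) (\<lambda>(a, c). if c = 0 then 1 else 0))"

text \<open>\<open>l\<close> lists the row lengths of a shifted Young diagram inside the staircase, continued by zeros, and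
\<open>v\<close> is its number of boxes at each vertex.  Truncated subtraction makes the second condition say that
the rows decrease strictly until they are empty.\<close>

definition shape :: "(nat \<Rightarrow> nat) \<Rightarrow> (nat \<Rightarrow> nat) \<Rightarrow> bool" where
  "shape l v \<longleftrightarrow> l 0 \<le> n - 1 \<and> (\<forall>r. l (Suc r) \<le> l r - 1) \<and>
     (\<forall>i\<in>vertices n. \<forall>k. k < v i \<longleftrightarrow> depth i < l (rowno i k))"

end

locale stable_rep = framed_rep n s v x j for n s v x j +
  assumes stable: "stable n v (fund_weight n s) (x, j)"
begin

text \<open>By \<open>fun_at_arrow\<close> the common kernels of the row vectors form a subrepresentation.  It is killed by
\<open>j\<close>, because \<open>j\<close> is the row vector of the corner.\<close>

lemma fun_at_separating:
  assumes i: "i \<in> vertices n" and u: "u \<in> carrier_vec (v i)" "\<And>k. fun_at i k *\<^sub>v u = 0\<^sub>v 1"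
  shows "u = 0\<^sub>v (v i)"
proof -
  define S where "S i = {u \<in> carrier_vec (v i). \<forall>k. fun_at i k *\<^sub>v u = 0\<^sub>v 1}" for i
  have "\<forall>i\<in>vertices n. VectorSpace.subspace class_ring (S i) (module_vec TYPE(complex) (v i))"
    unfolding S_def by (intro ballI subspace_common_kernel fun_at_carrier)
  moreover have "x h *\<^sub>v u \<in> S (target h)" if h: "h \<in> edges n" and u: "u \<in> S (source h)" for h u
  proof -
    note st = edges_endpoints[OF h n4]
    note xh = E_carrier[OF x h]
    have "fun_at (target h) a *\<^sub>v (x h *\<^sub>v u) = 0\<^sub>v 1" for a
    proof -
      have uc: "u \<in> carrier_vec (v (source h))" using u by (simp add: S_def)
      have "fun_at (target h) a *\<^sub>v (x h *\<^sub>v u) = (fun_at (target h) a * x h) *\<^sub>v u"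
        using fun_at_carrier[OF st(2)] xh uc by (rule assoc_mult_mat_vec[symmetric])
      also have "\<dots> = 0\<^sub>v 1"
      proof (cases "\<exists>b. rowno (source h) b = rowno (target h) a + row_step h")
        case True
        then show ?thesis using fun_at_arrow(1)[OF h] u by (auto simp: S_def)
      next
        case False
        then have "fun_at (target h) a * x h = 0\<^sub>m 1 (v (source h))" using fun_at_arrow(2)[OF h] by blast
        moreover have "0\<^sub>m 1 (v (source h)) *\<^sub>v u = 0\<^sub>v 1"
          using uc by (intro eq_vecI) (auto simp: scalar_prod_def)
        ultimately show ?thesis by simp
      qed
      finally show ?thesis .
    qed
    then show ?thesis using u xh by (simp add: S_def)
  qed
  moreover have "j i *\<^sub>v u = 0\<^sub>v (fund_weight n s i)" if i: "i \<in> vertices n" and u: "u \<in> S i" for i u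
  proof (cases "i = s")
    case True
    have "depth s = 0" "rowno s 0 = 0" using s n4 by (auto simp: depth_def rowno_def)
    then have "fun_at s 0 = j s" by (simp add: fun_at_def)
    moreover have "fun_at i 0 *\<^sub>v u = 0\<^sub>v 1" using u by (simp add: S_def)
    ultimately show ?thesis using True i by (simp add: fund_weight_def)
  next
    case False
    moreover have "j i \<in> carrier_mat (fund_weight n s i) (v i)"
      using j i unfolding Hom_VW_def by (rule PiE_mem)
    ultimately show ?thesis using i by (intro eq_vecI) (auto simp: fund_weight_def)
  qed
  ultimately have "\<forall>i\<in>vertices n. S i = {0\<^sub>v (v i)}"
    using stable unfolding stable_def by (auto dest: spec[of _ S])
  then show ?thesis using i u by (auto simp: S_def)
qed

lemma fun_at_basis:
  assumes i: "i \<in> vertices n"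
  shows "fun_at i k = 0\<^sub>m 1 (v i) \<longleftrightarrow> k \<ge> v i"
    and "mat (v i) (v i) (\<lambda>(a, c). fun_at i a $$ (0, c)) \<in> Units (GL_ring (v i))"
proof -
  obtain y where y: "y \<in> carrier_mat (v i) (v i)" "\<And>k. fun_at i (Suc k) = fun_at i k * y" using fun_at_step[OF i] by blast
  have "rowno i n \<ge> n" by (auto simp: rowno_def)
  then have "box_fun x j (rowno i n) (depth i) = 0\<^sub>m 1 (v (label (rowno i n) (depth i)))"
    using depth_le[OF i] by (intro box_outside_eq_0) auto
  then have "fun_at i n = 0\<^sub>m 1 (v i)" unfolding fun_at_def label_rowno[OF i] .
  note * = cyclic_nilpotent_functionals[OF fun_at_carrier[OF i] y this fun_at_separating[OF i]]
  show "fun_at i k = 0\<^sub>m 1 (v i) \<longleftrightarrow> k \<ge> v i" by (rule *(1))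
  show "mat (v i) (v i) (\<lambda>(a, c). fun_at i a $$ (0, c)) \<in> Units (GL_ring (v i))" by (rule *(2))
qed

definition coord :: vfam where
  "coord = (\<lambda>i\<in>vertices n. mat (v i) (v i) (\<lambda>(a, c). fun_at i a $$ (0, c)))"

lemma coord_G: "coord \<in> G n v"
  unfolding coord_def G_def using fun_at_basis(2) by auto

text \<open>This is \<open>fun_at_arrow\<close> in matrix form; row vectors with index from \<open>v\<close> on are missing in the product on
the right, and they vanish by \<open>fun_at_basis\<close>.\<close>

lemma coord_arrow:
  assumes h: "h \<in> edges n"
  shows "coord (target h) * x h = std_rep v h * coord (source h)"
proof (rule eq_matI)
  note st = edges_endpoints[OF h n4]
  note xh = E_carrier[OF x h]
  have cc: "coord (target h) \<in> carrier_mat (v (target h)) (v (target h))"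
    "coord (source h) \<in> carrier_mat (v (source h)) (v (source h))"
    "std_rep v h \<in> carrier_mat (v (target h)) (v (source h))"
    using st h by (auto simp: coord_def std_rep_def)
  fix a c assume "a < dim_row (std_rep v h * coord (source h))" "c < dim_col (std_rep v h * coord (source h))"
  then have ac: "a < v (target h)" "c < v (source h)" using cc by auto
  have "(coord (target h) * x h) $$ (a, c) = (\<Sum>e<v (target h). fun_at (target h) a $$ (0, e) * x h $$ (e, c))"
    unfolding mult_mat_entry[OF cc(1) xh ac] using ac st by (simp add: coord_def)
  also have "\<dots> = (fun_at (target h) a * x h) $$ (0, c)"
    by (rule mult_mat_entry[OF fun_at_carrier[OF st(2)] xh _ ac(2), symmetric]) simp
  finally have L: "(coord (target h) * x h) $$ (a, c) = (fun_at (target h) a * x h) $$ (0, c)" .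
  have R: "(std_rep v h * coord (source h)) $$ (a, c) =
    (\<Sum>b<v (source h). (if rowno (target h) a + row_step h = rowno (source h) b then 1 else 0) * fun_at (source h) b $$ (0, c))"
    unfolding mult_mat_entry[OF cc(3,2) ac] using ac st h by (simp add: coord_def std_rep_def)
  show "(coord (target h) * x h) $$ (a, c) = (std_rep v h * coord (source h)) $$ (a, c)"
  proof (cases "\<exists>b. rowno (source h) b = rowno (target h) a + row_step h")
    case True
    then obtain b where b: "rowno (source h) b = rowno (target h) a + row_step h" by blast
    then have eq: "rowno (target h) a + row_step h = rowno (source h) b' \<longleftrightarrow> b' = b" for b'
      using rowno_inj[of "source h" b b'] by auto
    show ?thesis
    proof (cases "b < v (source h)")
      case True
      then show ?thesis unfolding L R fun_at_arrow(1)[OF h b] eq by (subst sum_selector[of b]) auto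
    next
      case False
      then have "fun_at (source h) b = 0\<^sub>m 1 (v (source h))" using fun_at_basis(1)[OF st(1)] by simp
      moreover have "(\<Sum>b'<v (source h). (if b' = b then 1 else 0) * fun_at (source h) b' $$ (0, c)) = 0"
        using False by (intro sum.neutral) auto
      ultimately show ?thesis unfolding L R fun_at_arrow(1)[OF h b] eq using ac by simp
    qed
  next
    case False
    then have "fun_at (target h) a * x h = 0\<^sub>m 1 (v (source h))" using fun_at_arrow(2)[OF h] by blast
    moreover have "rowno (target h) a + row_step h \<noteq> rowno (source h) b" for b using False by metis
    ultimately show ?thesis unfolding L R using ac by simp
  qed
next
  note st = edges_endpoints[OF h n4]
  show "dim_row (coord (target h) * x h) = dim_row (std_rep v h * coord (source h))"
    "dim_col (coord (target h) * x h) = dim_col (std_rep v h * coord (source h))"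
    using E_carrier[OF x h] st h by (auto simp: coord_def std_rep_def)
qed

lemma coord_fr:
  assumes i: "i \<in> vertices n"
  shows "j i = std_fr v i * coord i"
proof -
  have ji: "j i \<in> carrier_mat (fund_weight n s i) (v i)" using j i unfolding Hom_VW_def by (rule PiE_mem)
  have c: "std_fr v i \<in> carrier_mat (fund_weight n s i) (v i)" "coord i \<in> carrier_mat (v i) (v i)"
    using i by (auto simp: std_fr_def coord_def)
  show ?thesis
  proof (rule eq_matI)
    fix a b assume "a < dim_row (std_fr v i * coord i)" "b < dim_col (std_fr v i * coord i)"
    then have ab: "a < fund_weight n s i" "b < v i" using c by auto
    then have i0: "i = s" "a = 0" using i by (auto simp: fund_weight_def split: if_splits)
    have "depth s = 0" "rowno s 0 = 0" using s n4 by (auto simp: depth_def rowno_def)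
    then have "fun_at s 0 = j s" by (simp add: fun_at_def)
    moreover have "(std_fr v i * coord i) $$ (a, b) = (\<Sum>e<v i. (if e = 0 then 1 else 0) * fun_at i e $$ (0, b))"
      unfolding mult_mat_entry[OF c ab] using ab i by (simp add: std_fr_def coord_def)
    moreover have "\<dots> = fun_at i 0 $$ (0, b)" using ab by (intro sum_selector) auto
    ultimately show "j i $$ (a, b) = (std_fr v i * coord i) $$ (a, b)" using i0 by simp
  qed (use ji c in auto)
qed

lemma act_coord: "act_fr n v coord (x, j) = (std_rep v, std_fr v)"
proof -
  have gi: "coord i \<in> Units (GL_ring (v i))" if "i \<in> vertices n" for i
    using coord_G that by (auto simp: G_def)
  have "act n v coord x = std_rep v"
  proof
    fix h
    show "act n v coord x h = std_rep v h"
    proof (cases "h \<in> edges n")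
      case True
      note st = edges_endpoints[OF True n4]
      have c: "std_rep v h \<in> carrier_mat (v (target h)) (v (source h))" using True by (simp add: std_rep_def)
      have "std_rep v h * coord (source h) * inv\<^bsub>GL_ring (v (source h))\<^esub> coord (source h) =
        std_rep v h * (coord (source h) * inv\<^bsub>GL_ring (v (source h))\<^esub> coord (source h))"
        using c GL_carrier[OF gi[OF st(1)]] GL_inv_carrier[OF gi[OF st(1)]] by (rule assoc_mult_mat)
      then show ?thesis
        using True c by (simp add: act_def coord_arrow GL_inv_right[OF gi[OF st(1)]])
    qed (simp add: act_def std_rep_def)
  qed
  moreover have "(\<lambda>i\<in>vertices n. j i * inv\<^bsub>GL_ring (v i)\<^esub> coord i) = std_fr v"
  proof
    fix i
    show "(\<lambda>i\<in>vertices n. j i * inv\<^bsub>GL_ring (v i)\<^esub> coord i) i = std_fr v i"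
    proof (cases "i \<in> vertices n")
      case True
      have c: "std_fr v i \<in> carrier_mat (fund_weight n s i) (v i)" using True by (simp add: std_fr_def)
      have "std_fr v i * coord i * inv\<^bsub>GL_ring (v i)\<^esub> coord i =
        std_fr v i * (coord i * inv\<^bsub>GL_ring (v i)\<^esub> coord i)"
        using c GL_carrier[OF gi[OF True]] GL_inv_carrier[OF gi[OF True]] by (rule assoc_mult_mat)
      then show ?thesis
        using True c coord_fr[OF True] by (simp add: GL_inv_right[OF gi[OF True]])
    qed (simp add: std_fr_def)
  qed
  ultimately show ?thesis by (simp add: act_fr_def)
qed

definition row_length :: "nat \<Rightarrow> nat" where
  "row_length r = (LEAST d. d \<ge> n - 1 \<or> box_fun x j r d = 0\<^sub>m 1 (v (label r d)))"

lemma less_row_length: "d < row_length r \<longleftrightarrow> d \<le> n - 2 \<and> box_fun x j r d \<noteq> 0\<^sub>m 1 (v (label r d))"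
proof -
  let ?P = "\<lambda>d. d \<ge> n - 1 \<or> box_fun x j r d = 0\<^sub>m 1 (v (label r d))"
  have "?P (n - 1)" by simp
  then have P: "?P (row_length r)" unfolding row_length_def by (rule LeastI)
  have up: "?P d \<Longrightarrow> ?P (Suc d)" for d
    using box_right_eq_0[of r d] n4 by (cases "d < n - 2") (auto simp del: box_fun.simps label_simps)
  have "?P (row_length r + k)" for k using P up by (induction k) (auto simp del: box_fun.simps label_simps)
  then have "?P d" if "row_length r \<le> d" for d using that le_Suc_ex by metis
  moreover have "\<not> ?P d" if "d < row_length r" for d using that not_less_Least unfolding row_length_def by blast
  ultimately have "d < row_length r \<longleftrightarrow> \<not> ?P d" by (meson not_le)
  moreover have "\<not> n - 1 \<le> d \<longleftrightarrow> d \<le> n - 2" using n4 by auto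
  ultimately show ?thesis by blast
qed

text \<open>Vanishing propagates to the right and from a right neighbour of a box to its lower neighbour, which
makes the nonvanishing boxes a shifted diagram.\<close>

lemma shape_row_length: "shape row_length v"
proof -
  have "row_length 0 \<le> n - 1" using less_row_length[of "n - 1" 0] n4 by (cases "row_length 0 \<le> n - 1") auto
  moreover have "row_length (Suc r) \<le> row_length r - 1" for r
  proof (rule ccontr)
    assume "\<not> row_length (Suc r) \<le> row_length r - 1"
    then have d: "row_length r - 1 < row_length (Suc r)" by simp
    show False
    proof (cases "row_length r - 1 < n - 2")
      case True
      have "\<not> Suc (row_length r - 1) < row_length r" by simp
      then have "box_fun x j r (Suc (row_length r - 1)) = 0\<^sub>m 1 (v (label r (Suc (row_length r - 1))))"
        using less_row_length[of "Suc (row_length r - 1)" r] True by simp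
      then show False using box_down_eq_0 True d less_row_length by blast
    next
      case False
      then have "row_length r - 1 = n - 2" using d less_row_length[of "row_length r - 1" "Suc r"] by simp
      then show False using d less_row_length[of "row_length r - 1" "Suc r"] box_last_column_eq_0[of r] by simp
    qed
  qed
  moreover have "k < v i \<longleftrightarrow> depth i < row_length (rowno i k)" if i: "i \<in> vertices n" for i k
    unfolding less_row_length label_rowno[OF i] using fun_at_basis(1)[OF i, of k] depth_le[OF i]
    by (auto simp: fun_at_def not_le)
  ultimately show ?thesis by (auto simp: shape_def)
qed

end

context spin_vertex
begin

theorem stable_normal_form:
  assumes p: "(x, j) \<in> Lambda_st n v (fund_weight n s)"
  shows "(\<exists>l. shape l v) \<and> (\<exists>g \<in> G n v. act_fr n v g (x, j) = (std_rep v, std_fr v))"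
proof -
  interpret stable_rep n s v x j
    by unfold_locales (use p in \<open>auto simp: Lambda_st_def Lambda_V_def\<close>)
  show ?thesis using shape_row_length coord_G act_coord by blast
qed

end


section \<open>The standard point of a shape\<close>

context spin_vertex
begin

text \<open>The number of steps from a box to the corner; every arrow lowers it by one.\<close>

definition height :: "nat \<Rightarrow> nat \<Rightarrow> nat" where
  "height i k = 2 * rowno i k + depth i"

lemma height_arrow:
  assumes h: "h \<in> edges n" and e: "rowno (target h) a + row_step h = rowno (source h) c"
  shows "height (target h) a + 1 = height (source h) c"
  using h
proof (cases rule: edge_cases)
  case (right r d)
  then have "depth (target h) = d" "depth (source h) = Suc d"
    using depth_label[of d r] depth_label[of "Suc d" r] by (auto simp del: label_simps)
  then show ?thesis using e right(4) by (simp add: height_def)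
next
  case (down r d)
  then have "depth (source h) = d" "depth (target h) = Suc d"
    using depth_label[of d r] depth_label[of "Suc d" r] by (auto simp del: label_simps)
  then show ?thesis using e down(4) by (simp add: height_def)
qed

lemma std_rep_E: "std_rep v \<in> E n v"
  by (auto simp: std_rep_def E_def)

lemma std_rep_entry:
  "h \<in> edges n \<Longrightarrow> a < v (target h) \<Longrightarrow> c < v (source h) \<Longrightarrow>
    std_rep v h $$ (a, c) = (if rowno (target h) a + row_step h = rowno (source h) c then 1 else 0)"
  by (simp add: std_rep_def)

lemma swap_edges: "h \<in> edges n \<Longrightarrow> prod.swap h \<in> edges n"
  by (force simp: edges_def)

lemma row_step_swap: "h \<in> edges n \<Longrightarrow> row_step h + row_step (prod.swap h) = 1"
  using Omega_swap_disjoint[OF n4] by (force simp: row_step_def edges_def)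

lemma ex_rowno_iff: "i \<in> vertices n \<Longrightarrow> (\<exists>b. rowno i b = q) \<longleftrightarrow> label q (depth i) = i"
  using label_rowno[of i] ex_rowno[OF depth_le, of i q] by metis

context
  fixes l v :: "nat \<Rightarrow> nat"
  assumes shape: "shape l v"
begin

lemma shape_mem: "i \<in> vertices n \<Longrightarrow> k < v i \<longleftrightarrow> depth i < l (rowno i k)"
  using shape by (auto simp: shape_def)

lemma shape_dec: "l (Suc r) \<le> l r - 1"
  using shape by (auto simp: shape_def)

lemma shape_bound: "l r \<le> n - 1 - r"
proof (induction r)
  case 0 then show ?case using shape by (simp add: shape_def)
next
  case (Suc r) then show ?case using shape_dec[of r] by simp
qed

lemma present_iff: "i \<in> vertices n \<Longrightarrow> (\<exists>b<v i. rowno i b = q) \<longleftrightarrow> label q (depth i) = i \<and> depth i < l q"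
  by (metis ex_rowno_iff shape_mem)

lemma std_rep_loop:
  assumes h: "h \<in> edges n" and ac: "a < v (target h)" "c < v (target h)"
  shows "(std_rep v h * std_rep v (prod.swap h)) $$ (a, c) =
    (if rowno (target h) a + 1 = rowno (target h) c \<and>
        (\<exists>b<v (source h). rowno (source h) b = rowno (target h) a + row_step h) then 1 else 0)"
proof -
  note c = E_carrier[OF std_rep_E[of v] h] E_carrier[OF std_rep_E[of v] swap_edges[OF h], simplified]
  have s: "std_rep v (prod.swap h) $$ (b, c) =
      (if rowno (source h) b + row_step (prod.swap h) = rowno (target h) c then 1 else 0)"
    if "b < v (source h)" for b
    using std_rep_entry[OF swap_edges[OF h], of b v c] that ac by simp
  have e: "(std_rep v h * std_rep v (prod.swap h)) $$ (a, c) = (\<Sum>b<v (source h).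
      (if rowno (source h) b = rowno (target h) a + row_step h then 1 else 0) *
      (if rowno (source h) b + row_step (prod.swap h) = rowno (target h) c then 1 else 0))"
    unfolding mult_mat_entry[OF c ac]
    by (intro sum.cong refl) (use ac h s in \<open>auto simp: std_rep_entry\<close>)
  show ?thesis
  proof (cases "\<exists>b<v (source h). rowno (source h) b = rowno (target h) a + row_step h")
    case True
    then obtain b where b: "b < v (source h)" "rowno (source h) b = rowno (target h) a + row_step h" by blast
    then have "rowno (source h) b' = rowno (target h) a + row_step h \<longleftrightarrow> b' = b" for b'
      using rowno_inj[of "source h" b' b] by auto
    then have "(std_rep v h * std_rep v (prod.swap h)) $$ (a, c) = (\<Sum>b'<v (source h). if b' = b then
      (if rowno (source h) b + row_step (prod.swap h) = rowno (target h) c then 1 else 0) else 0)"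
      unfolding e by (intro sum.cong) auto
    also have "\<dots> = (if rowno (source h) b + row_step (prod.swap h) = rowno (target h) c then 1 else 0)"
      using b(1) by simp
    also have "rowno (source h) b + row_step (prod.swap h) = rowno (target h) a + 1"
      using b(2) row_step_swap[OF h] by simp
    finally show ?thesis using True by auto
  next
    case False
    then have "(std_rep v h * std_rep v (prod.swap h)) $$ (a, c) = 0"
      unfolding e by (intro sum.neutral) auto
    then show ?thesis using False by auto
  qed
qed

text \<open>Each summand of \<open>psi\<close> sends a box to the box diagonally above it, along one of the two sides of a
square.  If the lower box belongs to the diagram, so do all four boxes of the square, and the two ways
cancel.  At the vertex 1 and at the leaves there is no such square.\<close>

lemma psi_std_rep:
  assumes i: "i \<in> vertices n"
  shows "psi n v i (std_rep v) = 0\<^sub>m (v i) (v i)"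
proof (rule eq_matI)
  fix a c assume "a < dim_row (0\<^sub>m (v i) (v i) :: complex mat)" "c < dim_col (0\<^sub>m (v i) (v i) :: complex mat)"
  then have ac: "a < v i" "c < v i" by auto
  define q where "q = rowno i a"
  have "(\<Sum>h | h \<in> edges n \<and> target h = i. eps n h * (std_rep v h * std_rep v (prod.swap h)) $$ (a, c))
    = (\<Sum>h | h \<in> edges n \<and> target h = i. eps n h * (if q + 1 = rowno i c \<and>
        label (q + row_step h) (depth (source h)) = source h \<and> depth (source h) < l (q + row_step h) then 1 else 0))"
    using ac edges_endpoints(1)[OF _ n4] by (intro sum.cong refl) (auto simp: std_rep_loop q_def present_iff)
  also have "\<dots> = 0"
  proof (cases "q + 1 = rowno i c")
    case False then show ?thesis by simp
  next
    case True
    have l1: "depth i < l (Suc q)" using shape_mem[OF i, of c] ac True by simp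
    then have l0: "Suc (depth i) < l q" using shape_dec[of q] by linarith
    have Om: "(a, b) \<in> Omega n \<longleftrightarrow> (1 \<le> a \<and> a \<le> n - 2 \<and> b = a + 1) \<or> (a = n - 2 \<and> b = n)" for a b
      by (auto simp: Omega_def)
    have "1 \<le> i" "i \<le> n" using i by (auto simp: vertices_def)
    then consider "i = 1" | "2 \<le> i" "i \<le> n - 3" | "i = n - 2" | "i = n - 1 \<or> i = n"
      by linarith
    then show ?thesis
    proof cases
      case 1
      then have "depth i = n - 2" using n4 by (simp add: depth_def numeral_2_eq_2)
      then show ?thesis using l0 shape_bound[of q] by simp
    next
      case 2
      then have d: "depth i = n - 1 - i" "depth (i - 1) = Suc (depth i)" "depth (i + 1) = depth i - 1" "0 < depth i" "1 < depth i"
        using n4 by (auto simp: depth_def)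
      have "label q' (depth (i - 1)) = i - 1" "label q' (depth (i + 1)) = i + 1" for q'
        using d 2 by (auto simp: label_def)
      moreover have "(i - 1, i) \<in> Omega n" "(i + 1, i) \<notin> Omega n" using 2 n4 unfolding Om by presburger+
      moreover have "depth (i + 1) < l (Suc q)" "depth (i - 1) < l q" using l1 l0 d by auto
      moreover have "{h \<in> edges n. target h = i} = {(i - 1, i), (i + 1, i)}"
        unfolding incoming_edges[OF n4 i] using 2 by auto
      ultimately show ?thesis using True 2 by (simp add: eps_def row_step_def)
    next
      case 3
      have d: "depth i = 1" "depth (n - 3) = 2" "depth (n - 1) = 0" "depth n = 0" using 3 n4 by (auto simp: depth_def)
      have "label q' 2 = n - 3" for q' using n4 by (simp add: label_def)
      moreover have "(n - 3, n - 2) \<in> Omega n" "(n - 1, n - 2) \<notin> Omega n" "(n, n - 2) \<notin> Omega n"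
        using n4 unfolding Om by presburger+
      moreover have "0 < l (Suc q)" "2 < l q" using l1 l0 d by auto
      moreover have "{h \<in> edges n. target h = i} = {(n - 3, i), (n - 1, i), (n, i)}"
        unfolding incoming_edges[OF n4 i] using 3 n4 by auto
      moreover have "n - 3 \<noteq> n - 1" "n - 3 \<noteq> n" "n - 1 \<noteq> n" using n4 by auto
      ultimately show ?thesis using True 3 d row_end_cases[of q] by (auto simp: eps_def row_step_def)
    next
      case 4
      then have "\<not> i < n - 1" using n4 by auto
      then have "2 * a + 1 = 2 * c" using True by (auto simp: rowno_def q_def split: if_splits)
      then have False by presburger
      then show ?thesis ..
    qed
  qed
  finally show "psi n v i (std_rep v) $$ (a, c) = 0\<^sub>m (v i) (v i) $$ (a, c)"
    using ac by (simp add: psi_def)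
qed (auto simp: psi_def)

lemma path_map_std_rep:
  assumes "composable n p" "p \<noteq> []"
  shows "path_map v (std_rep v) p \<in> carrier_mat (v (target (hd p))) (v (source (last p))) \<and>
    (\<forall>a < v (target (hd p)). \<forall>c < v (source (last p)). path_map v (std_rep v) p $$ (a, c) \<noteq> 0 \<longrightarrow>
       height (target (hd p)) a + length p = height (source (last p)) c)"
  using assms
proof (induction p)
  case (Cons h p)
  have h: "h \<in> edges n" using Cons.prems by (simp add: composable_def)
  note ch = E_carrier[OF std_rep_E h, of v]
  show ?case
  proof (cases "p = []")
    case True
    have pm: "path_map v (std_rep v) [h] = std_rep v h"
      using ch by (simp add: path_map_def)
    show ?thesis using ch height_arrow[OF h] by (auto simp: True pm std_rep_entry[OF h] split: if_splits)
  next
    case False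
    have comp: "composable n p" "source h = target (hd p)"
      using Cons.prems False by (auto simp: composable_def hd_conv_nth nth_Cons' dest: spec[of _ 0] )
    note IH = Cons.IH[OF comp(1) False]
    have pm: "path_map v (std_rep v) (h # p) = std_rep v h * path_map v (std_rep v) p"
      using False by (simp add: path_map_def)
    have c2: "path_map v (std_rep v) p \<in> carrier_mat (v (source h)) (v (source (last p)))"
      using IH comp by simp
    have "height (target h) a + Suc (length p) = height (source (last p)) c"
      if ac: "a < v (target h)" "c < v (source (last p))"
        and nz: "(std_rep v h * path_map v (std_rep v) p) $$ (a, c) \<noteq> 0" for a c
    proof -
      have "(\<Sum>b<v (source h). std_rep v h $$ (a, b) * path_map v (std_rep v) p $$ (b, c)) \<noteq> 0"
        using nz mult_mat_entry[OF ch c2 ac] by simp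
      then obtain b where "b \<in> {..<v (source h)}" "std_rep v h $$ (a, b) * path_map v (std_rep v) p $$ (b, c) \<noteq> 0"
        by (rule sum.not_neutral_contains_not_neutral)
      then have b: "b < v (source h)" "std_rep v h $$ (a, b) \<noteq> 0" "path_map v (std_rep v) p $$ (b, c) \<noteq> 0" by auto
      then have "height (target h) a + 1 = height (source h) b"
        using height_arrow[OF h, of a b] ac by (auto simp: std_rep_entry[OF h] split: if_splits)
      moreover have "height (source h) b + length p = height (source (last p)) c"
        using IH b ac comp(2) by auto
      ultimately show ?thesis by simp
    qed
    then show ?thesis using ch c2 False by (auto simp: pm)
  qed
qed simp

lemma nilpotent_std_rep: "nilpotent_rep n v (std_rep v)"
  unfolding nilpotent_rep_def
proof (intro exI[of _ "2 * n"] conjI allI impI)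
  show "1 \<le> 2 * n" using n4 by simp
  \<comment> \<open>Every arrow lowers the height by one, and boxes of the diagram have height below \<open>2 * n\<close>.\<close>
  fix p assume p: "length p = 2 * n \<and> composable n p"
  then have ne: "p \<noteq> []" using n4 by auto
  note P = path_map_std_rep[OF _ ne]
  have i: "source (last p) \<in> vertices n"
    using p last_in_set[OF ne] edges_endpoints(1)[OF _ n4, of "last p"] by (auto simp: composable_def)
  have "height (source (last p)) c < 2 * n" if "c < v (source (last p))" for c
  proof -
    have "depth (source (last p)) < l (rowno (source (last p)) c)" using shape_mem[OF i] that by simp
    then show ?thesis using shape_bound[of "rowno (source (last p)) c"] by (simp add: height_def)
  qed
  then show "path_map v (std_rep v) p = 0\<^sub>m (v (target (hd p))) (v (source (last p)))"
    using P p by (intro eq_matI) fastforce+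
qed

text \<open>By induction on the height, each coordinate of a vector in the subrepresentation vanishes: it is a
coordinate of the image of the vector under an arrow, or, at the corner, its image under the framing.\<close>

lemma stable_std: "stable n v (fund_weight n s) (std_rep v, std_fr v)"
  unfolding stable_def prod.case
proof (intro allI impI ballI)
  fix S i
  assume S: "(\<forall>i\<in>vertices n. VectorSpace.subspace class_ring (S i) (module_vec TYPE(complex) (v i))) \<and>
     (\<forall>h\<in>edges n. \<forall>u\<in>S (source h). std_rep v h *\<^sub>v u \<in> S (target h)) \<and>
     (\<forall>i\<in>vertices n. \<forall>u\<in>S i. std_fr v i *\<^sub>v u = 0\<^sub>v (fund_weight n s i))"
    and i: "i \<in> vertices n"
  have sub: "S i \<subseteq> carrier_vec (v i)" "0\<^sub>v (v i) \<in> S i" if "i \<in> vertices n" for i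
  proof -
    have "submodule class_ring (S i) (module_vec TYPE(complex) (v i))"
      using S that by (auto simp: subspace_def)
    then show "S i \<subseteq> carrier_vec (v i)" "0\<^sub>v (v i) \<in> S i"
      using submodule.subset submodule.zero_closed by (fastforce simp: module_vec_simps)+
  qed
  have step: "u $ k = (std_rep v h *\<^sub>v u) $ k'"
    if h: "h \<in> edges n" and u: "u \<in> carrier_vec (v (source h))" and k: "k < v (source h)" "k' < v (target h)"
      and r: "rowno (target h) k' + row_step h = rowno (source h) k" for h u k k'
  proof -
    have "(std_rep v h *\<^sub>v u) $ k' = (\<Sum>c<v (source h). std_rep v h $$ (k', c) * u $ c)"
      using E_carrier[OF std_rep_E h, of v] u k by (simp add: scalar_prod_def lessThan_atLeast0)
    also have "\<dots> = (\<Sum>c<v (source h). if c = k then u $ k else 0)"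
      using k r h by (intro sum.cong) (auto simp: std_rep_entry rowno_inj)
    also have "\<dots> = u $ k" using k by simp
    finally show ?thesis by simp
  qed
  have "u $ k = 0" if "i \<in> vertices n" "u \<in> S i" "k < v i" for i u k
    using that
  proof (induction "height i k" arbitrary: i u k rule: less_induct)
    case less
    note uc = subsetD[OF sub(1)[OF less.prems(1)] less.prems(2)]
    have via: "u $ k = 0"
      if h: "h \<in> edges n" "source h = i" and k': "k' < v (target h)" "rowno (target h) k' + row_step h = rowno i k" for h k'
    proof -
      have "std_rep v h *\<^sub>v u \<in> S (target h)" using S h less.prems(2) by auto
      moreover have "height (target h) k' < height i k"
        using height_arrow[OF h(1), of k' k] k' h by simp
      ultimately have "(std_rep v h *\<^sub>v u) $ k' = 0"
        using less.hyps[of "target h" k'] edges_endpoints(2)[OF h(1) n4] k' by blast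
      then show ?thesis using step[OF h(1), of u k k'] uc less.prems h k' by simp
    qed
    define q where "q = rowno i k"
    have pres: "depth i < l q" "label q (depth i) = i"
      using less.prems shape_mem[of i k] label_rowno[of i k] by (auto simp: q_def)
    have dle: "depth i \<le> n - 2" using depth_le less.prems by blast
    show ?case
    proof (cases "depth i")
      case (Suc d)
      have d: "d < n - 2" using dle Suc by simp
      obtain k' where k': "rowno (label q d) k' = q" using ex_rowno[of d q] d by auto
      show ?thesis
      proof (rule via[where h = "(label q (Suc d), label q d)" and k' = k'])
        show "(label q (Suc d), label q d) \<in> edges n" by (rule edges_label(1)[OF d])
        show "source (label q (Suc d), label q d) = i" using pres Suc by simp
        show "k' < v (target (label q (Suc d), label q d))"
          using shape_mem[of "label q d" k'] label_vertices[of d q] k' depth_label[of d q] d pres Suc by simp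
        show "rowno (target (label q (Suc d), label q d)) k' + row_step (label q (Suc d), label q d) = rowno i k"
          using k' Omega_label[OF d, of q] by (simp add: row_step_def q_def del: label_simps)
      qed
    next
      case 0
      show ?thesis
      proof (cases q)
        case 0
        then have i0: "i = s" "k = 0" using pres \<open>depth i = 0\<close> less.prems(1) by (auto simp: row_end_def q_def rowno_def split: if_splits)
        have "(std_fr v i *\<^sub>v u) $ 0 = 0" using S less.prems by (auto simp: fund_weight_def i0)
        moreover have "(std_fr v i *\<^sub>v u) $ 0 = (\<Sum>c<v i. (if c = 0 then 1 else 0) * u $ c)"
          using less.prems uc i0
          by (simp add: std_fr_def fund_weight_def scalar_prod_def lessThan_atLeast0)
        moreover have "\<dots> = (\<Sum>c<v i. if c = 0 then u $ 0 else 0)" by (intro sum.cong) auto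
        ultimately show ?thesis using less.prems(3) i0 by simp
      next
        case (Suc r)
        have e: "label (Suc r) 0 = i" using pres 0 Suc by simp
        have d: "0 < n - 2" using n4 by simp
        have l: "label (Suc r) 1 = n - 2" "depth (n - 2) = 1" "rowno (n - 2) r = r" "n - 2 \<in> vertices n"
          using n4 by (auto simp: depth_def rowno_def vertices_def)
        have notin: "(label (Suc r) 0, label (Suc r) 1) \<notin> Omega n"
          using Omega_label[OF d, of "Suc r"] Omega_swap_disjoint[OF n4] by force
        show ?thesis
        proof (rule via[where h = "(label (Suc r) 0, label (Suc r) 1)" and k' = r])
          show "(label (Suc r) 0, label (Suc r) 1) \<in> edges n" using edges_label(2)[OF d, of "Suc r"] by simp
          show "source (label (Suc r) 0, label (Suc r) 1) = i" using e by simp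
          have "1 < l r" using pres 0 Suc shape_dec[of r] by simp
          then show "r < v (target (label (Suc r) 0, label (Suc r) 1))"
            using shape_mem[OF l(4), of r] l by simp
          show "rowno (target (label (Suc r) 0, label (Suc r) 1)) r + row_step (label (Suc r) 0, label (Suc r) 1) = rowno i k"
            using notin l Suc by (simp add: row_step_def q_def del: label_simps)
        qed
      qed
    qed
  qed
  then have "u = 0\<^sub>v (v i)" if "u \<in> S i" for u
    using that sub[OF i] i by (intro eq_vecI) auto
  then show "S i = {0\<^sub>v (v i)}" using sub[OF i] by blast
qed

lemma std_Lambda_st: "(std_rep v, std_fr v) \<in> Lambda_st n v (fund_weight n s)"
proof -
  have "std_fr v \<in> Hom_VW n v (fund_weight n s)" by (auto simp: std_fr_def Hom_VW_def)
  then show ?thesis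
    using std_rep_E nilpotent_std_rep psi_std_rep stable_std by (simp add: Lambda_st_def Lambda_V_def)
qed

end

end


section \<open>Young diagrams and direct sums of strings\<close>

lemma down_closed_nat_set:
  fixes A :: "nat set"
  assumes "finite A" and "\<And>k l. k \<in> A \<Longrightarrow> l \<le> k \<Longrightarrow> l \<in> A"
  shows "k \<in> A \<longleftrightarrow> k < card A"
proof -
  obtain m where m: "m \<notin> A" using ex_new_if_finite[OF _ assms(1)] infinite_UNIV_nat by blast
  define b where "b = (LEAST m. m \<notin> A)"
  have b: "b \<notin> A" unfolding b_def using m by (rule LeastI)
  have "k \<in> A" if "k < b" for k using that not_less_Least unfolding b_def by blast
  moreover have "k < b" if "k \<in> A" for k using that b assms(2) by (meson not_le)
  ultimately have "A = {..<b}" by auto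
  then show ?thesis by simp
qed

text \<open>A block of size at most 1 has its entry, if any, at the position given by the numbers of nonempty
rows and columns of the preceding blocks.\<close>

lemma diag_block_mat_entry:
  fixes Bs :: "'a :: semiring_1 mat list"
  assumes "\<And>B. B \<in> set Bs \<Longrightarrow> dim_row B \<le> 1 \<and> dim_col B \<le> 1"
    and "i < dim_row (diag_block_mat Bs)" "j < dim_col (diag_block_mat Bs)"
  shows "diag_block_mat Bs $$ (i, j) = (\<Sum>k<length Bs.
    if dim_row (Bs ! k) = 1 \<and> dim_col (Bs ! k) = 1 \<and>
       i = (\<Sum>e<k. dim_row (Bs ! e)) \<and> j = (\<Sum>e<k. dim_col (Bs ! e))
    then (Bs ! k) $$ (0, 0) else 0)"
  using assms
proof (induction Bs arbitrary: i j)
  case (Cons B Bs)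
  let ?D = "diag_block_mat Bs"
  have B: "dim_row B = 0 \<or> dim_row B = 1" "dim_col B = 0 \<or> dim_col B = 1" using Cons.prems(1) by force+
  have ij: "i < dim_row B + dim_row ?D" "j < dim_col B + dim_col ?D"
    using Cons.prems(2,3) by (simp_all add: Let_def)
  have tail: "(\<Sum>k<length Bs. if dim_row (Bs ! k) = 1 \<and> dim_col (Bs ! k) = 1 \<and>
       i = dim_row B + (\<Sum>e<k. dim_row (Bs ! e)) \<and> j = dim_col B + (\<Sum>e<k. dim_col (Bs ! e))
      then (Bs ! k) $$ (0, 0) else 0) =
    (if i < dim_row B \<or> j < dim_col B then 0 else ?D $$ (i - dim_row B, j - dim_col B))"
  proof (cases "i < dim_row B \<or> j < dim_col B")
    case True then show ?thesis by (auto intro!: sum.neutral)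
  next
    case False
    then have "?D $$ (i - dim_row B, j - dim_col B) = (\<Sum>k<length Bs. if dim_row (Bs ! k) = 1 \<and> dim_col (Bs ! k) = 1 \<and>
       i - dim_row B = (\<Sum>e<k. dim_row (Bs ! e)) \<and> j - dim_col B = (\<Sum>e<k. dim_col (Bs ! e))
      then (Bs ! k) $$ (0, 0) else 0)"
      using Cons.prems(1) ij by (intro Cons.IH) auto
    also have "\<dots> = (\<Sum>k<length Bs. if dim_row (Bs ! k) = 1 \<and> dim_col (Bs ! k) = 1 \<and>
       i = dim_row B + (\<Sum>e<k. dim_row (Bs ! e)) \<and> j = dim_col B + (\<Sum>e<k. dim_col (Bs ! e))
      then (Bs ! k) $$ (0, 0) else 0)"
      using False by (intro sum.cong refl if_cong) auto
    finally show ?thesis using False by simp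
  qed
  have "diag_block_mat (B # Bs) $$ (i, j) = (if i < dim_row B then if j < dim_col B then B $$ (i, j) else 0
      else if j < dim_col B then 0 else ?D $$ (i - dim_row B, j - dim_col B))"
    using ij by (auto simp: Let_def)
  also have "\<dots> = (if dim_row B = 1 \<and> dim_col B = 1 \<and> i = 0 \<and> j = 0 then B $$ (0, 0) else 0) +
      (if i < dim_row B \<or> j < dim_col B then 0 else ?D $$ (i - dim_row B, j - dim_col B))"
    using B by auto
  finally show ?case unfolding tail[symmetric] by (simp add: sum.lessThan_Suc_shift del: sum.lessThan_Suc diag_block_mat.simps cong: if_cong)
qed simp

context spin_vertex
begin

text \<open>The pairs \<open>A\<^sup>\<plusminus>\<close> in terms of the leaf at which the string ends.\<close>

definition row_string :: "nat \<Rightarrow> nat \<Rightarrow> nat \<times> nat" where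
  "row_string t l = (if t = n then (if l > 1 then (n - l, n) else (n, n)) else (n - l, n - 1))"

definition row_strings :: "nat list \<Rightarrow> (nat \<times> nat) list" where
  "row_strings Y = map (\<lambda>k. row_string (row_end k) (Y ! k)) [0..<length Y]"

definition part :: "nat list \<Rightarrow> nat \<Rightarrow> nat" where
  "part Y r = (if r < length Y then Y ! r else 0)"

lemma string_dim_row_string:
  assumes l: "1 \<le> l" "l \<le> n - 1" and i: "i \<in> vertices n"
  shows "string_dim n (row_string (row_end k) l) i = (if label k (depth i) = i \<and> depth i < l then 1 else 0)"
proof -
  have "i \<in> string_support n (row_string (row_end k) l) \<longleftrightarrow> label k (depth i) = i \<and> depth i < l"
  proof (cases "i < n - 1")
    case True
    then have "depth i = n - 1 - i" "label k (depth i) = i" using n4 by (auto simp: depth_def label_def)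
    then show ?thesis using True l n4 i row_end_cases[of k]
      by (auto simp: row_string_def string_support_def vertices_def)
  next
    case False
    then have "depth i = 0" "i = n - 1 \<or> i = n" using i by (auto simp: depth_def vertices_def)
    then show ?thesis using l n4 row_end_cases[of k]
      by (auto simp: row_string_def string_support_def)
  qed
  then show ?thesis by (simp add: string_dim_def)
qed

lemma string_arrow_row_string:
  assumes l: "1 \<le> l" "l \<le> n - 1" and h: "h \<in> Omega n"
    and "string_dim n (row_string (row_end k) l) (source h) = 1" "string_dim n (row_string (row_end k) l) (target h) = 1"
  shows "h \<in> string_arrows n (row_string (row_end k) l)"
proof -
  have supp: "source h \<in> string_support n (row_string (row_end k) l)" "target h \<in> string_support n (row_string (row_end k) l)"
    using assms(4,5) unfolding string_dim_def by (metis zero_neq_one)+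
  obtain m where m: "n = Suc (Suc (Suc (Suc m)))" using n4 that[of "n - 4"] by auto
  have h': "h = (source h, source h + 1) \<and> 1 \<le> source h \<and> source h \<le> Suc (Suc m) \<or> h = (Suc (Suc m), n)"
    using h m unfolding Omega_def by auto
  consider (a) "row_string (row_end k) l = (n, n)" | (b) "row_string (row_end k) l = (n - l, n)" "l > 1"
    | (c) "row_string (row_end k) l = (n - l, Suc (Suc (Suc m)))"
  proof (cases "row_end k = n")
    case True then show ?thesis using a b by (cases "l > 1") (simp_all add: row_string_def)
  next
    case False
    then have "row_string (row_end k) l = (n - l, n - 1)" by (simp add: row_string_def)
    then show ?thesis using c m by simp
  qed
  then show ?thesis
  proof cases
    case a
    then show ?thesis using supp h' unfolding a string_support_def string_arrows_def m
      by (cases h) auto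
  next
    case b
    then show ?thesis using supp(1,2) h' unfolding b(1) string_support_def string_arrows_def m
      by (cases h) auto
  next
    case c
    then show ?thesis using supp(1,2) h' unfolding c(1) string_support_def string_arrows_def m
      by (cases h) auto
  qed
qed

context
  fixes Y assumes Y: "Y \<in> Young n"
begin

lemma Young_nth: "k < length Y \<Longrightarrow> 1 \<le> Y ! k \<and> Y ! k \<le> n - 1"
  using Y by (force simp: Young_def set_conv_nth)

lemma Young_less: "i < k \<Longrightarrow> k < length Y \<Longrightarrow> Y ! k < Y ! i"
  using Y sorted_wrt_nth_less[of "(>)" Y i k] by (simp add: Young_def)

lemma part_antimono: "r \<le> q \<Longrightarrow> part Y q \<le> part Y r"
  using Young_less[of r q] by (cases "r = q") (auto simp: part_def)

lemma part_dec: "part Y (Suc r) \<le> part Y r - 1"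
  using Young_less[of r "Suc r"] by (auto simp: part_def)

lemma part_le: "part Y r \<le> n - 1"
  using Young_nth[of r] by (auto simp: part_def)

lemma string_dim_row_strings:
  assumes i: "i \<in> vertices n" and k: "k < length Y"
  shows "string_dim n (row_strings Y ! k) i = (if label k (depth i) = i \<and> depth i < part Y k then 1 else 0)"
  using string_dim_row_string[OF _ _ i, of "Y ! k" k] Young_nth[OF k] k by (simp add: row_strings_def part_def)

lemma count_rows:
  assumes i: "i \<in> vertices n" and m: "m \<le> length Y"
  shows "(\<Sum>k<m. string_dim n (row_strings Y ! k) i) = card {b. rowno i b < m \<and> depth i < part Y (rowno i b)}"
proof -
  have "(\<Sum>k<m. string_dim n (row_strings Y ! k) i) = (\<Sum>k<m. if label k (depth i) = i \<and> depth i < part Y k then 1 else 0)"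
    using m by (intro sum.cong) (auto simp: string_dim_row_strings[OF i])
  also have "\<dots> = card {k. k < m \<and> label k (depth i) = i \<and> depth i < part Y k}"
    by (simp add: sum.If_cases Int_def)
  also have "{k. k < m \<and> label k (depth i) = i \<and> depth i < part Y k} =
      rowno i ` {b. rowno i b < m \<and> depth i < part Y (rowno i b)}"
    using ex_rowno_iff[OF i] by (auto simp: image_iff) metis
  also have "card \<dots> = card {b. rowno i b < m \<and> depth i < part Y (rowno i b)}"
    by (rule card_image) (auto intro!: inj_onI simp: rowno_inj)
  finally show ?thesis .
qed

lemma shape_Young: "shape (part Y) (dsum_dim n (row_strings Y))"
proof -
  have "k < dsum_dim n (row_strings Y) i \<longleftrightarrow> depth i < part Y (rowno i k)" if i: "i \<in> vertices n" for i k
  proof -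
    let ?A = "{b. depth i < part Y (rowno i b)}"
    have lt: "rowno i b < length Y" if "depth i < part Y (rowno i b)" for b
      using that by (auto simp: part_def split: if_splits)
    have "dsum_dim n (row_strings Y) i = (\<Sum>k<length Y. string_dim n (row_strings Y ! k) i)"
      using i by (simp add: dsum_dim_def sum_list_sum_nth row_strings_def lessThan_atLeast0)
    also have "\<dots> = card {b. rowno i b < length Y \<and> depth i < part Y (rowno i b)}"
      by (rule count_rows[OF i order_refl])
    also have "{b. rowno i b < length Y \<and> depth i < part Y (rowno i b)} = ?A" using lt by blast
    finally have d: "dsum_dim n (row_strings Y) i = card ?A" .
    have "b \<le> rowno i b" for b by (auto simp: rowno_def)
    then have "?A \<subseteq> {..<length Y}" using lt by (fastforce intro: le_less_trans)
    then have "finite ?A" by (rule finite_subset) simp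
    moreover have "b' \<in> ?A" if "b \<in> ?A" "b' \<le> b" for b b'
      using that part_antimono[of "rowno i b'" "rowno i b"] by (auto simp: rowno_mono)
    ultimately have "k \<in> ?A \<longleftrightarrow> k < card ?A" by (rule down_closed_nat_set)
    then show ?thesis unfolding d by simp
  qed
  then show ?thesis using part_dec part_le by (simp add: shape_def)
qed

text \<open>A string occupies the boxes of a row.  At each vertex the boxes come in the order of their rows on
both sides, so the two representations agree without any base change.\<close>

lemma dsum_rep_row_strings: "dsum_rep n (row_strings Y) = proj_Omega n (dsum_dim n (row_strings Y)) (std_rep (dsum_dim n (row_strings Y)))"
proof
  fix h
  define v where "v = dsum_dim n (row_strings Y)"
  have sh: "shape (part Y) v" unfolding v_def by (rule shape_Young)
  note mem = shape_mem[OF sh]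
  show "dsum_rep n (row_strings Y) h = proj_Omega n (dsum_dim n (row_strings Y)) (std_rep (dsum_dim n (row_strings Y))) h"
  proof (cases "h \<in> edges n")
    case False then show ?thesis by (simp add: dsum_rep_def proj_Omega_def)
  next
    case True
    note st = edges_endpoints[OF True n4]
    let ?Bs = "map (\<lambda>a. string_rep n a h) (row_strings Y)"
    have len: "length (row_strings Y) = length Y" by (simp add: row_strings_def)
    have dims: "dim_row (string_rep n a h) = string_dim n a (target h)"
      "dim_col (string_rep n a h) = string_dim n a (source h)" for a
      using True by (simp_all add: string_rep_def)
    have dr: "dim_row (diag_block_mat ?Bs) = v (target h)" "dim_col (diag_block_mat ?Bs) = v (source h)"
      using st by (simp_all add: dim_diag_block_mat comp_def dims v_def dsum_dim_def)
    show ?thesis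
    proof (rule eq_matI)
      fix a c
      assume "a < dim_row (proj_Omega n (dsum_dim n (row_strings Y)) (std_rep (dsum_dim n (row_strings Y))) h)"
        "c < dim_col (proj_Omega n (dsum_dim n (row_strings Y)) (std_rep (dsum_dim n (row_strings Y))) h)"
      then have ac: "a < v (target h)" "c < v (source h)"
        using True by (auto simp: proj_Omega_def std_rep_def v_def split: if_splits)
      define P where "P i k \<longleftrightarrow> label k (depth i) = i \<and> depth i < part Y k" for i k
      \<comment> \<open>The number of boxes at \<open>i\<close> in the rows above the \<open>b\<close>-th box is \<open>b\<close>.\<close>
      have count: "(\<Sum>e<k. string_dim n (row_strings Y ! e) i) = b"
        if "i \<in> vertices n" "k = rowno i b" "P i k" for i k b
      proof -
        have k: "k \<le> length Y" using that(3) by (auto simp: P_def part_def split: if_splits)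
        have "{b'. rowno i b' < k \<and> depth i < part Y (rowno i b')} = {..<b}"
        proof -
          have "rowno i b' < k \<longleftrightarrow> b' < b" for b'
            unfolding that(2) using rowno_mono[of i b b'] by (meson not_le)
          moreover have "depth i < part Y (rowno i b')" if "b' < b" for b'
            using part_antimono[of "rowno i b'" k] rowno_mono[of i b' b] that \<open>k = rowno i b\<close> \<open>P i k\<close>
            by (simp add: P_def)
          ultimately show ?thesis by auto
        qed
        then show ?thesis using count_rows[OF that(1) k] by simp
      qed
      have P_row: "P i (rowno i b)" if "i \<in> vertices n" "b < v i" for i b
        using mem[OF that(1)] that label_rowno[OF that(1)] by (auto simp: P_def)
      have row_P: "\<exists>b. k = rowno i b" if "i \<in> vertices n" "P i k" for i k
        using ex_rowno_iff[OF that(1), of k] that(2) by (auto simp: P_def)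
      have "dsum_rep n (row_strings Y) h $$ (a, c) = (\<Sum>k<length Y.
        if string_dim n (row_strings Y ! k) (target h) = 1 \<and> string_dim n (row_strings Y ! k) (source h) = 1 \<and>
           a = (\<Sum>e<k. string_dim n (row_strings Y ! e) (target h)) \<and> c = (\<Sum>e<k. string_dim n (row_strings Y ! e) (source h))
        then string_rep n (row_strings Y ! k) h $$ (0, 0) else 0)"
      proof -
        have "dsum_rep n (row_strings Y) h = diag_block_mat ?Bs" using True by (simp add: dsum_rep_def)
        moreover have "diag_block_mat ?Bs $$ (a, c) = (\<Sum>k<length ?Bs.
           if dim_row (?Bs ! k) = 1 \<and> dim_col (?Bs ! k) = 1 \<and>
             a = (\<Sum>e<k. dim_row (?Bs ! e)) \<and> c = (\<Sum>e<k. dim_col (?Bs ! e))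
           then (?Bs ! k) $$ (0, 0) else 0)"
          by (rule diag_block_mat_entry) (use ac dr in \<open>auto simp: dims string_dim_def\<close>)
        ultimately show ?thesis by (simp add: len dims cong: if_cong)
      qed
      also have "\<dots> = (\<Sum>k<length Y. if P (target h) k \<and> P (source h) k \<and>
           k = rowno (target h) a \<and> k = rowno (source h) c
         then string_rep n (row_strings Y ! k) h $$ (0, 0) else 0)"
      proof (intro sum.cong refl if_cong)
        fix k assume "k \<in> {..<length Y}"
        then have k: "k < length Y" by simp
        have sd: "string_dim n (row_strings Y ! k) i = 1 \<longleftrightarrow> P i k" if "i \<in> vertices n" for i
          using string_dim_row_strings[OF that k] by (simp add: P_def)
        have idx: "b = (\<Sum>e<k. string_dim n (row_strings Y ! e) i) \<longleftrightarrow> k = rowno i b"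
          if "i \<in> vertices n" "P i k" for i b
          using row_P[OF that] count[OF that(1) _ that(2)] by auto
        show "(string_dim n (row_strings Y ! k) (target h) = 1 \<and> string_dim n (row_strings Y ! k) (source h) = 1 \<and>
           a = (\<Sum>e<k. string_dim n (row_strings Y ! e) (target h)) \<and> c = (\<Sum>e<k. string_dim n (row_strings Y ! e) (source h)))
          \<longleftrightarrow> (P (target h) k \<and> P (source h) k \<and> k = rowno (target h) a \<and> k = rowno (source h) c)"
          using idx st sd by blast
      qed
      also have "\<dots> = (if rowno (target h) a = rowno (source h) c then
          string_rep n (row_strings Y ! rowno (target h) a) h $$ (0, 0) else 0)"
      proof (cases "rowno (target h) a = rowno (source h) c")
        case eq: True
        have "P (target h) (rowno (target h) a)" "P (source h) (rowno (target h) a)"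
          using P_row st ac eq by metis+
        moreover have "rowno (target h) a < length Y"
          using calculation(1) by (auto simp: P_def part_def split: if_splits)
        moreover have "(P (target h) k \<and> P (source h) k \<and> k = rowno (target h) a \<and> k = rowno (source h) c)
            \<longleftrightarrow> k = rowno (target h) a" for k
          using calculation(1,2) eq by auto
        ultimately show ?thesis using eq by simp
      next
        case False
        then show ?thesis by (auto intro!: sum.neutral)
      qed
      also have "\<dots> = proj_Omega n v (std_rep v) h $$ (a, c)"
      proof (cases "rowno (target h) a = rowno (source h) c")
        case eq: True
        let ?k = "rowno (target h) a"
        have PP: "P (target h) ?k" "P (source h) ?k" using P_row st ac eq by metis+
        then have k: "?k < length Y" by (auto simp: P_def part_def split: if_splits)
        have sd: "string_dim n (row_strings Y ! ?k) (target h) = 1" "string_dim n (row_strings Y ! ?k) (source h) = 1"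
          using string_dim_row_strings[OF _ k] PP st by (simp_all add: P_def)
        have AYk: "row_strings Y ! ?k = row_string (row_end ?k) (Y ! ?k)" using k by (simp add: row_strings_def)
        have "h \<in> string_arrows n (row_strings Y ! ?k) \<longleftrightarrow> h \<in> Omega n"
        proof
          assume "h \<in> Omega n"
          then show "h \<in> string_arrows n (row_strings Y ! ?k)"
            unfolding AYk using Young_nth[OF k] sd[unfolded AYk] by (intro string_arrow_row_string) auto
        next
          have "1 \<le> Y ! ?k" "Y ! ?k \<le> n - 1" using Young_nth[OF k] by auto
          moreover assume "h \<in> string_arrows n (row_strings Y ! ?k)"
          ultimately show "h \<in> Omega n" unfolding AYk using n4
            by (auto simp: string_arrows_def row_string_def Omega_def split: if_splits)
        qed
        then show ?thesis using True ac eq sd by (simp add: string_rep_def proj_Omega_def std_rep_def row_step_def)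
      next
        case False
        then show ?thesis using True ac by (simp add: proj_Omega_def std_rep_def row_step_def)
      qed
      finally show "dsum_rep n (row_strings Y) h $$ (a, c) =
          proj_Omega n (dsum_dim n (row_strings Y)) (std_rep (dsum_dim n (row_strings Y))) h $$ (a, c)"
        by (simp add: v_def)
    qed (use dr True in \<open>auto simp: dsum_rep_def proj_Omega_def std_rep_def v_def\<close>)
  qed
qed

end

text \<open>The boxes at one vertex are filled from the top, so their number tells which of them belong to the
diagram.\<close>

lemma shape_determines_rows:
  assumes "shape l v" "shape l' v"
  shows "l = l'"
proof
  fix r
  have "d < l r \<longleftrightarrow> d < l' r" for d
  proof (cases "d \<le> n - 2")
    case True
    obtain k where k: "rowno (label r d) k = r" using ex_rowno[OF True] by blast
    then show ?thesis
      using shape_mem[OF assms(1) label_vertices[OF True], of k r] shape_mem[OF assms(2) label_vertices[OF True], of k r]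
      by (simp add: depth_label[OF True])
  next
    case False
    then have "\<not> d < l r" "\<not> d < l' r"
      using shape_bound[OF assms(1), of r] shape_bound[OF assms(2), of r] n4 by linarith+
    then show ?thesis by simp
  qed
  then show "l r = l' r" by (meson linorder_neq_iff)
qed

lemma shape_determines_dim:
  assumes "shape l v" "shape l v'" "i \<in> vertices n"
  shows "v i = v' i"
  using shape_mem[OF assms(1,3)] shape_mem[OF assms(2,3)] by (meson linorder_neq_iff)

lemma part_inj:
  assumes "Y \<in> Young n" "Y' \<in> Young n" "part Y = part Y'"
  shows "Y = Y'"
proof -
  have pos: "part Y r > 0 \<longleftrightarrow> r < length Y" if "Y \<in> Young n" for Y r
    using Young_nth[OF that, of r] by (auto simp: part_def)
  have "r < length Y \<longleftrightarrow> r < length Y'" for r using pos[OF assms(1)] pos[OF assms(2)] assms(3) by metis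
  then have len: "length Y = length Y'" by (meson linorder_neq_iff)
  show ?thesis
  proof (rule nth_equalityI[OF len])
    fix r assume "r < length Y"
    then show "Y ! r = Y' ! r" using fun_cong[OF assms(3), of r] len by (simp add: part_def)
  qed
qed

lemma ex_Young_of_shape:
  assumes sh: "shape l v"
  shows "\<exists>Y\<in>Young n. part Y = l"
proof -
  define m where "m = (LEAST m. l m = 0)"
  have "l n = 0" using shape_bound[OF sh, of n] by simp
  then have m0: "l m = 0" unfolding m_def by (rule LeastI)
  have "l (m + k) = 0" for k
  proof (induction k)
    case (Suc k) then show ?case using shape_dec[OF sh, of "m + k"] by simp
  qed (use m0 in simp)
  then have zero: "l r = 0" if "m \<le> r" for r using that le_Suc_ex by metis
  have pos: "l r > 0" if "r < m" for r using that not_less_Least[of r "\<lambda>m. l m = 0"] unfolding m_def by auto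
  have less: "l (a + Suc k) < l a" if "a + Suc k < m" for a k
    using that
  proof (induction k)
    case 0 then show ?case using shape_dec[OF sh, of a] pos[of a] by simp
  next
    case (Suc k) then show ?case using shape_dec[OF sh, of "a + Suc k"] by simp
  qed
  let ?Y = "map l [0..<m]"
  have "sorted_wrt (>) ?Y"
    unfolding sorted_wrt_iff_nth_less
  proof (intro allI impI)
    fix a b assume "a < b" "b < length ?Y"
    then show "?Y ! b < ?Y ! a" using less[of a "b - a - 1"] by simp
  qed
  moreover have "set ?Y \<subseteq> {1..n - 1}"
  proof
    fix z assume "z \<in> set ?Y"
    then obtain r where "r < m" "z = l r" by auto
    then show "z \<in> {1..n - 1}" using pos[of r] shape_bound[OF sh, of r] by auto
  qed
  ultimately have "?Y \<in> Young n" by (simp add: Young_def)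
  moreover have "part ?Y = l" using zero by (auto simp: part_def fun_eq_iff)
  ultimately show ?thesis by blast
qed

end


section \<open>Irreducible components\<close>

context spin_vertex
begin

abbreviation wt :: "nat \<Rightarrow> nat" where "wt \<equiv> fund_weight n s"

lemma quiver_var_at_most_one_point: "topspace (quiver_var n v wt) \<subseteq> {orbit_fr n v (std_rep v, std_fr v)}"
proof -
  have "orbit_fr n v p = orbit_fr n v (std_rep v, std_fr v)" if p: "p \<in> Lambda_st n v wt" for p
  proof -
    obtain x j where xj: "p = (x, j)" by (cases p)
    obtain g where "g \<in> G n v" "act_fr n v g p = (std_rep v, std_fr v)"
      using stable_normal_form[of x j v] p unfolding xj by blast
    moreover have "p \<in> E n v \<times> Hom_VW n v wt" using p by (auto simp: Lambda_st_def Lambda_V_def)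
    ultimately show ?thesis using orbit_fr_act_fr[OF n4] by metis
  qed
  then show ?thesis unfolding topspace_quiver_var by auto
qed

lemma Young_of_nonempty:
  assumes v: "v \<in> dimvecs n" and ne: "topspace (quiver_var n v wt) \<noteq> {}"
  shows "\<exists>Y\<in>Young n. dsum_dim n (row_strings Y) = v"
proof -
  obtain x j where "(x, j) \<in> Lambda_st n v wt" using ne unfolding topspace_quiver_var by auto
  then obtain l where l: "shape l v" using stable_normal_form by blast
  then obtain Y where Y: "Y \<in> Young n" "part Y = l" using ex_Young_of_shape by blast
  have "dsum_dim n (row_strings Y) = v"
  proof
    fix i
    show "dsum_dim n (row_strings Y) i = v i"
      using shape_determines_dim[OF shape_Young[OF Y(1)], of v i] l Y(2) v
      by (cases "i \<in> vertices n") (auto simp: dsum_dim_def dimvecs_def)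
  qed
  then show ?thesis using Y by blast
qed

lemma dsum_dim_dimvecs: "dsum_dim n as \<in> dimvecs n"
  by (auto simp: dsum_dim_def dimvecs_def)

lemma dsum_dim_inj:
  assumes "Y \<in> Young n" "Y' \<in> Young n" "dsum_dim n (row_strings Y) = dsum_dim n (row_strings Y')"
  shows "Y = Y'"
  using shape_determines_rows[OF shape_Young[OF assms(1)], of "part Y'"] shape_Young[OF assms(2)]
    part_inj[OF assms(1,2)] assms(3) by simp

lemma act_one:
  assumes "x \<in> E n v"
  shows "act n v (\<lambda>i\<in>vertices n. 1\<^sub>m (v i)) x = x"
proof
  fix h
  show "act n v (\<lambda>i\<in>vertices n. 1\<^sub>m (v i)) x h = x h"
  proof (cases "h \<in> edges n")
    case True
    then show ?thesis
      using edges_endpoints[OF True n4] E_carrier[OF assms True] by (simp add: act_def GL_one(2))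
  next
    case False
    then show ?thesis using PiE_arb[OF assms[unfolded E_def] False] by (simp add: act_def)
  qed
qed

lemma std_conormal:
  assumes Y: "Y \<in> Young n" and v: "v = dsum_dim n (row_strings Y)"
  shows "std_rep v \<in> conormal n v (iso_class n v (row_strings Y))"
proof (rule conormal_of_psi_eq_0[OF n4 std_rep_E])
  have sh: "shape (part Y) v" unfolding v by (rule shape_Young[OF Y])
  show "psi n v i (std_rep v) = 0\<^sub>m (v i) (v i)" if "i \<in> vertices n" for i
    by (rule psi_std_rep[OF sh that])
  have pO: "proj_Omega n v (std_rep v) = dsum_rep n (row_strings Y)"
    unfolding v by (rule dsum_rep_row_strings[OF Y, symmetric])
  have E: "proj_Omega n v (std_rep v) \<in> E_Omega n v"
    using E_carrier[OF std_rep_E] by (auto simp: E_Omega_def proj_Omega_def E_def)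
  have "(\<lambda>i\<in>vertices n. 1\<^sub>m (v i)) \<in> G n v" by (auto simp: G_def intro: GL_one(1))
  then have "rep_iso n v (proj_Omega n v (std_rep v)) (proj_Omega n v (std_rep v))"
    using act_one[of "proj_Omega n v (std_rep v)" v] E unfolding rep_iso_def E_Omega_def by force
  then show "proj_Omega n v (std_rep v) \<in> iso_class n v (row_strings Y)"
    using E by (simp add: iso_class_def pO)
  show "rep_iso n v (proj_Omega n v (std_rep v)) y" if "y \<in> iso_class n v (row_strings Y)" for y
    using that by (simp add: iso_class_def pO)
qed

text \<open>The standard point is conormal to its orbit, so \<open>X\<^sub>\<O>\<close> contains the only point of the quiver
variety.\<close>

lemma X_orb_eq_topspace:
  assumes Y: "Y \<in> Young n" and v: "v = dsum_dim n (row_strings Y)"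
  shows "topspace (quiver_var n v wt) = {orbit_fr n v (std_rep v, std_fr v)}"
    and "X_orb n v wt (iso_class n v (row_strings Y)) = topspace (quiver_var n v wt)"
proof -
  have sh: "shape (part Y) v" unfolding v by (rule shape_Young[OF Y])
  note L = std_Lambda_st[OF sh]
  then show top: "topspace (quiver_var n v wt) = {orbit_fr n v (std_rep v, std_fr v)}"
    using quiver_var_at_most_one_point[of v] unfolding topspace_quiver_var by blast
  let ?C = "conormal n v (iso_class n v (row_strings Y))"
  have "?C \<subseteq> zariski (coords_E n v) (E n v) closure_of ?C"
    by (rule closure_of_subset) (auto simp: topspace_zariski conormal_def)
  then have "std_rep v \<in> zariski (coords_E n v) (E n v) closure_of ?C"
    using std_conormal[OF Y v] by blast
  then have "orbit_fr n v (std_rep v, std_fr v) \<in> X_orb n v wt (iso_class n v (row_strings Y))"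
    unfolding X_orb_def using L by (intro imageI) (auto simp: Lambda_st_def)
  moreover have "X_orb n v wt (iso_class n v (row_strings Y)) \<subseteq> topspace (quiver_var n v wt)"
    unfolding X_orb_def topspace_quiver_var by blast
  ultimately show "X_orb n v wt (iso_class n v (row_strings Y)) = topspace (quiver_var n v wt)"
    unfolding top by blast
qed

theorem components_quiver_var:
  assumes v: "v \<in> dimvecs n"
  shows "irreducible_components (quiver_var n v wt) =
    {X_orb n v wt (iso_class n v (row_strings Y)) | Y. Y \<in> Young n \<and> dsum_dim n (row_strings Y) = v}"
proof -
  have comp: "irreducible_components (quiver_var n v wt) = (\<lambda>p. {p}) ` topspace (quiver_var n v wt)"
  proof (rule irreducible_components_discrete)
    fix U assume "U \<subseteq> topspace (quiver_var n v wt)"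
    then have "U = {} \<or> U = topspace (quiver_var n v wt)" using quiver_var_at_most_one_point[of v] by blast
    then show "openin (quiver_var n v wt) U" by auto
  qed
  show ?thesis
  proof (cases "topspace (quiver_var n v wt) = {}")
    case True
    then have "\<not> (Y \<in> Young n \<and> dsum_dim n (row_strings Y) = v)" for Y
      using X_orb_eq_topspace(1)[of Y v] by blast
    then show ?thesis unfolding comp True by blast
  next
    case False
    then obtain Y where "Y \<in> Young n" "dsum_dim n (row_strings Y) = v" using Young_of_nonempty[OF v] by blast
    moreover have "X_orb n v wt (iso_class n v (row_strings Y')) = {orbit_fr n v (std_rep v, std_fr v)}"
      if "Y' \<in> Young n" "dsum_dim n (row_strings Y') = v" for Y'
      using X_orb_eq_topspace[OF that(1), of v] that(2) by simp
    moreover have "topspace (quiver_var n v wt) = {orbit_fr n v (std_rep v, std_fr v)}"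
      using X_orb_eq_topspace(1)[OF calculation(1), of v] calculation(2) by simp
    ultimately show ?thesis unfolding comp by auto
  qed
qed

theorem bij_betw_Young_components:
  "bij_betw (\<lambda>Y. X_strings n wt (row_strings Y)) (Young n)
     (irreducible_components (sum_topology (\<lambda>v. quiver_var n v wt) (dimvecs n)))"
proof -
  have X: "X_strings n wt (row_strings Y) =
      {(dsum_dim n (row_strings Y), orbit_fr n (dsum_dim n (row_strings Y)) (std_rep (dsum_dim n (row_strings Y)), std_fr (dsum_dim n (row_strings Y))))}"
    if "Y \<in> Young n" for Y
    using X_orb_eq_topspace[OF that refl] by (simp add: X_strings_def)
  have comp: "irreducible_components (sum_topology (\<lambda>v. quiver_var n v wt) (dimvecs n)) =
      (\<lambda>p. {p}) ` (SIGMA v:dimvecs n. topspace (quiver_var n v wt))"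
    by (rule irreducible_components_sum_topology) (use quiver_var_at_most_one_point in blast)
  show ?thesis
  proof (rule bij_betwI')
    fix Y Y' assume "Y \<in> Young n" "Y' \<in> Young n"
    then show "X_strings n wt (row_strings Y) = X_strings n wt (row_strings Y') \<longleftrightarrow> Y = Y'"
      using dsum_dim_inj by (auto simp: X)
  next
    fix Y assume Y: "Y \<in> Young n"
    then show "X_strings n wt (row_strings Y) \<in> irreducible_components (sum_topology (\<lambda>v. quiver_var n v wt) (dimvecs n))"
      unfolding comp X[OF Y] using X_orb_eq_topspace(1)[OF Y refl] dsum_dim_dimvecs by blast
  next
    fix T assume "T \<in> irreducible_components (sum_topology (\<lambda>v. quiver_var n v wt) (dimvecs n))"
    then obtain v p where T: "T = {(v, p)}" "v \<in> dimvecs n" "p \<in> topspace (quiver_var n v wt)"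
      unfolding comp by auto
    then obtain Y where Y: "Y \<in> Young n" "dsum_dim n (row_strings Y) = v" using Young_of_nonempty by blast
    then have "p = orbit_fr n v (std_rep v, std_fr v)" using T(3) X_orb_eq_topspace(1)[OF Y(1), of v] by simp
    then show "\<exists>Y\<in>Young n. T = X_strings n wt (row_strings Y)" using X[OF Y(1)] T(1) Y by auto
  qed
qed

end

theorem theorem4p1:
  fixes n :: nat
  assumes "n \<ge> 4"
  shows "(\<forall>v \<in> dimvecs n.
      irreducible_components (quiver_var n v (fund_weight n n)) =
        {X_orb n v (fund_weight n n) (iso_class n v (AY_plus n Y)) | Y.
           Y \<in> Young n \<and> dsum_dim n (AY_plus n Y) = v}) \<and>
    (\<forall>v \<in> dimvecs n.
      irreducible_components (quiver_var n v (fund_weight n (n - 1))) =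
        {X_orb n v (fund_weight n (n - 1)) (iso_class n v (AY_minus n Y)) | Y.
           Y \<in> Young n \<and> dsum_dim n (AY_minus n Y) = v}) \<and>
    bij_betw (\<lambda>Y. X_strings n (fund_weight n n) (AY_plus n Y)) (Young n)
      (irreducible_components
        (sum_topology (\<lambda>v. quiver_var n v (fund_weight n n)) (dimvecs n))) \<and>
    bij_betw (\<lambda>Y. X_strings n (fund_weight n (n - 1)) (AY_minus n Y)) (Young n)
      (irreducible_components
        (sum_topology (\<lambda>v. quiver_var n v (fund_weight n (n - 1))) (dimvecs n)))"
proof -
  interpret plus: spin_vertex n n by unfold_locales (use assms in auto)
  interpret minus: spin_vertex n "n - 1" by unfold_locales (use assms in auto)
  have "2 * n - 1 - n = n - 1" "2 * n - 1 - (n - 1) = n" using assms by auto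
  then have "plus.row_end k = (if even k then n else n - 1)" "minus.row_end k = (if even k then n - 1 else n)" for k
    unfolding plus.row_end_def minus.row_end_def by (simp_all only:)
  moreover have "n - 1 \<noteq> n" using assms by simp
  ultimately have "plus.row_string (plus.row_end k) l = A_plus n (k + 1) l" "minus.row_string (minus.row_end k) l = A_minus n (k + 1) l" for k l
    unfolding plus.row_string_def minus.row_string_def A_plus_def A_minus_def by simp_all
  then have "plus.row_strings = AY_plus n" "minus.row_strings = AY_minus n"
    unfolding fun_eq_iff plus.row_strings_def minus.row_strings_def AY_plus_def AY_minus_def by simp_all
  then show ?thesis
    using plus.components_quiver_var minus.components_quiver_var
      plus.bij_betw_Young_components minus.bij_betw_Young_components by (simp only:) blast
qed

end
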